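(* For each quasi-periodic labelling $\rho$, the group $G_\rho$ is uniformly simple.
   Context: For an element $g$ of a group $G$ let $C_g$ be its conjugacy class. $G$ is $N$-uniformly simple if for all non-trivial $f,g\in G$ the element $f$ is a product of at most $N$ elements of $C_g\cup C_{g^{-1}}$. $G$ is uniformly simple if it is $N$-uniformly simple for some natural number $N$. Maps act on the right: $x\cdot f$ is the image of $x$ under $f$, and $fg$ means first $f$, then $g$. $\mathrm{Supp}(f)=\{x : x\cdot f\neq x\}$. Thompson's group $F$ is the group of piecewise linear orientation-preserving homeomorphisms of $[0,1]$ that are differentiable except at finitely many dyadic rationals and whose derivatives, where they exist, are integer powers of $2$; $F'=[F,F]$. For dyadic rationals $0\le r<s\le 1$, $F_{[r,s]}$ is the subgroup of elements of $F$ with support in $[r,s]$. Let $\iota_0$ be the map $t\mapsto 1-t$ of $[0,1]$. Fix $c_0\in F$ with $\mathrm{Supp}(c_0)=(0,\tfrac14)$, $x\cdot c_0>x$ for all $x\in(0,\tfrac14)$, and $t\cdot c_0=2t$ for $t\in(0,\tfrac1{16})$. Put $c_1=\iota_0 c_0\iota_0$ and $\nu_1=c_0c_1$. Fix homeomorphisms $\nu_2,\nu_3$ of $[0,1]$ with supports in $(\tfrac1{16},\tfrac{15}{16})$ that generate $F_{[1/16,15/16]}$. Let $H=\langle F',\nu_1\rangle=\langle \nu_1,\nu_2,\nu_3\rangle$. A labelling is a map $\rho:\tfrac12\mathbf{Z}\to\{a,b,a^{-1},b^{-1}\}$ with $\rho(k)\in\{a,a^{-1}\}$ for $k\in\mathbf{Z}$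 and $\rho(k)\in\{b,b^{-1}\}$ for $k\in\tfrac12\mathbf{Z}\setminus\mathbf{Z}$. A block is a set $X=\{k,k+\tfrac12,\ldots,k+\tfrac12 n\}$ with $k\in\tfrac12\mathbf{Z}$, $n\in\mathbf{N}$; its word is $W_\rho(X)=\rho(k)\rho(k+\tfrac12)\cdots\rho(k+\tfrac12n)$, and $W_\rho^{-1}(X)$ is the formal inverse word (reverse the order and invert each letter). The labelling $\rho$ is quasi-periodic if (1) for each block $X$ there is $n\in\mathbf{N}$ such that for every block $Y$ of size at least $n$, $W_\rho(X)$ is a subword (string of consecutive letters) of $W_\rho(Y)$; and (2) for each block $X$ there is a block $Y$ with $W_\rho(Y)=W_\rho^{-1}(X)$. For a labelling $\rho$ and $i\in\{1,2,3\}$ define homeomorphisms $\zeta_i,\chi_i$ of $\mathbf{R}$ by: for $n\in\mathbf{Z}$, $t\in[0,1]$, $(n+t)\cdot\zeta_i=n+t\cdot\nu_i$ if $\rho(n+\tfrac12)=b$ and $(n+t)\cdot\zeta_i=n+t\cdot(\iota_0\nu_i\iota_0)$ if $\rho(n+\tfrac12)=b^{-1}$; $(n-\tfrac12+t)\cdot\chi_i=n-\tfrac12+t\cdot\nu_i$ if $\rho(n)=a$ and $(n-\tfrac12+t)\cdot\chi_i=n-\tfrac12+t\cdot(\iota_0\nu_i\iota_0)$ if $\rho(n)=a^{-1}$. Then $G_\rho=\langle\zeta_1,\zeta_2,\zeta_3,\chi_1,\chi_2,\chi_3\rangle<\mathrm{Homeo}^+(\mathbf{R})$. *)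

theory Defs
  imports "HOL-Analysis.Analysis" "HOL-Algebra.Generated_Groups" "HOL-Library.Sublist"
begin

section \<open>Uniform simplicity\<close>

definition conj_class :: "('a, 'm) monoid_scheme \<Rightarrow> 'a \<Rightarrow> 'a set" where
  "conj_class G g = {inv\<^bsub>G\<^esub> h \<otimes>\<^bsub>G\<^esub> g \<otimes>\<^bsub>G\<^esub> h | h. h \<in> carrier G}"

definition N_uniformly_simple :: "nat \<Rightarrow> ('a, 'm) monoid_scheme \<Rightarrow> bool" where
  "N_uniformly_simple N G \<longleftrightarrow> group G \<and>
     (\<forall>f \<in> carrier G - {\<one>\<^bsub>G\<^esub>}. \<forall>g \<in> carrier G - {\<one>\<^bsub>G\<^esub>}.
        \<exists>gs. length gs \<le> N \<and> set gs \<subseteq> conj_class G g \<union> conj_class G (inv\<^bsub>G\<^esub> g) \<and>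
             f = foldr (\<otimes>\<^bsub>G\<^esub>) gs \<one>\<^bsub>G\<^esub>)"

definition uniformly_simple :: "('a, 'm) monoid_scheme \<Rightarrow> bool" where
  "uniformly_simple G \<longleftrightarrow> (\<exists>N. N_uniformly_simple N G)"


section \<open>Groups of homeomorphisms\<close>

text \<open>
  A homeomorphism of a set \<open>S\<close> of reals is represented by its extension to all reals by the
  identity outside \<open>S\<close>. Maps act on the right, so the product of \<open>f\<close> and \<open>g\<close> applies \<open>f\<close>
  first: \<^term>\<open>fcomp f g = (\<lambda>x. g (f x))\<close>.
\<close>

definition homeo_plus :: "real set \<Rightarrow> (real \<Rightarrow> real) monoid" where
  "homeo_plus S =
     \<lparr>carrier = {f. (\<exists>g. homeomorphism S S f g) \<and> strict_mono_on S f \<and> (\<forall>x. x \<notin> S \<longrightarrow> f x = x)},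
      mult = fcomp, one = id\<rparr>"

definition supp :: "(real \<Rightarrow> real) \<Rightarrow> real set" where
  "supp f = {x. f x \<noteq> x}"

lemma group_homeo_plus: "group (homeo_plus S)"
proof (rule groupI)
  fix f g assume "f \<in> carrier (homeo_plus S)" "g \<in> carrier (homeo_plus S)"
  then obtain f' g' where *: "homeomorphism S S f f'" "homeomorphism S S g g'"
      "strict_mono_on S f" "strict_mono_on S g"
      "\<forall>x. x \<notin> S \<longrightarrow> f x = x" "\<forall>x. x \<notin> S \<longrightarrow> g x = x"
    by (auto simp: homeo_plus_def)
  have "homeomorphism S S (g \<circ> f) (f' \<circ> g')"
    using homeomorphism_compose[OF *(1,2)] .
  moreover have "strict_mono_on S (g \<circ> f)"
    using * unfolding strict_mono_on_def homeomorphism_def by (metis comp_apply imageI)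
  ultimately show "f \<otimes>\<^bsub>homeo_plus S\<^esub> g \<in> carrier (homeo_plus S)"
    using * by (auto simp: homeo_plus_def fcomp_comp)
next
  have "homeomorphism S S id id" by (simp add: homeomorphism_def)
  then show "\<one>\<^bsub>homeo_plus S\<^esub> \<in> carrier (homeo_plus S)"
    by (auto simp: homeo_plus_def strict_mono_on_def)
next
  fix f assume "f \<in> carrier (homeo_plus S)"
  then obtain g where *: "homeomorphism S S f g" "strict_mono_on S f" "\<forall>x. x \<notin> S \<longrightarrow> f x = x"
    by (auto simp: homeo_plus_def)
  define h where "h = (\<lambda>x. if x \<in> S then g x else x)"
  have "homeomorphism S S h f"
    using homeomorphism_symD[OF *(1)] by (rule homeomorphism_cong) (auto simp: h_def)
  moreover have "strict_mono_on S h"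
    unfolding strict_mono_on_def
  proof (intro allI impI)
    fix r s assume rs: "r \<in> S \<and> s \<in> S \<and> r < s"
    have "f (g r) = r" "f (g s) = s" "g r \<in> S" "g s \<in> S"
      using *(1) rs by (auto simp: homeomorphism_def)
    then have "g r < g s"
      using rs *(2) by (metis less_asym linorder_cases strict_mono_on_def)
    then show "h r < h s" using rs by (simp add: h_def)
  qed
  moreover have "fcomp h f = id"
    using * by (auto simp: fun_eq_iff h_def homeomorphism_def)
  ultimately show "\<exists>h\<in>carrier (homeo_plus S). h \<otimes>\<^bsub>homeo_plus S\<^esub> f = \<one>\<^bsub>homeo_plus S\<^esub>"
    by (intro bexI[of _ h]) (auto simp: homeo_plus_def h_def)
qed (auto simp: homeo_plus_def fcomp_assoc fun_eq_iff)


section \<open>Thompson's group F\<close>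

definition dyadic :: "real set" where
  "dyadic = {of_int m / 2 ^ k | m (k::nat). True}"

text \<open>Only used for continuous maps, so it suffices to look at the open linear pieces.\<close>

definition piecewise_linear01 :: "(real \<Rightarrow> real) \<Rightarrow> bool" where
  "piecewise_linear01 f \<longleftrightarrow> (\<exists>P. finite P \<and>
     (\<forall>u v. u < v \<longrightarrow> {u<..<v} \<subseteq> {0..1} - P \<longrightarrow>
        (\<exists>m c. \<forall>x\<in>{u<..<v}. f x = m * x + c)))"

definition thompson_F :: "(real \<Rightarrow> real) set" where
  "thompson_F = {f \<in> carrier (homeo_plus {0..1}). piecewise_linear01 f \<and>
     (\<exists>D. finite D \<and> D \<subseteq> dyadic \<and>
        (\<forall>x\<in>{0..1} - D. f differentiable (at x within {0..1}))) \<and>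
     (\<forall>x\<in>{0..1}. \<forall>d. (f has_real_derivative d) (at x within {0..1}) \<longrightarrow>
        (\<exists>k::int. d = 2 powi k))}"

definition F_on :: "real \<Rightarrow> real \<Rightarrow> (real \<Rightarrow> real) set" where
  "F_on r s = {f \<in> thompson_F. supp f \<subseteq> {r..s}}"

definition iota0 :: "real \<Rightarrow> real" where
  "iota0 t = (if t \<in> {0..1} then 1 - t else t)"

definition flip :: "(real \<Rightarrow> real) \<Rightarrow> real \<Rightarrow> real" where
  "flip f = fcomp iota0 (fcomp f iota0)"

definition nu1 :: "(real \<Rightarrow> real) \<Rightarrow> real \<Rightarrow> real" where
  "nu1 c0 = fcomp c0 (flip c0)"


section \<open>Labellings\<close>

definition half_ints :: "real set" where
  "half_ints = {x. 2 * x \<in> \<int>}"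

text \<open>The letters are \<open>a\<close>, \<open>b\<close> and their formal inverses.\<close>

datatype letter = La | Lb | La_inv | Lb_inv

fun letter_inv :: "letter \<Rightarrow> letter" where
  "letter_inv La = La_inv"
| "letter_inv Lb = Lb_inv"
| "letter_inv La_inv = La"
| "letter_inv Lb_inv = Lb"

text \<open>A labelling is a function on \<^const>\<open>half_ints\<close>; its values elsewhere are irrelevant.\<close>

definition labelling :: "(real \<Rightarrow> letter) \<Rightarrow> bool" where
  "labelling \<rho> \<longleftrightarrow> (\<forall>k\<in>\<int>. \<rho> k \<in> {La, La_inv}) \<and> (\<forall>k\<in>half_ints - \<int>. \<rho> k \<in> {Lb, Lb_inv})"

definition is_block :: "real set \<Rightarrow> bool" where
  "is_block X \<longleftrightarrow> (\<exists>k\<in>half_ints. \<exists>n::nat. X = {k + of_nat i / 2 | i. i \<le> n})"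

definition word :: "(real \<Rightarrow> letter) \<Rightarrow> real set \<Rightarrow> letter list" where
  "word \<rho> X = map \<rho> (sorted_list_of_set X)"

definition inverse_word :: "letter list \<Rightarrow> letter list" where
  "inverse_word w = map letter_inv (rev w)"

definition quasi_periodic :: "(real \<Rightarrow> letter) \<Rightarrow> bool" where
  "quasi_periodic \<rho> \<longleftrightarrow>
     (\<forall>X. is_block X \<longrightarrow> (\<exists>n::nat. \<forall>Y. is_block Y \<longrightarrow> card Y \<ge> n \<longrightarrow> sublist (word \<rho> X) (word \<rho> Y))) \<and>
     (\<forall>X. is_block X \<longrightarrow> (\<exists>Y. is_block Y \<and> word \<rho> Y = inverse_word (word \<rho> X)))"

lemma word_block:
  "word \<rho> {k + of_nat i / 2 | i. i \<le> n} = map (\<lambda>i. \<rho> (k + of_nat i / 2)) [0..<Suc n]"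
proof -
  let ?f = "\<lambda>i::nat. k + of_nat i / 2"
  have "sorted (map ?f [0..<Suc n])"
    by (subst sorted_map, rule sorted_wrt_mono_rel[OF _ sorted_upt]) auto
  moreover have "distinct (map ?f [0..<Suc n])"
    unfolding distinct_map by (auto simp: inj_on_def)
  moreover have "set (map ?f [0..<Suc n]) = {k + of_nat i / 2 | i. i \<le> n}"
    by (force simp: less_Suc_eq_le simp del: upt_Suc)
  ultimately have "sorted_list_of_set {k + of_nat i / 2 | i. i \<le> n} = map ?f [0..<Suc n]"
    by (metis sorted_list_of_set.idem_if_sorted_distinct)
  then show ?thesis by (simp add: word_def del: upt_Suc)
qed


section \<open>The group attached to a labelling\<close>

text \<open>
  With \<open>n = \<lfloor>x\<rfloor>\<close> one has \<open>x = n + t\<close> for some \<open>t\<close> in \<open>[0,1)\<close>, and with \<open>n = \<lfloor>x + 1/2\<rfloor>\<close>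
  one has \<open>x = n - 1/2 + t\<close>; the lemmas below cover the overlap at \<open>t = 1\<close>.
\<close>

definition zeta :: "(real \<Rightarrow> letter) \<Rightarrow> (real \<Rightarrow> real) \<Rightarrow> real \<Rightarrow> real" where
  "zeta \<rho> \<nu> x = (let n = real_of_int \<lfloor>x\<rfloor>; t = x - n in
     if \<rho> (n + 1/2) = Lb then n + \<nu> t else n + flip \<nu> t)"

definition chi :: "(real \<Rightarrow> letter) \<Rightarrow> (real \<Rightarrow> real) \<Rightarrow> real \<Rightarrow> real" where
  "chi \<rho> \<nu> x = (let n = real_of_int \<lfloor>x + 1/2\<rfloor>; t = x - (n - 1/2) in
     if \<rho> n = La then n - 1/2 + \<nu> t else n - 1/2 + flip \<nu> t)"

lemma zeta_eq:
  assumes "\<nu> 0 = 0" "\<nu> 1 = 1" "t \<in> {0..1}"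
  shows "zeta \<rho> \<nu> (real_of_int n + t) =
    (if \<rho> (real_of_int n + 1/2) = Lb then real_of_int n + \<nu> t else real_of_int n + flip \<nu> t)"
proof (cases "t = 1")
  case True
  then have "\<lfloor>real_of_int n + t\<rfloor> = n + 1" by simp
  then show ?thesis using True assms by (simp add: zeta_def flip_def iota0_def Let_def)
next
  case False
  then have "\<lfloor>real_of_int n + t\<rfloor> = n" using assms by (simp add: floor_unique)
  then show ?thesis by (simp add: zeta_def)
qed

lemma chi_eq:
  assumes "\<nu> 0 = 0" "\<nu> 1 = 1" "t \<in> {0..1}"
  shows "chi \<rho> \<nu> (real_of_int n - 1/2 + t) =
    (if \<rho> (real_of_int n) = La then real_of_int n - 1/2 + \<nu> t else real_of_int n - 1/2 + flip \<nu> t)"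
proof (cases "t = 1")
  case True
  then have "\<lfloor>real_of_int n - 1/2 + t + 1/2\<rfloor> = n + 1" by simp
  then show ?thesis using True assms
    by (simp add: chi_def flip_def iota0_def Let_def)
next
  case False
  then have "\<lfloor>real_of_int n - 1/2 + t + 1/2\<rfloor> = n" using assms by (intro floor_unique) auto
  then show ?thesis by (simp add: chi_def Let_def)
qed

definition G_rho :: "(real \<Rightarrow> letter) \<Rightarrow> (real \<Rightarrow> real) set \<Rightarrow> (real \<Rightarrow> real) monoid" where
  "G_rho \<rho> \<nu>s = (homeo_plus UNIV)
     \<lparr>carrier := generate (homeo_plus UNIV) (zeta \<rho> ` \<nu>s \<union> chi \<rho> ` \<nu>s)\<rparr>"

end

theory Submission
  imports Defs
begin

text \<open>
  Write \<open>G\<close> for the group of the labelling \<open>\<rho>\<close> and take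
  non-trivial \<open>f\<close>, \<open>g\<close> in \<open>G\<close>. Every element of
  \<open>G\<close> acts by a local rule: the way it moves a point depends only on the labels in
  a bounded neighbourhood. Conversely, a dyadic piecewise linear map of a bounded interval,
  repeated at all occurrences (in either direction) of a block of labels, belongs to
  \<open>G\<close> as soon as the copies are disjoint: enlarging the block amounts to taking
  commutators of two such rules, and compactly supported dyadic piecewise linear maps of an
  interval form a perfect group.

  Because a letter differs from its inverse, the reversal axiom prevents \<open>\<rho>\<close>
  from being periodic, so the occurrences of a long block around 0 are far apart, while
  quasi-periodicity bounds the gaps between them. One repeated map makes \<open>f\<close>
  trivial near all these occurrences, and the rest is a map repeated on intervals of finitely
  many kinds. Each of the two factors is a product of two commutators of maps of the same sort,
  whatever the number of commutators needed inside a single interval. Finally \<open>g\<close>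
  displaces some small interval and all its copies; conjugating the supports into these copies
  turns each commutator into a product of four conjugates of \<open>g\<close> and its inverse,
  sixteen in total.
\<close>

section \<open>Homeomorphisms of the line\<close>

text \<open>The bound must not depend on \<open>f\<close> or \<open>g\<close>, whereas the radius of
  the local rule, the number of commutators and the number of kinds of intervals do. Two devices
  remove them. A product of arbitrarily many commutators with entries in one compact set becomes a
  product of two, once some map pushes that set off itself for ever. And the recurrence length of
  the block displaced by \<open>g\<close> depends on \<open>g\<close> only; the marked points for
  \<open>f\<close> are taken at least that far apart, so each interval between them contains a
  displaced window. Perfectness is read off from the two generators of
  \<open>F_on (1/16) (15/16)\<close>: modulo commutators only exponent sums matter, and the slopes
  at the two ends detect these. Unit cells around neighbouring letters overlap in half a cell; on
  this overlap a commutator can test two words at once. The other obstacle is orientation: an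
  interval matched with itself by a reflection would admit only symmetric maps. Its midpoint is a
  letter position, and a letter differs from its inverse, so no such matching occurs.\<close>

definition Homeo :: "(real \<Rightarrow> real) set" where
  "Homeo = {f. strict_mono f \<and> surj f}"

abbreviation iv :: "('a \<Rightarrow> 'b) \<Rightarrow> 'b \<Rightarrow> 'a" where
  "iv f \<equiv> inv_into UNIV f"

lemma Homeo_bij: "f \<in> Homeo \<Longrightarrow> bij f"
  by (auto simp: Homeo_def bij_def strict_mono_imp_inj_on)

lemma Homeo_inj: "f \<in> Homeo \<Longrightarrow> f x = f y \<longleftrightarrow> x = y"
  by (metis Homeo_bij bij_pointE)

lemma Homeo_less: assumes "f \<in> Homeo" shows "f x < f y \<longleftrightarrow> x < y"
proof -
  have "strict_mono f" using assms by (simp add: Homeo_def)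
  then show ?thesis by (rule strict_mono_less)
qed

lemma Homeo_le: assumes "f \<in> Homeo" shows "f x \<le> f y \<longleftrightarrow> x \<le> y"
proof -
  have "strict_mono f" using assms by (simp add: Homeo_def)
  then show ?thesis by (rule strict_mono_less_eq)
qed

lemma iv_f [simp]: "f \<in> Homeo \<Longrightarrow> iv f (f x) = x"
  by (simp add: Homeo_bij bij_is_inj)

lemma f_iv: "f \<in> Homeo \<Longrightarrow> f (iv f x) = x"
  by (simp add: Homeo_def surj_f_inv_f)

lemma iv_eqI: "f \<in> Homeo \<Longrightarrow> f y = x \<Longrightarrow> iv f x = y"
  using iv_f by blast

lemma iv_fix: "f \<in> Homeo \<Longrightarrow> f x = x \<Longrightarrow> iv f x = x"
  by (rule iv_eqI)

lemma Homeo_id [simp]: "id \<in> Homeo"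
  by (auto simp: Homeo_def strict_mono_def)

lemma Homeo_comp [simp]: assumes "f \<in> Homeo" "g \<in> Homeo" shows "f \<circ> g \<in> Homeo"
proof -
  have "surj (f \<circ> g)" using assms comp_surj[of g f] by (simp add: Homeo_def)
  moreover have "strict_mono (f \<circ> g)"
    using assms by (simp add: Homeo_def strict_mono_def)
  ultimately show ?thesis by (simp add: Homeo_def)
qed

lemma Homeo_iv [simp]: assumes "f \<in> Homeo" shows "iv f \<in> Homeo"
proof -
  have "strict_mono (iv f)"
    unfolding strict_mono_def
  proof (intro allI impI)
    fix x y :: real assume "x < y"
    then show "iv f x < iv f y"
      using Homeo_less[OF assms, of "iv f x" "iv f y"] by (simp add: f_iv[OF assms])
  qed
  moreover have "surj (iv f)" using assms by (metis iv_f surjI)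
  ultimately show ?thesis by (simp add: Homeo_def)
qed

lemma iv_iv [simp]: "f \<in> Homeo \<Longrightarrow> iv (iv f) = f"
  by (rule ext, rule iv_eqI) (auto simp: f_iv)

lemma iv_comp: "f \<in> Homeo \<Longrightarrow> g \<in> Homeo \<Longrightarrow> iv (f \<circ> g) = iv g \<circ> iv f"
  by (rule ext, rule iv_eqI) (auto simp: f_iv[of f] f_iv[of g])

text \<open>An increasing map onto the line cannot jump, so continuity comes for free from the two
  conditions in \<open>Homeo\<close>.\<close>

lemma Homeo_cont: assumes "f \<in> Homeo" shows "isCont f x"
proof -
  have "continuous_on UNIV f"
    by (rule continuous_onI_mono) (use assms in \<open>auto simp: Homeo_def strict_mono_less_eq\<close>)
  then show ?thesis by (simp add: continuous_on_eq_continuous_at)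
qed

lemma Homeo_carrier: "carrier (homeo_plus UNIV) = Homeo"
proof
  show "carrier (homeo_plus UNIV) \<subseteq> Homeo"
    by (auto simp: homeo_plus_def Homeo_def homeomorphism_def)
  show "Homeo \<subseteq> carrier (homeo_plus UNIV)"
  proof
    fix f assume f: "f \<in> Homeo"
    have "homeomorphism UNIV UNIV f (iv f)"
    proof (rule homeomorphismI)
      show "continuous_on UNIV f" "continuous_on UNIV (iv f)"
        using f by (auto intro!: continuous_at_imp_continuous_on simp: Homeo_cont)
      show "f (iv f y) = y" for y using f by (rule f_iv)
    qed (use f in auto)
    then show "f \<in> carrier (homeo_plus UNIV)"
      using f by (auto simp: homeo_plus_def Homeo_def)
  qed
qed

lemma homeo_mult [simp]: "f \<otimes>\<^bsub>homeo_plus S\<^esub> g = g \<circ> f"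
  by (simp add: homeo_plus_def fcomp_comp)

lemma homeo_one [simp]: "\<one>\<^bsub>homeo_plus S\<^esub> = id"
  by (simp add: homeo_plus_def)

lemma homeo_inv: assumes "f \<in> Homeo" shows "inv\<^bsub>homeo_plus UNIV\<^esub> f = iv f"
proof (rule group.inv_equality[OF group_homeo_plus])
  show "iv f \<otimes>\<^bsub>homeo_plus UNIV\<^esub> f = \<one>\<^bsub>homeo_plus UNIV\<^esub>"
    using assms by (auto simp: fun_eq_iff f_iv[of f])
qed (use assms in \<open>auto simp: Homeo_carrier\<close>)

text \<open>With the extension by the identity, homeomorphisms of the unit interval become elements
  of \<open>Homeo\<close>, so the groups over \<open>{0..1}\<close> and over the line share
  composition and inverse.\<close>

lemma homeo01_iff:
  "f \<in> carrier (homeo_plus {0..1}) \<longleftrightarrow> f \<in> Homeo \<and> (\<forall>x. x \<notin> {0..1} \<longrightarrow> f x = x)"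
proof
  assume "f \<in> carrier (homeo_plus {0..1})"
  then obtain g where g: "homeomorphism {0..1} {0..1} f g" and m: "strict_mono_on {0..1} f"
    and o: "\<forall>x. x \<notin> {0..1} \<longrightarrow> f x = x" by (auto simp: homeo_plus_def)
  have im: "f ` {0..1} = {0..1}" using g by (simp add: homeomorphism_def)
  then have fin: "f x \<in> {0..1} \<longleftrightarrow> x \<in> {0..1}" for x
    using o by (metis imageI)
  have "strict_mono f"
    unfolding strict_mono_def
  proof (intro allI impI)
    fix x y :: real assume "x < y"
    then show "f x < f y"
      using fin[of x] fin[of y] o strict_mono_onD[OF m, of x y]
      by (cases "x \<in> {0..1}"; cases "y \<in> {0..1}") (force simp: not_le)+
  qed
  moreover have "surj f"
    unfolding surj_def using o im by (metis imageE)
  ultimately show "f \<in> Homeo \<and> (\<forall>x. x \<notin> {0..1} \<longrightarrow> f x = x)" using o by (auto simp: Homeo_def)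
next
  assume f: "f \<in> Homeo \<and> (\<forall>x. x \<notin> {0..1} \<longrightarrow> f x = x)"
  then have iff: "f x \<in> {0..1} \<longleftrightarrow> x \<in> {0..1}" for x
    by (metis Homeo_inj)
  then have im: "f ` {0..1} = {0..1}"
    using f by (auto simp: image_iff) (metis atLeastAtMost_iff f_iv)
  have im': "iv f ` {0..1} = {0..1}"
    using f by (subst im[symmetric]) (simp add: image_image)
  have "homeomorphism {0..1} {0..1} f (iv f)"
    by (rule homeomorphismI)
      (use f im im' in \<open>auto intro!: continuous_at_imp_continuous_on simp: Homeo_cont f_iv[of f]\<close>)
  then show "f \<in> carrier (homeo_plus {0..1})"
    using f unfolding homeo_plus_def
    by (auto simp: strict_mono_on_def Homeo_less[of f])
qed

lemma homeo01_inv: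
  assumes "f \<in> carrier (homeo_plus {0..1})"
  shows "inv\<^bsub>homeo_plus {0..1}\<^esub> f = iv f"
proof (rule group.inv_equality[OF group_homeo_plus])
  have f: "f \<in> Homeo" using assms by (simp add: homeo01_iff)
  show "iv f \<otimes>\<^bsub>homeo_plus {0..1}\<^esub> f = \<one>\<^bsub>homeo_plus {0..1}\<^esub>"
    using f by (auto simp: fun_eq_iff f_iv[of f])
  show "iv f \<in> carrier (homeo_plus {0..1})"
    using assms by (auto simp: homeo01_iff iv_fix)
qed (use assms in auto)

section \<open>Groups of maps and products of commutators\<close>

definition perm_group :: "(real \<Rightarrow> real) set \<Rightarrow> bool" where
  "perm_group S \<longleftrightarrow> S \<subseteq> Homeo \<and> id \<in> S \<and> (\<forall>f\<in>S. \<forall>g\<in>S. f \<circ> g \<in> S) \<and> (\<forall>f\<in>S. iv f \<in> S)"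

lemma gpD:
  assumes "perm_group S"
  shows "f \<in> S \<Longrightarrow> f \<in> Homeo" "id \<in> S" "f \<in> S \<Longrightarrow> g \<in> S \<Longrightarrow> f \<circ> g \<in> S" "f \<in> S \<Longrightarrow> iv f \<in> S"
  using assms by (auto simp: perm_group_def)

definition commt :: "(real \<Rightarrow> real) \<Rightarrow> (real \<Rightarrow> real) \<Rightarrow> real \<Rightarrow> real" where
  "commt a b = a \<circ> b \<circ> iv a \<circ> iv b"

text \<open>For a group \<open>S\<close> this is the derived subgroup, because the inverse of
  \<open>commt a b\<close> is \<open>commt b a\<close>. Commutators are added one at a time, the
  form in which \<open>shift_trick\<close> consumes them.\<close>

inductive_set cprod :: "(real \<Rightarrow> real) set \<Rightarrow> (real \<Rightarrow> real) set" for S where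
  cprod_id: "id \<in> cprod S"
| cprod_step: "a \<in> S \<Longrightarrow> b \<in> S \<Longrightarrow> f \<in> cprod S \<Longrightarrow> commt a b \<circ> f \<in> cprod S"

lemma cprod_mono: "f \<in> cprod S \<Longrightarrow> S \<subseteq> T \<Longrightarrow> f \<in> cprod T"
  by (induction rule: cprod.induct) (auto intro: cprod.intros)

lemma perm_group_commt: "perm_group S \<Longrightarrow> a \<in> S \<Longrightarrow> b \<in> S \<Longrightarrow> commt a b \<in> S"
  by (simp add: commt_def gpD)

lemma cprod_sub: "f \<in> cprod S \<Longrightarrow> perm_group S \<Longrightarrow> f \<in> S"
  by (induction rule: cprod.induct) (auto simp: gpD perm_group_commt)

lemma cprod_commt: "a \<in> S \<Longrightarrow> b \<in> S \<Longrightarrow> commt a b \<in> cprod S"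
  using cprod_step[OF _ _ cprod_id] by force

lemma cprod_comp: "f \<in> cprod S \<Longrightarrow> g \<in> cprod S \<Longrightarrow> f \<circ> g \<in> cprod S"
  by (induction rule: cprod.induct) (auto simp: comp_assoc intro: cprod.intros)

text \<open>The conjugating bijection need not preserve the orientation.\<close>

lemma iv_conj:
  assumes "bij s" "f \<in> Homeo"
  shows "iv (s \<circ> f \<circ> iv s) = s \<circ> iv f \<circ> iv s"
proof -
  have "bij f" using assms Homeo_bij by blast
  then show ?thesis using assms(1)
    by (simp add: o_inv_distrib bij_comp bij_imp_bij_inv inv_inv_eq comp_assoc)
qed

lemma commt_conj:
  assumes "bij s" "a \<in> Homeo" "b \<in> Homeo"
  shows "s \<circ> commt a b \<circ> iv s = commt (s \<circ> a \<circ> iv s) (s \<circ> b \<circ> iv s)"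
  using assms by (simp add: commt_def iv_conj fun_eq_iff bij_is_inj)

lemma cprod_conj:
  assumes "f \<in> cprod S" "perm_group S" "bij s" "\<And>a. a \<in> S \<Longrightarrow> s \<circ> a \<circ> iv s \<in> T"
  shows "s \<circ> f \<circ> iv s \<in> cprod T"
  using assms(1)
proof (induction rule: cprod.induct)
  case cprod_id
  have "s \<circ> id \<circ> iv s = id" using assms by (simp add: fun_eq_iff bij_is_surj surj_f_inv_f)
  then show ?case using cprod.cprod_id by metis
next
  case (cprod_step a b f)
  have "s \<circ> (commt a b \<circ> f) \<circ> iv s = (s \<circ> commt a b \<circ> iv s) \<circ> (s \<circ> f \<circ> iv s)"
    using assms by (simp add: fun_eq_iff bij_is_inj)
  also have "\<dots> = commt (s \<circ> a \<circ> iv s) (s \<circ> b \<circ> iv s) \<circ> (s \<circ> f \<circ> iv s)"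
    using cprod_step assms by (simp only: commt_conj gpD)
  finally show ?case
    using cprod_step(1,2,4) assms(4) cprod.cprod_step by metis
qed

section \<open>Dyadic piecewise linear homeomorphisms\<close>

lemma dyadic_of_int [simp]: "of_int m \<in> dyadic"
  unfolding dyadic_def by (rule CollectI, rule exI[of _ m], rule exI[of _ 0]) simp

lemma dyadic_numeral [simp]: "0 \<in> dyadic" "1 \<in> dyadic" "numeral n \<in> dyadic"
  using dyadic_of_int[of 0] dyadic_of_int[of 1] dyadic_of_int[of "numeral n"] by simp_all

lemma dyadic_add [simp]: assumes "x \<in> dyadic" "y \<in> dyadic" shows "x + y \<in> dyadic"
proof -
  obtain m k n l where "x = of_int m / 2 ^ k" "y = of_int n / 2 ^ l"
    using assms by (auto simp: dyadic_def)
  then have "x + y = of_int (m * 2 ^ l + n * 2 ^ k) / 2 ^ (k + l)"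
    by (simp add: add_divide_distrib power_add)
  then show ?thesis unfolding dyadic_def by blast
qed

lemma dyadic_mult [simp]: assumes "x \<in> dyadic" "y \<in> dyadic" shows "x * y \<in> dyadic"
proof -
  obtain m k n l where "x = of_int m / 2 ^ k" "y = of_int n / 2 ^ l"
    using assms by (auto simp: dyadic_def)
  then have "x * y = of_int (m * n) / 2 ^ (k + l)"
    by (simp add: power_add)
  then show ?thesis unfolding dyadic_def by blast
qed

lemma dyadic_uminus [simp]: "x \<in> dyadic \<Longrightarrow> - x \<in> dyadic"
  using dyadic_mult[of "-1" x] dyadic_of_int[of "-1"] by simp

lemma dyadic_diff [simp]: "x \<in> dyadic \<Longrightarrow> y \<in> dyadic \<Longrightarrow> x - y \<in> dyadic"
  using dyadic_add[of x "- y"] by simp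

lemma dyadic_powi [simp]: "2 powi i \<in> dyadic"
proof (cases "i \<ge> 0")
  case True
  then have "2 powi i = real_of_int (2 ^ nat i)" by (simp add: power_int_def)
  then show ?thesis by (metis dyadic_of_int)
next
  case False
  then have "2 powi i = real_of_int 1 / 2 ^ nat (- i)"
    by (simp add: power_int_def divide_simps power_inverse)
  then show ?thesis unfolding dyadic_def by blast
qed

lemma dyadic_half [simp]: "x \<in> dyadic \<Longrightarrow> x / 2 \<in> dyadic"
  using dyadic_mult[OF _ dyadic_powi[of "-1"], of x] by (simp add: power_int_def)

lemma powi_cancel: "2 powi i * (2 powi (- i) * x) = (x :: real)"
  "2 powi (- i) * (2 powi i * x) = (x :: real)"
  by (simp_all add: power_int_minus field_simps)

lemma dyadic_powi_mult: "2 powi i * x \<in> dyadic \<longleftrightarrow> x \<in> dyadic"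
proof
  assume "2 powi i * x \<in> dyadic"
  then have "2 powi (- i) * (2 powi i * x) \<in> dyadic"
    by (rule dyadic_mult[OF dyadic_powi])
  then show "x \<in> dyadic" by (simp only: powi_cancel)
qed simp

lemma powi2_inj: "(2::real) powi i = 2 powi j \<longleftrightarrow> i = j"
  using power_int_strict_increasing[of i j "2::real"] power_int_strict_increasing[of j i "2::real"]
  by (cases i j rule: linorder_cases) auto

section \<open>One-sided affine germs\<close>

definition germ :: "(real \<Rightarrow> real) \<Rightarrow> real \<Rightarrow> real set \<Rightarrow> bool" where
  "germ f x U \<longleftrightarrow> (\<exists>i::int. \<exists>c\<in>dyadic. \<forall>\<^sub>F y in nhds x. y \<in> U \<longrightarrow> f y = 2 powi i * y + c)"

text \<open>Local form of the conditions on Thompson's group: breaks at dyadic points only, slopes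
  powers of 2, dyadic constant terms. It involves no finite partition, so it also describes elements
  of the group of the labelling, which may have infinitely many breaks.\<close>

definition pl2 :: "(real \<Rightarrow> real) \<Rightarrow> bool" where
  "pl2 f \<longleftrightarrow> (\<forall>x. germ f x {x..} \<and> germ f x {..x} \<and> (x \<notin> dyadic \<longrightarrow> germ f x UNIV))"

lemma germ_id: "germ id x U"
  unfolding germ_def by (rule exI[of _ 0], rule bexI[of _ 0]) auto

lemma germ_mono: assumes "germ f x U" "V \<subseteq> U" shows "germ f x V"
proof -
  obtain i c where c: "c \<in> dyadic" "\<forall>\<^sub>F y in nhds x. y \<in> U \<longrightarrow> f y = 2 powi i * y + c"
    using assms by (auto simp: germ_def)
  have "\<forall>\<^sub>F y in nhds x. y \<in> V \<longrightarrow> f y = 2 powi i * y + c"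
    using c(2) by eventually_elim (use assms in auto)
  then show ?thesis using c by (auto simp: germ_def)
qed

lemma germ_cong:
  assumes "germ f x U" "\<forall>\<^sub>F y in nhds x. y \<in> U \<longrightarrow> f y = g y"
  shows "germ g x U"
proof -
  obtain i c where c: "c \<in> dyadic" "\<forall>\<^sub>F y in nhds x. y \<in> U \<longrightarrow> f y = 2 powi i * y + c"
    using assms by (auto simp: germ_def)
  have "\<forall>\<^sub>F y in nhds x. y \<in> U \<longrightarrow> g y = 2 powi i * y + c"
    using c(2) assms(2) by eventually_elim auto
  then show ?thesis using c by (auto simp: germ_def)
qed

lemma germ_dyadic: assumes "germ f x U" "x \<in> U" shows "f x \<in> dyadic \<longleftrightarrow> x \<in> dyadic"
proof -
  obtain i c where c: "c \<in> dyadic" "\<forall>\<^sub>F y in nhds x. y \<in> U \<longrightarrow> f y = 2 powi i * y + c"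
    using assms by (auto simp: germ_def)
  have eq: "f x = 2 powi i * x + c" using eventually_nhds_x_imp_x[OF c(2)] assms by simp
  show ?thesis
    unfolding eq using c(1) dyadic_powi_mult[of i x] dyadic_diff[of "2 powi i * x + c" c] by auto
qed

lemma isCont_nhds: "isCont f x \<Longrightarrow> (f \<longlongrightarrow> f x) (nhds x)"
  by (simp add: isCont_def tendsto_at_iff_tendsto_nhds)

lemma germ_comp:
  assumes "germ f x U" "isCont f x" "germ g (f x) V" "\<And>y. y \<in> U \<Longrightarrow> f y \<in> V"
  shows "germ (g \<circ> f) x U"
proof -
  obtain i c where c: "c \<in> dyadic" "\<forall>\<^sub>F y in nhds x. y \<in> U \<longrightarrow> f y = 2 powi i * y + c"
    using assms by (auto simp: germ_def)
  obtain j d where d: "d \<in> dyadic" "\<forall>\<^sub>F y in nhds (f x). y \<in> V \<longrightarrow> g y = 2 powi j * y + d"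
    using assms by (auto simp: germ_def)
  have "\<forall>\<^sub>F y in nhds x. f y \<in> V \<longrightarrow> g (f y) = 2 powi j * f y + d"
    using eventually_compose_filterlim[OF d(2) isCont_nhds[OF assms(2)]] .
  with c(2) have "\<forall>\<^sub>F y in nhds x. y \<in> U \<longrightarrow> (g \<circ> f) y = 2 powi (j + i) * y + (2 powi j * c + d)"
    by eventually_elim (use assms(4) in \<open>auto simp: power_int_add algebra_simps\<close>)
  then show ?thesis using c d unfolding germ_def
    by (intro exI[of _ "j + i"] bexI[of _ "2 powi j * c + d"]) auto
qed

lemma germ_iv:
  assumes "germ f x U" "f \<in> Homeo"
  shows "germ (iv f) (f x) (f ` U)"
proof -
  obtain i c where c: "c \<in> dyadic" "\<forall>\<^sub>F y in nhds x. y \<in> U \<longrightarrow> f y = 2 powi i * y + c"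
    using assms by (auto simp: germ_def)
  have "((iv f) \<longlongrightarrow> x) (nhds (f x))"
    using isCont_nhds[OF Homeo_cont[of "iv f" "f x"]] assms by simp
  from eventually_compose_filterlim[OF c(2) this]
  have "\<forall>\<^sub>F z in nhds (f x). z \<in> f ` U \<longrightarrow> iv f z = 2 powi (- i) * z + (- (2 powi (- i) * c))"
  proof eventually_elim
    case (elim z)
    show ?case
    proof
      assume "z \<in> f ` U"
      then have "iv f z \<in> U" using assms by auto
      then have "z = 2 powi i * iv f z + c" using elim assms by (simp add: f_iv)
      then have "2 powi (- i) * z = 2 powi (- i) * (2 powi i * iv f z) + 2 powi (- i) * c"
        by (metis distrib_left)
      then show "iv f z = 2 powi (- i) * z + (- (2 powi (- i) * c))"
        by (simp only: powi_cancel)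
    qed
  qed
  then show ?thesis using c unfolding germ_def
    by (intro exI[of _ "- i"] bexI[of _ "- (2 powi (- i) * c)"]) auto
qed

lemma Homeo_image_ge: assumes "f \<in> Homeo" shows "f ` {x..} = {f x..}"
proof -
  have "z \<in> f ` {x..} \<longleftrightarrow> f x \<le> z" for z
    using f_iv[OF assms, of z] Homeo_le[OF assms, of x] by (metis atLeast_iff imageE imageI)
  then show ?thesis by blast
qed

lemma Homeo_image_le: assumes "f \<in> Homeo" shows "f ` {..x} = {..f x}"
proof -
  have "z \<in> f ` {..x} \<longleftrightarrow> z \<le> f x" for z
    using f_iv[OF assms, of z] Homeo_le[OF assms, of _ x] by (metis atMost_iff imageE imageI)
  then show ?thesis by blast
qed

lemma Homeo_image_UNIV: "f \<in> Homeo \<Longrightarrow> f ` UNIV = UNIV"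
  by (simp add: Homeo_def)

lemma pl2_id: "pl2 id"
  by (simp add: pl2_def germ_id)

lemma pl2_dyadic: "pl2 f \<Longrightarrow> f x \<in> dyadic \<longleftrightarrow> x \<in> dyadic"
  using germ_dyadic[of f x "{x..}"] by (simp add: pl2_def)

lemma pl2_comp:
  assumes "pl2 f" "pl2 g" "f \<in> Homeo" shows "pl2 (g \<circ> f)"
  unfolding pl2_def
proof (intro allI conjI impI)
  fix x
  show "germ (g \<circ> f) x {x..}"
    by (rule germ_comp[where V = "{f x..}"]) (use assms in \<open>auto simp: pl2_def Homeo_cont Homeo_le[of f]\<close>)
  show "germ (g \<circ> f) x {..x}"
    by (rule germ_comp[where V = "{..f x}"]) (use assms in \<open>auto simp: pl2_def Homeo_cont Homeo_le[of f]\<close>)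
  assume "x \<notin> dyadic"
  then show "germ (g \<circ> f) x UNIV"
    by (intro germ_comp[where V = UNIV])
      (use assms pl2_dyadic[of f x] in \<open>auto simp: pl2_def Homeo_cont\<close>)
qed

lemma pl2_iv:
  assumes "pl2 f" "f \<in> Homeo" shows "pl2 (iv f)"
  unfolding pl2_def
proof (intro allI conjI impI)
  fix x
  let ?y = "iv f x"
  have y: "f ?y = x" using assms by (simp add: f_iv)
  show "germ (iv f) x {x..}"
    using germ_iv[of f ?y "{?y..}"] assms Homeo_image_ge[of f ?y] by (simp add: y pl2_def)
  show "germ (iv f) x {..x}"
    using germ_iv[of f ?y "{..?y}"] assms Homeo_image_le[of f ?y] by (simp add: y pl2_def)
  assume "x \<notin> dyadic"
  then have "?y \<notin> dyadic" using pl2_dyadic[OF assms(1), of ?y] y by simp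
  then show "germ (iv f) x UNIV"
    using germ_iv[of f ?y UNIV] assms Homeo_image_UNIV[of f] by (simp add: y pl2_def)
qed

text \<open>For an open interval \<open>A\<close> the support stays away from the ends, and
  \<open>PLc {0<..<1}\<close> is the derived subgroup of Thompson's group. For a closed interval
  inside the unit interval one gets \<open>F_on\<close>.\<close>

definition PLc :: "real set \<Rightarrow> (real \<Rightarrow> real) set" where
  "PLc A = {f \<in> Homeo. pl2 f \<and> (\<exists>C. compact C \<and> C \<subseteq> A \<and> (\<forall>x. x \<notin> C \<longrightarrow> f x = x))}"

lemma PLc_Homeo: "f \<in> PLc A \<Longrightarrow> f \<in> Homeo"
  by (simp add: PLc_def)

lemma PLc_fix: "f \<in> PLc A \<Longrightarrow> x \<notin> A \<Longrightarrow> f x = x"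
  by (auto simp: PLc_def)

lemma PLc_mono: "f \<in> PLc A \<Longrightarrow> A \<subseteq> A' \<Longrightarrow> f \<in> PLc A'"
  by (auto simp: PLc_def)

lemma perm_group_PLc: "perm_group (PLc A)"
  unfolding perm_group_def
proof (intro conjI ballI)
  show "id \<in> PLc A" by (auto simp: PLc_def pl2_id intro: exI[of _ "{}"])
  fix f assume f: "f \<in> PLc A"
  then obtain C where C: "compact C" "C \<subseteq> A" "\<And>x. x \<notin> C \<Longrightarrow> f x = x" "f \<in> Homeo" "pl2 f"
    by (auto simp: PLc_def)
  show "iv f \<in> PLc A"
    using C by (auto simp: PLc_def pl2_iv iv_fix intro!: exI[of _ C])
  fix g assume "g \<in> PLc A"
  then obtain D where D: "compact D" "D \<subseteq> A" "\<And>x. x \<notin> D \<Longrightarrow> g x = x" "g \<in> Homeo" "pl2 g"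
    by (auto simp: PLc_def)
  show "f \<circ> g \<in> PLc A"
    unfolding PLc_def
  proof (intro CollectI conjI exI[of _ "C \<union> D"])
    show "\<forall>x. x \<notin> C \<union> D \<longrightarrow> (f \<circ> g) x = x" using C(3) D(3) by simp
  qed (use C D in \<open>auto intro: pl2_comp\<close>)
qed (auto simp: PLc_def)

text \<open>Negative slopes are allowed because words are also read backwards. Conjugation by such a
  map preserves \<open>pl2\<close> even when the map itself reverses orientation and so lies outside
  \<open>Homeo\<close>.\<close>

definition aff :: "(real \<Rightarrow> real) \<Rightarrow> bool" where
  "aff \<alpha> \<longleftrightarrow> (\<exists>e\<in>{1,-1}. \<exists>k::int. \<exists>d\<in>dyadic. \<alpha> = (\<lambda>y. e * 2 powi k * y + d))"

lemma affE:
  assumes "aff \<alpha>"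
  obtains e k d where "e \<in> {1,-1::real}" "d \<in> dyadic" "\<alpha> = (\<lambda>y. e * 2 powi k * y + d)"
  using assms unfolding aff_def by blast

lemma affI: "e \<in> {1,-1} \<Longrightarrow> d \<in> dyadic \<Longrightarrow> aff (\<lambda>y. e * 2 powi k * y + d)"
  unfolding aff_def by blast

lemma aff_iv_eq:
  assumes "e \<in> {1,-1::real}" "\<alpha> = (\<lambda>y. e * 2 powi k * y + d)"
  shows "bij \<alpha>" "iv \<alpha> = (\<lambda>y. e * 2 powi (- k) * y + (- (e * 2 powi (- k) * d)))"
proof -
  let ?b = "\<lambda>y. e * 2 powi (- k) * y + (- (e * 2 powi (- k) * d))"
  have e: "e * e = 1" using assms by auto
  have p: "(2::real) powi k * 2 powi (- k) = 1" by (simp add: power_int_minus)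
  have 1: "\<alpha> (?b y) = y" for y
  proof -
    have "\<alpha> (?b y) = (e * e) * (2 powi k * 2 powi (- k)) * y - (e * e) * (2 powi k * 2 powi (- k)) * d + d"
      unfolding assms(2) by (simp add: algebra_simps)
    then show ?thesis by (simp only: e p)
  qed
  have 2: "?b (\<alpha> y) = y" for y
  proof -
    have "?b (\<alpha> y) = (e * e) * (2 powi k * 2 powi (- k)) * y"
      unfolding assms(2) by (simp add: algebra_simps)
    then show ?thesis by (simp only: e p)
  qed
  show b: "bij \<alpha>" using 1 2 by (metis bijI')
  show "iv \<alpha> = ?b"
    by (rule ext) (metis 1 b bij_is_inj inv_f_f)
qed

lemma aff_bij: "aff \<alpha> \<Longrightarrow> bij \<alpha>"
  by (erule affE) (rule aff_iv_eq(1))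

lemma aff_iv: assumes "aff \<alpha>" shows "aff (iv \<alpha>)"
proof -
  obtain e k d where e: "e \<in> {1,-1::real}" "d \<in> dyadic" "\<alpha> = (\<lambda>y. e * 2 powi k * y + d)"
    using assms by (rule affE)
  have "- (e * 2 powi (- k) * d) \<in> dyadic" using e by auto
  then show ?thesis
    unfolding aff_iv_eq(2)[OF e(1,3)] by (rule affI[OF e(1)])
qed

lemma aff_iv_f: "aff \<alpha> \<Longrightarrow> iv \<alpha> (\<alpha> x) = x"
  by (simp add: aff_bij bij_is_inj)

lemma aff_f_iv: "aff \<alpha> \<Longrightarrow> \<alpha> (iv \<alpha> x) = x"
  by (simp add: aff_bij bij_is_surj surj_f_inv_f)

lemma aff_iv_iv: "aff \<alpha> \<Longrightarrow> iv (iv \<alpha>) = \<alpha>"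
  by (simp add: aff_bij inv_inv_eq)

lemma aff_cont: "aff \<alpha> \<Longrightarrow> isCont \<alpha> x"
  by (auto simp: aff_def)

lemma aff_mono_cases:
  assumes "aff \<alpha>"
  shows "\<alpha> \<in> Homeo \<or> (\<forall>y z. (\<alpha> y < \<alpha> z \<longleftrightarrow> z < y) \<and> (\<alpha> y \<le> \<alpha> z \<longleftrightarrow> z \<le> y))"
proof -
  obtain e k d where e: "e \<in> {1,-1::real}" "d \<in> dyadic" "\<alpha> = (\<lambda>y. e * 2 powi k * y + d)"
    using assms by (rule affE)
  show ?thesis
  proof (cases "e = 1")
    case True
    then have "strict_mono \<alpha>" using e by (simp add: strict_mono_def)
    then show ?thesis using aff_bij[OF assms] by (simp add: Homeo_def bij_is_surj)
  next
    case False
    then show ?thesis using e by simp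
  qed
qed

lemma aff_dyadic: assumes "aff \<alpha>" shows "\<alpha> x \<in> dyadic \<longleftrightarrow> x \<in> dyadic"
proof -
  have *: "\<alpha> x \<in> dyadic" if "x \<in> dyadic" "aff \<alpha>" for \<alpha> x
    using that by (auto simp: aff_def)
  show ?thesis using *[of x \<alpha>] *[of "\<alpha> x" "iv \<alpha>"] assms aff_iv aff_iv_f by metis
qed

lemma germ_conj:
  assumes "germ f x U" "aff \<alpha>"
  shows "germ (\<alpha> \<circ> f \<circ> iv \<alpha>) (\<alpha> x) (\<alpha> ` U)"
proof -
  obtain i c where c: "c \<in> dyadic" "\<forall>\<^sub>F y in nhds x. y \<in> U \<longrightarrow> f y = 2 powi i * y + c"
    using assms by (auto simp: germ_def)
  obtain e k d where e: "e \<in> {1,-1::real}" "d \<in> dyadic" "\<alpha> = (\<lambda>y. e * 2 powi k * y + d)"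
    using assms(2) by (rule affE)
  have ee: "e * e = 1" using e by auto
  have p: "(2::real) powi k * 2 powi (- k) = 1" by (simp add: power_int_minus)
  let ?c = "e * 2 powi k * c + d - 2 powi i * d"
  have "((iv \<alpha>) \<longlongrightarrow> x) (nhds (\<alpha> x))"
    using isCont_nhds[OF aff_cont[OF aff_iv[OF assms(2)]]] assms aff_iv_f by metis
  from eventually_compose_filterlim[OF c(2) this]
  have "\<forall>\<^sub>F z in nhds (\<alpha> x). z \<in> \<alpha> ` U \<longrightarrow> (\<alpha> \<circ> f \<circ> iv \<alpha>) z = 2 powi i * z + ?c"
  proof eventually_elim
    case (elim z)
    show ?case
    proof
      assume "z \<in> \<alpha> ` U"
      then have "iv \<alpha> z \<in> U" using aff_iv_f[OF assms(2)] by auto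
      then have "(\<alpha> \<circ> f \<circ> iv \<alpha>) z = e * 2 powi k * (2 powi i * iv \<alpha> z + c) + d"
        using elim e by simp
      also have "\<dots> = (e * e) * (2 powi k * 2 powi (- k)) * (2 powi i * z)
          - (e * e) * (2 powi k * 2 powi (- k)) * (2 powi i * d) + e * 2 powi k * c + d"
        unfolding aff_iv_eq(2)[OF e(1,3)] by (simp add: algebra_simps)
      finally show "(\<alpha> \<circ> f \<circ> iv \<alpha>) z = 2 powi i * z + ?c"
        unfolding ee p by simp
    qed
  qed
  moreover have "?c \<in> dyadic" using e c by auto
  ultimately show ?thesis unfolding germ_def by blast
qed

lemma aff_image_cases:
  assumes "aff \<alpha>"
  shows "\<alpha> ` {x..} = {\<alpha> x..} \<and> \<alpha> ` {..x} = {..\<alpha> x} \<or> \<alpha> ` {x..} = {..\<alpha> x} \<and> \<alpha> ` {..x} = {\<alpha> x..}"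
proof (cases "\<alpha> \<in> Homeo")
  case True
  then show ?thesis by (simp add: Homeo_image_ge Homeo_image_le)
next
  case False
  then have le: "\<alpha> y \<le> \<alpha> z \<longleftrightarrow> z \<le> y" for y z
    using aff_mono_cases[OF assms] by blast
  have "z \<in> \<alpha> ` {x..} \<longleftrightarrow> z \<le> \<alpha> x" "z \<in> \<alpha> ` {..x} \<longleftrightarrow> \<alpha> x \<le> z" for z
    using le[of "iv \<alpha> z" x] le[of x "iv \<alpha> z"] aff_f_iv[OF assms, of z] le
    by (auto intro!: image_eqI[of _ _ "iv \<alpha> z"])
  then show ?thesis by blast
qed

lemma Homeo_conj:
  assumes "f \<in> Homeo" "aff \<alpha>" shows "\<alpha> \<circ> f \<circ> iv \<alpha> \<in> Homeo"
proof -
  have "bij (\<alpha> \<circ> f \<circ> iv \<alpha>)"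
    using assms by (simp add: aff_bij aff_iv Homeo_bij bij_comp)
  moreover have "strict_mono (\<alpha> \<circ> f \<circ> iv \<alpha>)"
    using aff_mono_cases[OF assms(2)]
  proof
    assume "\<alpha> \<in> Homeo"
    then have "\<alpha> \<circ> f \<circ> iv \<alpha> \<in> Homeo" using assms by simp
    then show ?thesis by (simp add: Homeo_def)
  next
    assume l: "\<forall>y z. (\<alpha> y < \<alpha> z \<longleftrightarrow> z < y) \<and> (\<alpha> y \<le> \<alpha> z \<longleftrightarrow> z \<le> y)"
    show ?thesis
      unfolding strict_mono_def
    proof (intro allI impI)
      fix y z :: real assume "y < z"
      then have "iv \<alpha> z < iv \<alpha> y" using l aff_f_iv[OF assms(2)] by metis
      then show "(\<alpha> \<circ> f \<circ> iv \<alpha>) y < (\<alpha> \<circ> f \<circ> iv \<alpha>) z"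
        using l Homeo_less[OF assms(1)] by simp
    qed
  qed
  ultimately show ?thesis using bij_is_surj by (simp add: Homeo_def del: o_apply) blast
qed

lemma pl2_conj:
  assumes "pl2 f" "aff \<alpha>" shows "pl2 (\<alpha> \<circ> f \<circ> iv \<alpha>)"
  unfolding pl2_def
proof (intro allI)
  fix x
  define y where "y = iv \<alpha> x"
  have x: "x = \<alpha> y" using assms by (simp add: y_def aff_f_iv)
  have g: "germ f y {y..}" "germ f y {..y}" "y \<notin> dyadic \<Longrightarrow> germ f y UNIV"
    using assms by (auto simp: pl2_def)
  have U: "\<alpha> ` UNIV = UNIV" using aff_bij[OF assms(2)] by (simp add: bij_is_surj)
  show "germ (\<alpha> \<circ> f \<circ> iv \<alpha>) x {x..} \<and> germ (\<alpha> \<circ> f \<circ> iv \<alpha>) x {..x} \<and>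
      (x \<notin> dyadic \<longrightarrow> germ (\<alpha> \<circ> f \<circ> iv \<alpha>) x UNIV)"
    unfolding x aff_dyadic[OF assms(2)]
    using aff_image_cases[OF assms(2), of y] germ_conj[OF g(1) assms(2)] germ_conj[OF g(2) assms(2)]
      germ_conj[OF g(3) assms(2)] U by auto
qed

lemma PLc_conj:
  assumes "f \<in> PLc A" "aff \<alpha>" shows "\<alpha> \<circ> f \<circ> iv \<alpha> \<in> PLc (\<alpha> ` A)"
proof -
  obtain C where C: "compact C" "C \<subseteq> A" "\<And>x. x \<notin> C \<Longrightarrow> f x = x" "f \<in> Homeo" "pl2 f"
    using assms by (auto simp: PLc_def)
  have "compact (\<alpha> ` C)"
    using C(1) assms(2)
    by (intro compact_continuous_image) (auto intro: continuous_at_imp_continuous_on aff_cont)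
  moreover have "(\<alpha> \<circ> f \<circ> iv \<alpha>) x = x" if "x \<notin> \<alpha> ` C" for x
  proof -
    have "iv \<alpha> x \<notin> C" using that aff_f_iv[OF assms(2)] by (metis imageI)
    then show ?thesis using C aff_f_iv[OF assms(2)] by simp
  qed
  ultimately show ?thesis
    using C assms unfolding PLc_def
    by (intro CollectI conjI Homeo_conj pl2_conj exI[of _ "\<alpha> ` C"]) auto
qed

lemma PLc_conj_Homeo:
  assumes "f \<in> PLc A" "s \<in> PLc A'" shows "s \<circ> f \<circ> iv s \<in> PLc (s ` A)"
proof -
  obtain C where C: "compact C" "C \<subseteq> A" "\<And>x. x \<notin> C \<Longrightarrow> f x = x" "f \<in> Homeo" "pl2 f"
    using assms by (auto simp: PLc_def)
  have s: "s \<in> Homeo" "pl2 s" using assms(2) by (auto simp: PLc_def)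
  have "compact (s ` C)"
    using C(1) s
    by (intro compact_continuous_image) (auto intro: continuous_at_imp_continuous_on Homeo_cont)
  moreover have "(s \<circ> f \<circ> iv s) x = x" if "x \<notin> s ` C" for x
  proof -
    have "iv s x \<notin> C" using that f_iv[OF s(1)] by (metis imageI)
    then show ?thesis using C f_iv[OF s(1)] by simp
  qed
  ultimately show ?thesis
    using C s unfolding PLc_def
    by (intro CollectI conjI Homeo_comp pl2_comp pl2_iv Homeo_iv exI[of _ "s ` C"]) auto
qed

section \<open>Restriction to an interval with fixed ends\<close>

definition cut :: "(real \<Rightarrow> real) \<Rightarrow> real \<Rightarrow> real \<Rightarrow> real \<Rightarrow> real" where
  "cut f a b x = (if a \<le> x \<and> x \<le> b then f x else x)"

lemma cut_Homeo:
  assumes "f \<in> Homeo" "f a = a" "f b = b"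
  shows "cut f a b \<in> Homeo"
proof -
  have ab: "a \<le> f x \<and> f x \<le> b \<longleftrightarrow> a \<le> x \<and> x \<le> b" for x
    using Homeo_le[OF assms(1), of a x] Homeo_le[OF assms(1), of x b] assms by simp
  have "surj (cut f a b)"
    unfolding surj_def
  proof
    fix y
    show "\<exists>x. y = cut f a b x"
      using ab[of "iv f y"] f_iv[OF assms(1), of y] unfolding cut_def by (metis (full_types))
  qed
  moreover have "strict_mono (cut f a b)"
    unfolding strict_mono_def
  proof (intro allI impI)
    fix x y :: real assume "x < y"
    then show "cut f a b x < cut f a b y"
      using Homeo_less[OF assms(1), of x y] ab[of x] ab[of y] by (auto simp: cut_def)
  qed
  ultimately show ?thesis by (simp add: Homeo_def)
qed

text \<open>New breaks arise only at \<open>a\<close> and \<open>b\<close>. These are dyadic fixed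
  points, so the identity on one side and \<open>f\<close> on the other give admissible one-sided
  germs.\<close>

lemma cut_pl2:
  assumes "pl2 f" "a < b" "a \<in> dyadic" "b \<in> dyadic" "f a = a" "f b = b"
  shows "pl2 (cut f a b)"
  unfolding pl2_def
proof (intro allI)
  fix x
  have g: "germ f x {x..}" "germ f x {..x}" "x \<notin> dyadic \<Longrightarrow> germ f x UNIV"
    using assms by (auto simp: pl2_def)
  have lt: "\<forall>\<^sub>F y in nhds x. y < z" if "x < z" for z
    using that by (metis eventually_nhds open_lessThan lessThan_iff)
  have gt: "\<forall>\<^sub>F y in nhds x. z < y" if "z < x" for z
    using that by (metis eventually_nhds open_greaterThan greaterThan_iff)
  consider "x < a" | "x = a" | "a < x" "x < b" | "x = b" | "b < x" by linarith
  then show "germ (cut f a b) x {x..} \<and> germ (cut f a b) x {..x} \<and>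
      (x \<notin> dyadic \<longrightarrow> germ (cut f a b) x UNIV)"
  proof cases
    case 1
    have "germ (cut f a b) x UNIV"
      by (rule germ_cong[OF germ_id]) (use lt[OF 1] in \<open>auto simp: cut_def elim!: eventually_mono\<close>)
    then show ?thesis by (auto intro: germ_mono)
  next
    case 2
    have "germ (cut f a b) x {x..}"
      by (rule germ_cong[OF g(1)])
        (use lt[of b] 2 assms in \<open>auto simp: cut_def elim!: eventually_mono\<close>)
    moreover have "germ (cut f a b) x {..x}"
      by (rule germ_cong[OF germ_id]) (use 2 assms in \<open>auto simp: cut_def intro!: always_eventually\<close>)
    ultimately show ?thesis using 2 assms by auto
  next
    case 3
    have *: "\<forall>\<^sub>F y in nhds x. f y = cut f a b y"
      using gt[OF 3(1)] lt[OF 3(2)] by eventually_elim (auto simp: cut_def)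
    have "germ (cut f a b) x U" if "germ f x U" for U
      by (rule germ_cong[OF that]) (use * in \<open>auto elim!: eventually_mono\<close>)
    then show ?thesis using g by auto
  next
    case 4
    have "germ (cut f a b) x {..x}"
      by (rule germ_cong[OF g(2)])
        (use gt[of a] 4 assms in \<open>auto simp: cut_def elim!: eventually_mono\<close>)
    moreover have "germ (cut f a b) x {x..}"
      by (rule germ_cong[OF germ_id]) (use 4 assms in \<open>auto simp: cut_def intro!: always_eventually\<close>)
    ultimately show ?thesis using 4 assms by auto
  next
    case 5
    have "germ (cut f a b) x UNIV"
      by (rule germ_cong[OF germ_id]) (use gt[OF 5] in \<open>auto simp: cut_def elim!: eventually_mono\<close>)
    then show ?thesis by (auto intro: germ_mono)
  qed
qed

lemma cut_PLc:
  assumes "f \<in> Homeo" "pl2 f" "a < b" "a \<in> dyadic" "b \<in> dyadic" "f a = a" "f b = b"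
  shows "cut f a b \<in> PLc UNIV"
  using cut_Homeo[OF assms(1,6,7)] cut_pl2[OF assms(2-)]
  by (auto simp: PLc_def cut_def intro!: exI[of _ "{a..b}"])

section \<open>Thompson's group\<close>

lemma deriv_right:
  fixes f :: "real \<Rightarrow> real"
  assumes "(f has_real_derivative D) (at x within S)" "x < z" "{x..<z} \<subseteq> S"
    and "\<And>y. x \<le> y \<Longrightarrow> y < z \<Longrightarrow> f y = m * y + c"
  shows "D = m"
proof -
  obtain w where w: "x < w" "w < z" using dense[OF assms(2)] by blast
  then have "{x..w} \<subseteq> S" using assms(3) by auto
  from has_field_derivative_subset[OF assms(1) this]
  have "((\<lambda>y. (f y - f x) / (y - x)) \<longlongrightarrow> D) (at x within {x..w})"
    by (simp add: has_field_derivative_iff)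
  then have "((\<lambda>y. (f y - f x) / (y - x)) \<longlongrightarrow> D) (at_right x)"
    by (simp add: at_within_Icc_at_right[OF w(1)])
  moreover have "\<forall>\<^sub>F y in at_right x. (f y - f x) / (y - x) = m"
    unfolding eventually_at_right_field using assms(2)
    by (intro exI[of _ z]) (auto simp: assms(4) field_simps)
  ultimately have "((\<lambda>y. m) \<longlongrightarrow> D) (at_right x)"
    using tendsto_cong by fast
  then show ?thesis using tendsto_unique[OF trivial_limit_at_right_real _ tendsto_const] by blast
qed

lemma deriv_left:
  fixes f :: "real \<Rightarrow> real"
  assumes "(f has_real_derivative D) (at x within S)" "z < x" "{z<..x} \<subseteq> S"
    and "\<And>y. z < y \<Longrightarrow> y \<le> x \<Longrightarrow> f y = m * y + c"
  shows "D = m"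
proof -
  obtain w where w: "z < w" "w < x" using dense[OF assms(2)] by blast
  then have "{w..x} \<subseteq> S" using assms(3) by auto
  from has_field_derivative_subset[OF assms(1) this]
  have "((\<lambda>y. (f y - f x) / (y - x)) \<longlongrightarrow> D) (at x within {w..x})"
    by (simp add: has_field_derivative_iff)
  then have "((\<lambda>y. (f y - f x) / (y - x)) \<longlongrightarrow> D) (at_left x)"
    by (simp add: at_within_Icc_at_left[OF w(2)])
  moreover have "\<forall>\<^sub>F y in at_left x. (f y - f x) / (y - x) = m"
    unfolding eventually_at_left_field using assms(2)
    by (intro exI[of _ z]) (auto simp: assms(4) field_simps)
  ultimately have "((\<lambda>y. m) \<longlongrightarrow> D) (at_left x)"
    using tendsto_cong by fast
  then show ?thesis using tendsto_unique[OF trivial_limit_at_left_real _ tendsto_const] by blast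
qed

lemma eventually_nhds_ge_iff:
  fixes x :: real
  shows "(\<forall>\<^sub>F y in nhds x. x \<le> y \<longrightarrow> P y) \<longleftrightarrow> (\<exists>z>x. \<forall>y. x \<le> y \<longrightarrow> y < z \<longrightarrow> P y)"
proof
  assume "\<forall>\<^sub>F y in nhds x. x \<le> y \<longrightarrow> P y"
  then obtain d where "d > 0" "\<And>y. dist y x < d \<Longrightarrow> x \<le> y \<longrightarrow> P y"
    unfolding eventually_nhds_metric by blast
  then show "\<exists>z>x. \<forall>y. x \<le> y \<longrightarrow> y < z \<longrightarrow> P y"
    by (intro exI[of _ "x + d"]) (auto simp: dist_real_def)
next
  assume "\<exists>z>x. \<forall>y. x \<le> y \<longrightarrow> y < z \<longrightarrow> P y"
  then obtain z where "z > x" "\<And>y. x \<le> y \<Longrightarrow> y < z \<Longrightarrow> P y" by blast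
  then show "\<forall>\<^sub>F y in nhds x. x \<le> y \<longrightarrow> P y"
    unfolding eventually_nhds_metric by (intro exI[of _ "z - x"]) (auto simp: dist_real_def)
qed

lemma eventually_nhds_le_iff:
  fixes x :: real
  shows "(\<forall>\<^sub>F y in nhds x. y \<le> x \<longrightarrow> P y) \<longleftrightarrow> (\<exists>z<x. \<forall>y. z < y \<longrightarrow> y \<le> x \<longrightarrow> P y)"
proof
  assume "\<forall>\<^sub>F y in nhds x. y \<le> x \<longrightarrow> P y"
  then obtain d where "d > 0" "\<And>y. dist y x < d \<Longrightarrow> y \<le> x \<longrightarrow> P y"
    unfolding eventually_nhds_metric by blast
  then show "\<exists>z<x. \<forall>y. z < y \<longrightarrow> y \<le> x \<longrightarrow> P y"
    by (intro exI[of _ "x - d"]) (auto simp: dist_real_def)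
next
  assume "\<exists>z<x. \<forall>y. z < y \<longrightarrow> y \<le> x \<longrightarrow> P y"
  then obtain z where "z < x" "\<And>y. z < y \<Longrightarrow> y \<le> x \<Longrightarrow> P y" by blast
  then show "\<forall>\<^sub>F y in nhds x. y \<le> x \<longrightarrow> P y"
    unfolding eventually_nhds_metric by (intro exI[of _ "x - z"]) (auto simp: dist_real_def)
qed

lemma affine_unique:
  fixes m m' :: real
  assumes "\<And>y. u < y \<Longrightarrow> y < v \<Longrightarrow> m * y + c = m' * y + c'" "u < v"
  shows "m = m'" "c = c'"
proof -
  obtain y where y: "u < y" "y < v" using dense[OF assms(2)] by blast
  obtain z where z: "y < z" "z < v" using dense[OF y(2)] by blast
  have 1: "m * y + c = m' * y + c'" "m * z + c = m' * z + c'" using assms(1) y z by auto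
  then have "(m - m') * (z - y) = 0" by (simp add: algebra_simps)
  then show "m = m'" using z by simp
  then show "c = c'" using 1 by simp
qed

text \<open>The definition controls slopes and breaks but not constant terms. Consecutive pieces
  either meet at a dyadic point or have the same formula, so dyadicity of the constant term passes
  from piece to piece, starting from the identity to the left of 0.\<close>

lemma thompson_F_imp:
  assumes "f \<in> thompson_F"
  shows "f \<in> Homeo" "pl2 f" "x \<notin> {0..1} \<Longrightarrow> f x = x"
proof -
  have car: "f \<in> carrier (homeo_plus {0..1})" using assms by (simp add: thompson_F_def)
  then show fH: "f \<in> Homeo" and out: "x \<notin> {0..1} \<Longrightarrow> f x = x" for x
    by (auto simp: homeo01_iff)
  have f0: "f 0 = 0"
  proof (rule antisym)
    show "f 0 \<le> 0"
    proof (rule ccontr)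
      assume "\<not> f 0 \<le> 0"
      then have l: "0 < f 0" by simp
      have "iv f 0 < 0" using Homeo_less[OF fH, of "iv f 0" 0] f_iv[OF fH, of 0] l by simp
      then have "f (iv f 0) = iv f 0" using out by auto
      then show False using f_iv[OF fH] \<open>iv f 0 < 0\<close> by simp
    qed
    show "0 \<le> f 0"
    proof (rule ccontr)
      assume "\<not> 0 \<le> f 0"
      then have l: "f 0 < 0" by simp
      then have "f (f 0) = f 0" using out by auto
      then show False using l Homeo_inj[OF fH, of "f 0" 0] by simp
    qed
  qed
  have f1: "f 1 = 1"
  proof (rule antisym)
    show "f 1 \<le> 1"
    proof (rule ccontr)
      assume "\<not> f 1 \<le> 1"
      then have l: "1 < f 1" by simp
      then have "f (f 1) = f 1" using out by auto
      then show False using l Homeo_inj[OF fH, of "f 1" 1] by simp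
    qed
    show "1 \<le> f 1"
    proof (rule ccontr)
      assume "\<not> 1 \<le> f 1"
      then have l: "f 1 < 1" by simp
      have "1 < iv f 1" using Homeo_less[OF fH, of 1 "iv f 1"] f_iv[OF fH, of 1] l by simp
      then have "f (iv f 1) = iv f 1" using out by auto
      then show False using f_iv[OF fH] \<open>1 < iv f 1\<close> by simp
    qed
  qed
  obtain P where P: "finite P"
    "\<And>u v. u < v \<Longrightarrow> {u<..<v} \<subseteq> {0..1} - P \<Longrightarrow> \<exists>m c. \<forall>x\<in>{u<..<v}. f x = m * x + c"
    using assms unfolding thompson_F_def piecewise_linear01_def by blast
  obtain D
    where D: "finite D" "D \<subseteq> dyadic" "\<And>x. x \<in> {0..1} - D \<Longrightarrow> f differentiable (at x within {0..1})"
    using assms unfolding thompson_F_def by blast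
  have germ_slope: "\<exists>k::int. d = 2 powi k"
    if "(f has_real_derivative d) (at x within {0..1})" "x \<in> {0..1}" for x d
    using assms that unfolding thompson_F_def by blast
  have piece: "\<exists>i::int. \<exists>c. \<forall>y. u \<le> y \<longrightarrow> y \<le> v \<longrightarrow> f y = 2 powi i * y + c"
    if uv: "u < v" "{u<..<v} \<subseteq> {0..1} - P" for u v
  proof -
    obtain m c where mc: "\<And>x. u < x \<Longrightarrow> x < v \<Longrightarrow> f x = m * x + c"
      using P(2)[OF uv] by auto
    obtain w where w: "u < w" "w < v" using dense[OF uv(1)] by blast
    have "((\<lambda>y. m * y + c) has_real_derivative m) (at w)"
      by (auto intro!: derivative_eq_intros)
    moreover have "\<forall>\<^sub>F y in nhds w. f y = m * y + c"
      using eventually_nhds_in_open[of "{u<..<v}" w] w by (auto elim!: eventually_mono simp: mc)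
    ultimately have "(f has_real_derivative m) (at w)"
      using DERIV_cong_ev[of w w f "\<lambda>y. m * y + c" m m] by simp
    then have "(f has_real_derivative m) (at w within {0..1})"
      by (rule has_field_derivative_at_within)
    then obtain i where i: "m = 2 powi i" using germ_slope[of m w] uv w by fastforce
    have cl: "f y = m * y + c" if "y \<in> closure {u<..<v}" for y
    proof (rule continuous_constant_on_closure[where S = "{u<..<v}" and f = "\<lambda>y. f y - (m * y + c)"
      and a = 0, simplified])
      show "y \<in> closure {u<..<v}" by fact
      show "continuous_on (closure {u<..<v}) (\<lambda>y. f y - (m * y + c))"
        by (intro continuous_intros continuous_at_imp_continuous_on ballI Homeo_cont[OF fH])
    qed (auto simp: mc)
    have "f y = m * y + c" if "u \<le> y" "y \<le> v" for y
      using cl[of y] that uv by (simp add: closure_greaterThanLessThan)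
    then show ?thesis using i by blast
  qed
  have RG: "\<exists>i::int. \<exists>c. \<exists>z>x. \<forall>y. x \<le> y \<longrightarrow> y < z \<longrightarrow> f y = 2 powi i * y + c" for x
  proof -
    consider "x < 0" | "0 \<le> x" "x < 1" | "x \<ge> 1" by linarith
    then show ?thesis
    proof cases
      case 1
      then show ?thesis using out by (intro exI[of _ 0]) auto
    next
      case 2
      obtain d where d: "d > 0" "\<And>y. y \<in> P \<Longrightarrow> y \<noteq> x \<Longrightarrow> d \<le> dist x y"
        using finite_set_avoid[OF P(1), of x] by blast
      have "{x<..<min 1 (x + d)} \<subseteq> {0..1} - P"
        using 2 d(2) by (force simp: dist_real_def)
      then obtain i c where ic: "\<And>y. x \<le> y \<Longrightarrow> y \<le> min 1 (x + d) \<Longrightarrow> f y = 2 powi i * y + c"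
        using piece[of x "min 1 (x + d)"] 2 d by auto
      then show ?thesis using 2 d
        by (intro exI[of _ i] exI[of _ c] exI[of _ "min 1 (x + d)"]) auto
    next
      case 3
      have "f y = y" if "x \<le> y" for y using 3 that out f1 by (cases "y = 1") auto
      then show ?thesis by (intro exI[of _ 0] exI[of _ "x + 1"]) auto
    qed
  qed
  have LG: "\<exists>i::int. \<exists>c. \<exists>z<x. \<forall>y. z < y \<longrightarrow> y \<le> x \<longrightarrow> f y = 2 powi i * y + c" for x
  proof -
    consider "x > 1" | "0 < x" "x \<le> 1" | "x \<le> 0" by linarith
    then show ?thesis
    proof cases
      case 1
      then show ?thesis using out by (intro exI[of _ 0] exI[of _ 0] exI[of _ 1]) auto
    next
      case 2
      obtain d where d: "d > 0" "\<And>y. y \<in> P \<Longrightarrow> y \<noteq> x \<Longrightarrow> d \<le> dist x y"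
        using finite_set_avoid[OF P(1), of x] by blast
      have "{max 0 (x - d)<..<x} \<subseteq> {0..1} - P"
        using 2 d(2) by (force simp: dist_real_def)
      then obtain i c where ic: "\<And>y. max 0 (x - d) \<le> y \<Longrightarrow> y \<le> x \<Longrightarrow> f y = 2 powi i * y + c"
        using piece[of "max 0 (x - d)" x] 2 d by auto
      then show ?thesis using 2 d
        by (intro exI[of _ i] exI[of _ c] exI[of _ "max 0 (x - d)"]) auto
    next
      case 3
      have "f y = y" if "y \<le> x" for y using 3 that out f0 by (cases "y = 0") auto
      then show ?thesis by (intro exI[of _ 0] exI[of _ "x - 1"]) auto
    qed
  qed
  have idp: "(2::real) powi i = 1"
    if "u < v" "\<And>y. u < y \<Longrightarrow> y < v \<Longrightarrow> f y = 2 powi i * y + c" "\<And>y. u < y \<Longrightarrow> y < v \<Longrightarrow> f y = y"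
      for i :: int and u v c
  proof (rule affine_unique(1))
    show "2 powi i * y + c = 1 * y + 0" if "u < y" "y < v" for y
      using \<open>\<And>y. u < y \<Longrightarrow> y < v \<Longrightarrow> f y = 2 powi i * y + c\<close>[OF that]
        \<open>\<And>y. u < y \<Longrightarrow> y < v \<Longrightarrow> f y = y\<close>[OF that] by simp
  qed fact
  \<comment> \<open>At a dyadic \<open>a\<close> both constants differ from \<open>f a\<close> by a
    dyadic number. At any other \<open>a\<close> the map has a derivative, so the one-sided slopes
    coincide, and with them the constants.\<close>
  have same: "(c \<in> dyadic \<longleftrightarrow> c' \<in> dyadic) \<and> (a \<notin> dyadic \<longrightarrow> i = j \<and> c = c')"
    if z: "a < z" "\<And>y. a \<le> y \<Longrightarrow> y < z \<Longrightarrow> f y = 2 powi i * y + c"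
      and w: "w < a" "\<And>y. w < y \<Longrightarrow> y \<le> a \<Longrightarrow> f y = 2 powi j * y + c'" for a z w i j c c'
  proof -
    have eq: "f a = 2 powi i * a + c" "f a = 2 powi j * a + c'"
      using z(2)[of a] w(2)[of a] z(1) w(1) by auto
    show ?thesis
    proof (cases "a \<in> dyadic")
      case True
      have "c \<in> dyadic \<longleftrightarrow> f a \<in> dyadic"
        using True eq(1) dyadic_diff[of "f a" "2 powi i * a"] by auto
      moreover have "c' \<in> dyadic \<longleftrightarrow> f a \<in> dyadic"
        using True eq(2) dyadic_diff[of "f a" "2 powi j * a"] by auto
      ultimately show ?thesis using True by simp
    next
      case False
      then have a01: "a \<noteq> 0" "a \<noteq> 1" by auto
      consider "a < 0" | "a > 1" | "0 < a" "a < 1" using a01 by linarith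
      then have "(2::real) powi i = 2 powi j"
      proof cases
        case 1
        have "(2::real) powi i = 1"
          by (rule idp[of a "min z 0" i c, OF _ z(2) out]) (use z(1) 1 in auto)
        moreover have "(2::real) powi j = 1"
          by (rule idp[of w a j c', OF _ w(2) out]) (use w(1) 1 in auto)
        ultimately show ?thesis by simp
      next
        case 2
        have "(2::real) powi i = 1" by (rule idp[of a z i c, OF _ z(2) out]) (use z(1) 2 in auto)
        moreover have "(2::real) powi j = 1"
          by (rule idp[of "max w 1" a j c', OF _ w(2) out]) (use w(1) 2 in auto)
        ultimately show ?thesis by simp
      next
        case 3
        then obtain d where d: "(f has_real_derivative d) (at a within {0..1})"
          using D False unfolding real_differentiable_def
          by (metis (no_types) Diff_iff atLeastAtMost_iff in_mono less_imp_le)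
        have "d = 2 powi i"
          by (rule deriv_right[OF d, of "min z 1"]) (use z 3 in auto)
        moreover have "d = 2 powi j"
          by (rule deriv_left[OF d, of "max w 0"]) (use w 3 in auto)
        ultimately show ?thesis by simp
      qed
      then show ?thesis using eq by (auto simp: powi2_inj)
    qed
  qed
  \<comment> \<open>Connectedness of the line: whether the constant term is dyadic is locally
    constant, and at -1 the germ is the identity.\<close>
  have good: "germ f x {x..}" for x
  proof (rule connected_induction_simple[where S = UNIV and a = "-1" and P = "\<lambda>x. germ f x {x..}"])
    show "germ f (- 1) {- 1..}"
      unfolding germ_def using out
      by (intro exI[of _ 0] bexI[of _ 0]) (auto simp: eventually_nhds_ge_iff intro!: exI[of _ 0])
    fix a :: real
    obtain i c z where z: "a < z" "\<And>y. a \<le> y \<Longrightarrow> y < z \<Longrightarrow> f y = 2 powi i * y + c"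
      using RG[of a] by blast
    obtain j c' w where w: "w < a" "\<And>y. w < y \<Longrightarrow> y \<le> a \<Longrightarrow> f y = 2 powi j * y + c'"
      using LG[of a] by blast
    have iff: "c \<in> dyadic \<longleftrightarrow> c' \<in> dyadic" using same[OF z w] by blast
    have gen: "germ f x {x..} \<longleftrightarrow> c \<in> dyadic"
      if xv: "x < v" "\<And>y. x \<le> y \<Longrightarrow> y < v \<Longrightarrow> f y = 2 powi i * y + c" for x v i c
    proof
      assume "germ f x {x..}"
      then obtain k d u where "d \<in> dyadic" "u > x" "\<And>y. x \<le> y \<Longrightarrow> y < u \<Longrightarrow> f y = 2 powi k * y + d"
        unfolding germ_def by (auto simp: eventually_nhds_ge_iff)
      moreover from this have "c = d"
        using xv by (intro affine_unique(2)[of x "min u v" "2 powi i" c "2 powi k" d])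
          (metis less_imp_le min_less_iff_conj, simp)
      ultimately show "c \<in> dyadic" by simp
    next
      assume "c \<in> dyadic"
      then show "germ f x {x..}"
        unfolding germ_def using xv by (auto simp: eventually_nhds_ge_iff)
    qed
    have "germ f x {x..} \<longleftrightarrow> c \<in> dyadic" if "x \<in> {w<..<z}" for x
    proof (cases "a \<le> x")
      case True
      then show ?thesis using gen[of x z i c] z that by auto
    next
      case False
      then show ?thesis using gen[of x a j c'] w that iff by auto
    qed
    then show "\<exists>T. openin (top_of_set UNIV) T \<and> a \<in> T \<and> (\<forall>x\<in>T. \<forall>y\<in>T. germ f x {x..} \<longrightarrow> germ f y {y..})"
      using z(1) w(1) by (intro exI[of _ "{w<..<z}"]) auto
  qed auto
  show "pl2 f"
    unfolding pl2_def
  proof (intro allI)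
    fix x
    obtain i c z where c: "c \<in> dyadic" and z: "x < z" "\<And>y. x \<le> y \<Longrightarrow> y < z \<Longrightarrow> f y = 2 powi i * y + c"
      using good[of x] unfolding germ_def by (auto simp: eventually_nhds_ge_iff)
    obtain j c' w where w: "w < x" "\<And>y. w < y \<Longrightarrow> y \<le> x \<Longrightarrow> f y = 2 powi j * y + c'"
      using LG[of x] by blast
    note s = same[OF z w]
    have "germ f x {..x}"
      unfolding germ_def using s c w by (auto simp: eventually_nhds_le_iff)
    moreover have "germ f x UNIV" if "x \<notin> dyadic"
    proof -
      have ij: "i = j" "c = c'" using s that by auto
      have "f y = 2 powi i * y + c" if "y \<in> {w<..<z}" for y
        using z(2)[of y] w(2)[of y] that ij by (cases "x \<le> y") auto
      moreover have "\<forall>\<^sub>F y in nhds x. y \<in> {w<..<z}"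
        using z(1) w(1) by (intro eventually_nhds_in_open) auto
      ultimately show ?thesis
        unfolding germ_def using c by (intro exI[of _ i] bexI[of _ c]) (auto elim: eventually_mono)
    qed
    ultimately show "germ f x {x..} \<and> germ f x {..x} \<and> (x \<notin> dyadic \<longrightarrow> germ f x UNIV)"
      using good by blast
  qed
qed

text \<open>A right germ at \<open>x\<close> is a full germ at every nearby point on the right, and
  symmetrically on the left; hence breaks do not accumulate.\<close>

lemma pl2_singular_isolated:
  assumes "pl2 f" shows "\<forall>\<^sub>F y in at x. germ f y UNIV"
proof -
  have g: "germ f x {x..}" "germ f x {..x}" using assms by (auto simp: pl2_def)
  obtain i c where c: "c \<in> dyadic" "\<forall>\<^sub>F y in nhds x. y \<in> {x..} \<longrightarrow> f y = 2 powi i * y + c"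
    using g(1) unfolding germ_def by blast
  obtain j d where d: "d \<in> dyadic" "\<forall>\<^sub>F y in nhds x. y \<in> {..x} \<longrightarrow> f y = 2 powi j * y + d"
    using g(2) unfolding germ_def by blast
  have c2: "\<forall>\<^sub>F y in nhds x. \<forall>\<^sub>F z in nhds y. z \<in> {x..} \<longrightarrow> f z = 2 powi i * z + c"
    using c(2) by (simp only: eventually_eventually)
  have d2: "\<forall>\<^sub>F y in nhds x. \<forall>\<^sub>F z in nhds y. z \<in> {..x} \<longrightarrow> f z = 2 powi j * z + d"
    using d(2) by (simp only: eventually_eventually)
  have "\<forall>\<^sub>F y in nhds x. y \<noteq> x \<longrightarrow> germ f y UNIV"
    using c2 d2
  proof eventually_elim
    case (elim y)
    show ?case
    proof
      assume "y \<noteq> x"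
      then consider "x < y" | "y < x" by linarith
      then show "germ f y UNIV"
      proof cases
        case 1
        have "\<forall>\<^sub>F z in nhds y. z > x" using 1
          by (metis eventually_nhds open_greaterThan greaterThan_iff)
        then have "\<forall>\<^sub>F z in nhds y. f z = 2 powi i * z + c" using elim(1) by eventually_elim auto
        then show ?thesis unfolding germ_def using c by auto
      next
        case 2
        have "\<forall>\<^sub>F z in nhds y. z < x" using 2 by (metis eventually_nhds open_lessThan lessThan_iff)
        then have "\<forall>\<^sub>F z in nhds y. f z = 2 powi j * z + d" using elim(2) by eventually_elim auto
        then show ?thesis unfolding germ_def using d by auto
      qed
    qed
  qed
  then show ?thesis by (simp add: eventually_at_filter)
qed

text \<open>Isolated breaks in a compact interval are finite in number. On a gap between them the
  coefficients of the affine formula are locally constant, so one formula holds on the whole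
  gap.\<close>

lemma pl2_thompson_F:
  assumes f: "f \<in> Homeo" "pl2 f" "\<And>x. x \<notin> {0..1} \<Longrightarrow> f x = x"
  shows "f \<in> thompson_F"
proof -
  define S where "S = {x \<in> {0..1}. \<not> germ f x UNIV}"
  have "S \<subseteq> dyadic" using f by (auto simp: S_def pl2_def)
  have "finite S"
  proof (rule ccontr)
    assume "infinite S"
    then obtain x where "x islimpt S"
      using compact_eq_Bolzano_Weierstrass[of "{0..1::real}"] by (auto simp: S_def)
    then have "\<exists>\<^sub>F y in at x. y \<in> S" by (simp add: islimpt_iff_eventually frequently_def)
    then have "\<exists>\<^sub>F y in at x. False"
      using pl2_singular_isolated[OF f(2), of x]
      by (elim frequently_rev_mp) (auto simp: S_def elim: eventually_mono)
    then show False by simp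
  qed
  have loc: "\<exists>i::int. \<exists>c. \<forall>\<^sub>F y in nhds x. f y = 2 powi i * y + c" if "x \<in> {0..1} - S" for x
    using that by (auto simp: S_def germ_def)
  have "piecewise_linear01 f"
    unfolding piecewise_linear01_def
  proof (intro exI[of _ S] conjI allI impI)
    fix u v :: real assume uv: "u < v" "{u<..<v} \<subseteq> {0..1} - S"
    obtain w where w: "u < w" "w < v" using dense[OF uv(1)] by blast
    then obtain i :: int and c where ic: "\<forall>\<^sub>F y in nhds w. f y = 2 powi i * y + c"
      using loc[of w] uv(2) by (meson greaterThanLessThan_iff subsetD)
    have "\<forall>\<^sub>F y in nhds x. f y = 2 powi i * y + c" if "x \<in> {u<..<v}" for x
    proof (rule connected_induction_simple[where S = "{u<..<v}" and a = w
          and P = "\<lambda>x. \<forall>\<^sub>F y in nhds x. f y = 2 powi i * y + c"])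
      fix a assume a: "a \<in> {u<..<v}"
      then obtain j :: int and d where "\<forall>\<^sub>F y in nhds a. f y = 2 powi j * y + d"
        using loc[of a] uv(2) by (meson subsetD)
      then obtain T where T: "open T" "a \<in> T" "\<And>y. y \<in> T \<Longrightarrow> f y = 2 powi j * y + d"
        unfolding eventually_nhds by blast
      have "\<forall>\<^sub>F y in nhds z. f y = 2 powi i * y + c"
        if "x \<in> T" "z \<in> T" "\<forall>\<^sub>F y in nhds x. f y = 2 powi i * y + c" for x z
      proof -
        have "\<forall>\<^sub>F y in nhds x. y \<in> T" using T that by (intro eventually_nhds_in_open)
        with that(3) have "\<forall>\<^sub>F y in nhds x. 2 powi i * y + c = 2 powi j * y + d"
          by eventually_elim (use T in auto)
        then obtain e where e: "e > 0" "\<And>y. dist y x < e \<Longrightarrow> 2 powi i * y + c = 2 powi j * y + d"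
          unfolding eventually_nhds_metric by blast
        have *: "2 powi i * y + c = 2 powi j * y + d" if "x < y" "y < x + e" for y
          by (rule e(2)) (use that in \<open>auto simp: dist_real_def\<close>)
        have "(2::real) powi i = 2 powi j" "c = d"
          using affine_unique[OF *] e(1) by auto
        then have "f y = 2 powi i * y + c" if "y \<in> T" for y using T(3)[OF that] by simp
        then show ?thesis
          using eventually_nhds_in_open[OF T(1) \<open>z \<in> T\<close>] by (auto elim: eventually_mono)
      qed
      then show "\<exists>T. openin (top_of_set {u<..<v}) T \<and> a \<in> T \<and> (\<forall>x\<in>T. \<forall>y\<in>T.
          (\<forall>\<^sub>F z in nhds x. f z = 2 powi i * z + c) \<longrightarrow> (\<forall>\<^sub>F z in nhds y. f z = 2 powi i * z + c))"
        using T a by (intro exI[of _ "{u<..<v} \<inter> T"]) (auto simp: openin_open)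
    qed (use that w ic in auto)
    then show "\<exists>m c. \<forall>x\<in>{u<..<v}. f x = m * x + c"
      using eventually_nhds_x_imp_x by blast
  qed fact
  moreover have "f differentiable (at x within {0..1})" if x: "x \<in> {0..1} - S" for x
  proof -
    obtain i :: int and c where "\<forall>\<^sub>F y in nhds x. f y = 2 powi i * y + c" using loc[OF x] by blast
    moreover have "((\<lambda>y. 2 powi i * y + c) has_real_derivative 2 powi i) (at x)"
      by (auto intro!: derivative_eq_intros)
    ultimately have "(f has_real_derivative 2 powi i) (at x)"
      using DERIV_cong_ev[of x x f "\<lambda>y. 2 powi i * y + c" "2 powi i" "2 powi i"] by simp
    then show ?thesis
      unfolding real_differentiable_def using has_field_derivative_at_within by blast
  qed
  moreover have "\<exists>k::int. d = 2 powi k"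
    if x: "x \<in> {0..1}" and d: "(f has_real_derivative d) (at x within {0..1})" for x d
  proof (cases "x = 1")
    case False
    obtain i :: int and c z where z: "x < z" "\<And>y. x \<le> y \<Longrightarrow> y < z \<Longrightarrow> f y = 2 powi i * y + c"
      using f(2) unfolding germ_def pl2_def by (auto simp: eventually_nhds_ge_iff) (metis)
    have "d = 2 powi i" by (rule deriv_right[OF d, of "min z 1"]) (use z x False in auto)
    then show ?thesis by blast
  next
    case True
    obtain i :: int and c w where w: "w < x" "\<And>y. w < y \<Longrightarrow> y \<le> x \<Longrightarrow> f y = 2 powi i * y + c"
      using f(2) unfolding germ_def pl2_def by (auto simp: eventually_nhds_le_iff) (metis)
    have "d = 2 powi i" by (rule deriv_left[OF d, of "max w 0"]) (use w x True in auto)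
    then show ?thesis by blast
  qed
  ultimately show ?thesis
    unfolding thompson_F_def using f \<open>finite S\<close> \<open>S \<subseteq> dyadic\<close>
    by (auto simp: homeo01_iff intro!: exI[of _ S])
qed

section \<open>Compressing supports\<close>

text \<open>Consider the supremum of the orbit of \<open>c\<close>. If it stayed below
  \<open>v\<close>, some \<open>b\<close> would raise it and thereby carry orbit points just below
  it beyond it. \<open>\<Gamma>\<close> is a monoid, so that the powers of a single map
  qualify.\<close>

lemma push:
  assumes \<Gamma>: "\<And>f g. f \<in> \<Gamma> \<Longrightarrow> g \<in> \<Gamma> \<Longrightarrow> f \<circ> g \<in> \<Gamma>" "id \<in> \<Gamma>" "\<And>f. f \<in> \<Gamma> \<Longrightarrow> f \<in> Homeo"
    and up: "\<And>s. u < s \<Longrightarrow> s < v \<Longrightarrow> \<exists>b\<in>\<Gamma>. s < b s"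
    and c: "u < c" "c < v" "c' < v"
  shows "\<exists>t\<in>\<Gamma>. c' < t c"
proof (rule ccontr)
  assume "\<not> ?thesis"
  then have le: "t c \<le> c'" if "t \<in> \<Gamma>" for t using that by force
  define S where "S = (\<lambda>t. t c) ` \<Gamma>"
  have bdd: "bdd_above S" using le by (auto simp: S_def bdd_above_def)
  have cS: "c \<in> S" unfolding S_def by (rule image_eqI[OF _ \<Gamma>(2)]) simp
  have "c \<le> Sup S" using bdd cS by (rule cSup_upper[rotated])
  moreover have "Sup S \<le> c'" using cS le by (intro cSup_least) (auto simp: S_def)
  ultimately obtain b where b: "b \<in> \<Gamma>" "Sup S < b (Sup S)" using up[of "Sup S"] c by auto
  have bH: "b \<in> Homeo" using b \<Gamma> by blast
  have "iv b (Sup S) < Sup S"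
    using b(2) Homeo_less[OF bH, of "iv b (Sup S)" "Sup S"] f_iv[OF bH] by simp
  then obtain t where t: "t \<in> \<Gamma>" "iv b (Sup S) < t c"
    using less_cSup_iff[of S "iv b (Sup S)"] bdd cS by (auto simp: S_def)
  then have "Sup S < b (t c)" using Homeo_less[OF bH, of "iv b (Sup S)" "t c"] f_iv[OF bH] by simp
  moreover have "b (t c) \<in> S" unfolding S_def by (rule image_eqI[OF _ \<Gamma>(1)[OF b(1) t(1)]]) simp
  ultimately show False using bdd cSup_upper by (metis not_le)
qed

lemma PLc_less:
  assumes "f \<in> PLc {u<..<v}"
  shows "f x < v \<longleftrightarrow> x < v" "u < f x \<longleftrightarrow> u < x" "v \<le> f x \<longleftrightarrow> v \<le> x" "f x \<le> u \<longleftrightarrow> x \<le> u"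
proof -
  have "f u = u" "f v = v" "f \<in> Homeo" using assms by (auto intro: PLc_fix PLc_Homeo)
  then show "f x < v \<longleftrightarrow> x < v" "u < f x \<longleftrightarrow> u < x" "v \<le> f x \<longleftrightarrow> v \<le> x" "f x \<le> u \<longleftrightarrow> x \<le> u"
    using Homeo_less[of f x v] Homeo_less[of f u x] Homeo_le[of f v x] Homeo_le[of f x u] by auto
qed

text \<open>\<open>O'\<close> may have many components. Since it omits \<open>u\<close> and
  \<open>v\<close>, the part of the compact set between them keeps a positive distance from both. If
  that part is empty, any inner point serves for both bounds.\<close>

lemma compact_hull:
  fixes u v :: real
  assumes "compact C" "C \<subseteq> O'" "u < v" "u \<notin> O'" "v \<notin> O'"
  obtains c c' where "u < c" "c \<le> c'" "c' < v" "\<And>x. x \<in> C \<Longrightarrow> u < x \<Longrightarrow> x < v \<Longrightarrow> c \<le> x \<and> x \<le> c'"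
proof (cases "C \<inter> {u..v} = {}")
  case True
  obtain w where "u < w" "w < v" using dense[OF assms(3)] by blast
  then show ?thesis using True by (intro that[of w w]) auto
next
  case False
  let ?C = "C \<inter> {u..v}"
  have C: "compact ?C" using assms(1) by (rule compact_Int_closed) simp
  have b: "bdd_below ?C" "bdd_above ?C" "closed ?C"
    using C
    by (auto simp: compact_imp_bounded bounded_imp_bdd_below bounded_imp_bdd_above compact_imp_closed)
  have 1: "Inf ?C \<in> ?C" "Sup ?C \<in> ?C"
    using closed_contains_Inf[OF False b(1,3)] closed_contains_Sup[OF False b(2,3)] by auto
  have 2: "Inf ?C \<le> x \<and> x \<le> Sup ?C" if "x \<in> ?C" for x
    using cInf_lower[OF that b(1)] cSup_upper[OF that b(2)] by simp
  have "Inf ?C \<noteq> u" "Sup ?C \<noteq> v" using 1 assms(2,4,5) by auto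
  then have "u < Inf ?C" "Sup ?C < v" using 1 by auto
  moreover have "Inf ?C \<le> Sup ?C" using 1 2 by blast
  moreover have "Inf ?C \<le> x \<and> x \<le> Sup ?C" if "x \<in> C" "u < x" "x < v" for x
    by (rule 2) (use that in auto)
  ultimately show ?thesis using that by blast
qed

lemma PLc_hull:
  assumes "h \<in> PLc {u<..<v}" "u < v"
  obtains c c' where "u < c" "c \<le> c'" "c' < v" "h \<in> PLc {c..c'}"
proof -
  obtain C where C: "compact C" "C \<subseteq> {u<..<v}" "\<And>x. x \<notin> C \<Longrightarrow> h x = x" "h \<in> Homeo" "pl2 h"
    using assms by (auto simp: PLc_def)
  obtain c c' where c: "u < c" "c \<le> c'" "c' < v" "\<And>x. x \<in> C \<Longrightarrow> u < x \<Longrightarrow> x < v \<Longrightarrow> c \<le> x \<and> x \<le> c'"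
    using compact_hull[OF C(1,2) assms(2)] by auto
  have "C \<subseteq> {c..c'}"
  proof
    fix x assume x: "x \<in> C"
    then have "u < x" "x < v" using C(2) by auto
    then show "x \<in> {c..c'}" using c(4)[OF x] by simp
  qed
  then have "\<forall>x. x \<notin> {c..c'} \<longrightarrow> h x = x" using C(3) by blast
  then have "h \<in> PLc {c..c'}"
    using C(4,5) unfolding PLc_def by (intro CollectI conjI exI[of _ "{c..c'}"]) auto
  then show ?thesis using that c by blast
qed

lemma powi_small: assumes "(e::real) > 0" shows "\<exists>k::int. 2 powi k < e"
proof -
  obtain n where "(1/2::real) ^ n < e" using real_arch_pow_inv[OF assms, of "1/2"] by auto
  then have "2 powi (- int n) < e" by (simp add: power_int_minus power_one_over inverse_eq_divide)
  then show ?thesis by blast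
qed

lemma floor_scaled:
  fixes r :: real
  assumes "r > 0" shows "r * of_int \<lfloor>s / r\<rfloor> \<le> s" "s < r * of_int \<lfloor>s / r\<rfloor> + r"
proof -
  have "r * of_int \<lfloor>s / r\<rfloor> \<le> r * (s / r)" "r * (s / r) < r * (of_int \<lfloor>s / r\<rfloor> + 1)"
    using assms by (intro mult_left_mono mult_strict_left_mono; linarith)+
  then show "r * of_int \<lfloor>s / r\<rfloor> \<le> s" "s < r * of_int \<lfloor>s / r\<rfloor> + r"
    using assms by (simp_all add: distrib_left)
qed

lemma small_copy:
  assumes "u < v"
  obtains \<alpha> where "aff \<alpha>" "\<alpha> \<in> Homeo" "\<alpha> ` {0..1} \<subseteq> {u<..<v}"
proof -
  obtain k :: int where k: "2 powi k < (v - u) / 2" using powi_small[of "(v - u) / 2"] assms by auto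
  define r :: real where "r = 2 powi k"
  have r: "r > 0" "2 * r < v - u" using k by (simp_all add: r_def)
  \<comment> \<open>The first multiple of the scale \<open>r\<close> beyond \<open>u\<close>: it is
    dyadic, and the copy of the unit interval ends at most \<open>2 * r\<close> past
    \<open>u\<close>.\<close>
  define d where "d = r * of_int \<lfloor>u / r\<rfloor> + r"
  have d: "u < d" "d \<le> u + r" "d \<in> dyadic"
    using floor_scaled[OF r(1), of u] by (simp_all add: d_def r_def)
  define \<alpha> where "\<alpha> = (\<lambda>y. 1 * 2 powi k * y + d)"
  have a: "aff \<alpha>" unfolding \<alpha>_def using d by (intro affI) auto
  have \<alpha>: "\<alpha> y = r * y + d" for y by (simp add: \<alpha>_def r_def)
  have "strict_mono \<alpha>" using r by (simp add: strict_mono_def \<alpha>)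
  then have "\<alpha> \<in> Homeo" using aff_bij[OF a] by (simp add: Homeo_def bij_is_surj)
  moreover have "\<alpha> ` {0..1} \<subseteq> {u<..<v}"
  proof clarify
    fix y :: real assume y: "y \<in> {0..1}"
    then have "0 \<le> r * y" "r * y \<le> r" using r by (auto simp: mult_left_le)
    then have "u < \<alpha> y" "\<alpha> y < v" using d r unfolding \<alpha> by linarith+
    then show "\<alpha> y \<in> {u<..<v}" by simp
  qed
  ultimately show ?thesis using that a by blast
qed

lemma F_on_PLc: assumes "0 \<le> r" "s \<le> 1" shows "F_on r s = PLc {r..s}"
proof
  show "F_on r s \<subseteq> PLc {r..s}"
    using thompson_F_imp(1,2) by (force simp: F_on_def PLc_def supp_def intro!: exI[of _ "{r..s}"])
  show "PLc {r..s} \<subseteq> F_on r s"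
  proof
    fix f assume f: "f \<in> PLc {r..s}"
    then have "f x = x" if "x \<notin> {r..s}" for x using that PLc_fix by blast
    moreover have "f \<in> thompson_F"
      by (rule pl2_thompson_F) (use f assms in \<open>auto simp: PLc_def\<close>)
    ultimately show "f \<in> F_on r s" unfolding F_on_def supp_def by blast
  qed
qed

section \<open>Moving supports with copies of \<open>c0\<close>\<close>

locale thompson_gens =
  fixes c0 \<nu>2 \<nu>3 :: "real \<Rightarrow> real"
  assumes c0_F: "c0 \<in> thompson_F"
    and c0_supp: "supp c0 = {0<..<1/4}"
    and c0_up: "\<forall>x\<in>{0<..<1/4}. c0 x > x"
    and c0_double: "\<forall>t\<in>{0<..<1/16}. c0 t = 2 * t"
    and nu2: "\<nu>2 \<in> carrier (homeo_plus {0..1})" "supp \<nu>2 \<subseteq> {1/16<..<15/16}"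
    and nu3: "\<nu>3 \<in> carrier (homeo_plus {0..1})" "supp \<nu>3 \<subseteq> {1/16<..<15/16}"
    and nu_gen: "generate (homeo_plus {0..1}) {\<nu>2, \<nu>3} = F_on (1/16) (15/16)"
begin

lemma c0_PLc: "c0 \<in> PLc {0..1/4}"
proof -
  have "c0 x = x" if "x \<notin> {0..1/4}" for x
  proof -
    have "x \<notin> supp c0" using that c0_supp by auto
    then show ?thesis by (simp add: supp_def)
  qed
  then show ?thesis
    using thompson_F_imp(1,2)[OF c0_F] unfolding PLc_def
    by (intro CollectI conjI exI[of _ "{0..1/4}"]) auto
qed

text \<open>A rescaled copy of \<open>c0\<close> does it, placed so that \<open>s\<close> lies
  inside its support, where \<open>c0\<close> moves points to the right.\<close>

lemma bump:
  assumes "u < s" "s < v" shows "\<exists>b\<in>PLc {u<..<v}. s < b s"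
proof -
  obtain k :: int where k: "2 powi k < min (s - u) (v - s) / 2"
    using powi_small[of "min (s - u) (v - s) / 2"] assms by auto
  define r :: real where "r = 2 powi k"
  have r: "r > 0" "2 * r < s - u" "2 * r < v - s" using k by (simp_all add: r_def)
  define d where "d = r * of_int \<lfloor>s / r\<rfloor> - r"
  have d: "d + r \<le> s" "s < d + 2 * r" "d \<in> dyadic"
    using floor_scaled[OF r(1), of s] by (simp_all add: d_def r_def)
  \<comment> \<open>Scale \<open>8 * r\<close> turns the support \<open>{0<..<1/4}\<close> of
    \<open>c0\<close> into \<open>{d<..<d + 2 * r}\<close>, and \<open>s\<close> lies in the right
    half of the latter.\<close>
  define \<alpha> where "\<alpha> = (\<lambda>y. 1 * 2 powi (k + 3) * y + d)"
  have a: "aff \<alpha>" unfolding \<alpha>_def using d by (intro affI) auto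
  have \<alpha>: "\<alpha> y = 8 * (r * y) + d" for y by (simp add: \<alpha>_def r_def power_int_add)
  have "strict_mono \<alpha>" using r by (simp add: strict_mono_def \<alpha>)
  then have aH: "\<alpha> \<in> Homeo" using aff_bij[OF a] by (simp add: Homeo_def bij_is_surj)
  let ?b = "\<alpha> \<circ> c0 \<circ> iv \<alpha>"
  have "\<alpha> ` {0..1/4} \<subseteq> {u<..<v}"
  proof clarify
    fix y :: real assume "y \<in> {0..1/4}"
    then have "0 \<le> r * y" "4 * (r * y) \<le> r" using r by auto
    then have "u < \<alpha> y" "\<alpha> y < v" using d r unfolding \<alpha> by linarith+
    then show "\<alpha> y \<in> {u<..<v}" by simp
  qed
  then have "?b \<in> PLc {u<..<v}" using PLc_conj[OF c0_PLc a] PLc_mono by blast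
  moreover have "s < ?b s"
  proof -
    let ?y = "iv \<alpha> s"
    have y: "\<alpha> ?y = s" using aff_f_iv[OF a] .
    then have "8 * (r * ?y) + d = s" by (simp only: \<alpha>)
    then have "0 < r * ?y" "r * (4 * ?y) < r * 1" using d r by linarith+
    then have "?y \<in> {0<..<1/4}" using r by (simp add: zero_less_mult_iff mult_less_cancel_left_pos)
    then have "?y < c0 ?y" using c0_up by blast
    then have "\<alpha> ?y < \<alpha> (c0 ?y)" using Homeo_less[OF aH] by blast
    then show ?thesis using y by simp
  qed
  ultimately show ?thesis by blast
qed

lemma push_PLc:
  assumes "u < c" "c < v" "c' < v" shows "\<exists>t\<in>PLc {u<..<v}. c' < t c"
  by (rule push[OF _ _ _ bump assms]) (auto simp: gpD[OF perm_group_PLc])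

text \<open>Two moves: a push in the whole interval takes \<open>c\<close> beyond \<open>e1\<close>;
  then the inverse of a push inside \<open>{e1<..<v}\<close> brings the image of \<open>c'\<close>
  below \<open>e2\<close>, without letting anything slip back past \<open>e1\<close>.\<close>

lemma squeeze:
  assumes "u < c" "c < v" "c' < v" "u \<le> e1" "e1 < e2" "e2 \<le> v"
  shows "\<exists>s\<in>PLc {u<..<v}. e1 < s c \<and> s c' < e2"
proof -
  obtain t where t: "t \<in> PLc {u<..<v}" "e1 < t c" using push_PLc[of u c v e1] assms by auto
  obtain z where z: "e1 < z" "z < e2" using dense assms by blast
  have "t c' < v" using PLc_less[OF t(1)] assms by simp
  then obtain t' where t': "t' \<in> PLc {e1<..<v}" "t c' < t' z"
    using push_PLc[of e1 z v "t c'"] z assms by auto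
  have H: "t' \<in> Homeo" using t' PLc_Homeo by blast
  have i: "iv t' \<in> PLc {e1<..<v}" using t' gpD(4)[OF perm_group_PLc] by blast
  have "iv t' (t c') < z" using t'(2) Homeo_less[OF H, of "iv t' (t c')" z] f_iv[OF H] by simp
  moreover have "e1 < iv t' (t c)" using PLc_less(2)[OF i] t by simp
  moreover have "iv t' \<in> PLc {u<..<v}" using i by (rule PLc_mono) (use assms in auto)
  ultimately show ?thesis
    using z gpD(3)[OF perm_group_PLc _ t(1)] by (intro bexI[of _ "iv t' \<circ> t"]) auto
qed

lemma squeeze_PLc:
  assumes "h \<in> PLc {u<..<v}" "u < v" "u \<le> e1" "e1 < e2" "e2 \<le> v"
  shows "\<exists>s\<in>PLc {u<..<v}. s \<circ> h \<circ> iv s \<in> PLc {e1<..<e2}"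
proof -
  obtain c c' where c: "u < c" "c \<le> c'" "c' < v" "h \<in> PLc {c..c'}" using PLc_hull[OF assms(1,2)] .
  obtain s where s: "s \<in> PLc {u<..<v}" "e1 < s c" "s c' < e2"
    using squeeze[of u c v c' e1 e2] c assms by auto
  have "s ` {c..c'} \<subseteq> {e1<..<e2}"
  proof clarify
    fix x assume "x \<in> {c..c'}"
    then have "s c \<le> s x" "s x \<le> s c'" using Homeo_le[OF PLc_Homeo[OF s(1)]] by auto
    then show "s x \<in> {e1<..<e2}" using s by auto
  qed
  then show ?thesis using PLc_conj_Homeo[OF c(4) s(1)] s(1) PLc_mono by blast
qed

end

section \<open>Perfectness of the groups of compactly supported elements\<close>

definition germ_slope :: "real \<Rightarrow> real set \<Rightarrow> (real \<Rightarrow> real) \<Rightarrow> int \<Rightarrow> bool" where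
  "germ_slope r U h i \<longleftrightarrow> (\<forall>\<^sub>F y in nhds r. y \<in> U \<longrightarrow> h y = r + 2 powi i * (y - r))"

text \<open>Base 2 logarithm of the one-sided derivative at \<open>r\<close>. On \<open>pl2\<close>
  homeomorphisms that fix \<open>r\<close> it is a homomorphism to the integers, by
  \<open>log_slope_comp\<close>.\<close>

definition log_slope :: "real \<Rightarrow> real set \<Rightarrow> (real \<Rightarrow> real) \<Rightarrow> int" where
  "log_slope r U h = (THE i. germ_slope r U h i)"

lemma germ_slope_unique:
  assumes "U = {r..} \<or> U = {..r}" "germ_slope r U h i" "germ_slope r U h j"
  shows "i = j"
proof -
  have "\<forall>\<^sub>F y in nhds r. y \<in> U \<longrightarrow> y \<noteq> r \<longrightarrow> i = j"
    using assms(2,3) unfolding germ_slope_def by eventually_elim (auto simp: powi2_inj)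
  then obtain d where d: "d > 0" "\<And>y. dist y r < d \<Longrightarrow> y \<in> U \<Longrightarrow> y \<noteq> r \<Longrightarrow> i = j"
    unfolding eventually_nhds_metric by blast
  show ?thesis using d(2)[of "r + d / 2"] d(2)[of "r - d / 2"] d(1) assms(1)
    by (auto simp: dist_real_def)
qed

lemma log_slope_eq: "U = {r..} \<or> U = {..r} \<Longrightarrow> germ_slope r U h i \<Longrightarrow> log_slope r U h = i"
  unfolding log_slope_def using germ_slope_unique by blast

lemma germ_slope_exists:
  assumes "pl2 h" "h r = r" "U = {r..} \<or> U = {..r}"
  shows "\<exists>i. germ_slope r U h i"
proof -
  have "germ h r U" using assms by (auto simp: pl2_def)
  then obtain i c where c: "\<forall>\<^sub>F y in nhds r. y \<in> U \<longrightarrow> h y = 2 powi i * y + c"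
    unfolding germ_def by blast
  have "r \<in> U" using assms by auto
  then have r: "r = 2 powi i * r + c" using eventually_nhds_x_imp_x[OF c] assms by simp
  have "germ_slope r U h i" unfolding germ_slope_def
    using c
  proof eventually_elim
    case (elim y)
    show ?case
    proof
      assume "y \<in> U"
      then have "h y = 2 powi i * y + (r - 2 powi i * r)" using elim r by simp
      then show "h y = r + 2 powi i * (y - r)" by (simp add: right_diff_distrib)
    qed
  qed
  then show ?thesis ..
qed

lemma germ_slope_log_slope:
  assumes "pl2 h" "h r = r" "U = {r..} \<or> U = {..r}" shows "germ_slope r U h (log_slope r U h)"
  using germ_slope_exists[OF assms] log_slope_eq[OF assms(3)] by metis

lemma germ_slope_comp:
  assumes "germ_slope r U f i" "germ_slope r U g j" "f \<in> Homeo" "f r = r" "U = {r..} \<or> U = {..r}"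
  shows "germ_slope r U (g \<circ> f) (i + j)"
proof -
  have U: "f y \<in> U" if "y \<in> U" for y
    using that assms(4,5) Homeo_le[OF assms(3), of r y] Homeo_le[OF assms(3), of y r] by auto
  have "\<forall>\<^sub>F y in nhds r. f y \<in> U \<longrightarrow> g (f y) = r + 2 powi j * (f y - r)"
    using eventually_compose_filterlim[OF assms(2)[unfolded germ_slope_def]]
      isCont_nhds[OF Homeo_cont[OF assms(3)], of r] assms(4) by simp
  then show ?thesis
    using assms(1) unfolding germ_slope_def
  proof eventually_elim
    case (elim y)
    show ?case
    proof
      assume y: "y \<in> U"
      have "(g \<circ> f) y = r + 2 powi j * (f y - r)" using elim(1) U[OF y] by simp
      also have "f y = r + 2 powi i * (y - r)" using elim(2) y by simp
      finally show "(g \<circ> f) y = r + 2 powi (i + j) * (y - r)" by (simp add: power_int_add)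
    qed
  qed
qed

context
  fixes r :: real and U
  assumes rU: "U = {r..} \<or> U = {..r}"
begin

lemma log_slope_comp:
  assumes "pl2 f" "f r = r" "pl2 g" "g r = r" "f \<in> Homeo"
  shows "log_slope r U (g \<circ> f) = log_slope r U f + log_slope r U g"
  using log_slope_eq[OF rU germ_slope_comp[OF germ_slope_log_slope[OF assms(1,2) rU] germ_slope_log_slope[OF assms(3,4) rU] assms(5,2) rU]] .

lemma log_slope_id: "log_slope r U id = 0"
  by (rule log_slope_eq[OF rU]) (simp add: germ_slope_def)

lemma log_slope_iv:
  assumes "pl2 f" "f r = r" "f \<in> Homeo" shows "log_slope r U (iv f) = - log_slope r U f"
proof -
  have "log_slope r U (iv f \<circ> f) = log_slope r U f + log_slope r U (iv f)"
    using assms by (intro log_slope_comp) (auto simp: pl2_iv iv_fix)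
  moreover have "iv f \<circ> f = id" using assms(3) by (auto simp: fun_eq_iff)
  ultimately show ?thesis using log_slope_id by simp
qed

end

section \<open>Congruence modulo commutators\<close>

definition cong_comm :: "(real \<Rightarrow> real) set \<Rightarrow> (real \<Rightarrow> real) \<Rightarrow> (real \<Rightarrow> real) \<Rightarrow> bool" where
  "cong_comm S x y \<longleftrightarrow> x \<in> S \<and> y \<in> S \<and> iv y \<circ> x \<in> cprod S"

context
  fixes S assumes S: "perm_group S"
begin

lemma Homeo_bij': "x \<in> S \<Longrightarrow> bij x"
  using S gpD Homeo_bij by blast

lemma cprod_normal: "f \<in> cprod S \<Longrightarrow> s \<in> S \<Longrightarrow> s \<circ> f \<circ> iv s \<in> cprod S"
  by (rule cprod_conj[OF _ S Homeo_bij']) (use gpD[OF S] in auto)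

lemma cong_comm_refl: "x \<in> S \<Longrightarrow> cong_comm S x x"
proof -
  assume x: "x \<in> S"
  then have "iv x \<circ> x = id" using gpD(1)[OF S x] by (auto simp: fun_eq_iff)
  then show ?thesis using x cprod_id unfolding cong_comm_def by metis
qed

lemma cong_comm_trans: assumes "cong_comm S x y" "cong_comm S y z" shows "cong_comm S x z"
proof -
  have H: "y \<in> Homeo" using assms gpD[OF S] by (auto simp: cong_comm_def)
  have "iv z \<circ> x = (iv z \<circ> y) \<circ> (iv y \<circ> x)" by (auto simp: fun_eq_iff f_iv[OF H])
  also have "\<dots> \<in> cprod S" using assms cprod_comp unfolding cong_comm_def by blast
  finally show ?thesis using assms by (simp add: cong_comm_def)
qed

text \<open>Compatibility with products rests on normality of the subgroup of commutator
  products.\<close>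

lemma cong_comm_comp: assumes "cong_comm S x x'"
  "cong_comm S y y'" shows "cong_comm S (x \<circ> y) (x' \<circ> y')"
proof -
  have m: "x \<in> S" "x' \<in> S" "y \<in> S" "y' \<in> S" "iv x' \<circ> x \<in> cprod S" "iv y' \<circ> y \<in> cprod S"
    using assms by (auto simp: cong_comm_def)
  have H: "x' \<in> Homeo" "y' \<in> Homeo" using m gpD[OF S] by auto
  have "iv (x' \<circ> y') \<circ> (x \<circ> y) = (iv y' \<circ> (iv x' \<circ> x) \<circ> iv (iv y')) \<circ> (iv y' \<circ> y)"
    using H by (auto simp: fun_eq_iff iv_comp f_iv[OF H(1)] f_iv[OF H(2)])
  also have "\<dots> \<in> cprod S"
    by (rule cprod_comp[OF cprod_normal[OF m(5) gpD(4)[OF S m(4)]] m(6)])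
  finally show ?thesis using m gpD(3)[OF S] unfolding cong_comm_def by blast
qed

lemma cong_comm_commute: assumes "x \<in> S" "y \<in> S" shows "cong_comm S (x \<circ> y) (y \<circ> x)"
proof -
  have H: "x \<in> Homeo" "y \<in> Homeo" using assms gpD[OF S] by auto
  have "iv (y \<circ> x) \<circ> (x \<circ> y) = commt (iv x) (iv y)"
    using H by (auto simp: commt_def iv_comp fun_eq_iff)
  also have "\<dots> \<in> cprod S" using assms gpD(4)[OF S] by (intro cprod_commt) auto
  finally show ?thesis using assms gpD(3)[OF S] unfolding cong_comm_def by blast
qed

end

abbreviation zpow :: "(real \<Rightarrow> real) \<Rightarrow> int \<Rightarrow> real \<Rightarrow> real" where
  "zpow f n \<equiv> f [^]\<^bsub>homeo_plus UNIV\<^esub> n"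

lemma zpow_add: "f \<in> Homeo \<Longrightarrow> zpow f (m + n) = zpow f m \<circ> zpow f n"
  using group.int_pow_mult[OF group_homeo_plus, of f UNIV n m]
  by (simp add: Homeo_carrier add.commute)

lemma zpow_0: "zpow f 0 = id"
  by (simp add: int_pow_def)

lemma zpow_1: "f \<in> Homeo \<Longrightarrow> zpow f 1 = f"
  using group.int_pow_1[OF group_homeo_plus, of f UNIV] by (simp add: Homeo_carrier)

lemma zpow_m1: "f \<in> Homeo \<Longrightarrow> zpow f (- 1) = iv f"
  using group.int_pow_neg[OF group_homeo_plus, of f UNIV 1]
  by (simp add: Homeo_carrier zpow_1 homeo_inv)

lemma zpow_perm_group: assumes "perm_group S" "f \<in> S" shows "zpow f n \<in> S"
proof (induction n rule: int_induct[where k = 0])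
  case base
  show ?case unfolding zpow_0 by (rule gpD[OF assms(1)])
next
  case (step1 i)
  then show ?case using zpow_add[of f i 1] zpow_1[of f] gpD(1,3)[OF assms(1)] assms(2) by metis
next
  case (step2 i)
  moreover have "zpow f (i - 1) = zpow f i \<circ> iv f"
    using zpow_add[of f i "-1"] zpow_m1[of f] gpD(1)[OF assms(1)] assms(2) by simp
  ultimately show ?case using gpD(3,4)[OF assms(1)] assms(2) by metis
qed

text \<open>In the abelianization a word in \<open>p\<close> and \<open>q\<close> is determined by
  its two exponent sums. The inductive step collects powers by interchanging the middle two
  factors.\<close>

lemma two_generated_cong_comm:
  assumes S: "perm_group S" and pq: "p \<in> S" "q \<in> S"
    and car: "S \<subseteq> carrier (homeo_plus {0..1})"
    and h: "h \<in> generate (homeo_plus {0..1}) {p, q}"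
  shows "\<exists>m n. cong_comm S h (zpow p m \<circ> zpow q n)"
  using h
proof (induction rule: generate.induct)
  note H = gpD(1)[OF S]
  note mem = zpow_perm_group[OF S pq(1)] zpow_perm_group[OF S pq(2)]
  {
    case one
    have "cong_comm S id (zpow p 0 \<circ> zpow q 0)" unfolding zpow_0
      using cong_comm_refl[OF S gpD(2)[OF S]] by simp
    then show ?case unfolding homeo_one by blast
  next
    case (incl h)
    have "cong_comm S p (zpow p 1 \<circ> zpow q 0)" "cong_comm S q (zpow p 0 \<circ> zpow q 1)"
      unfolding zpow_0 zpow_1[OF H[OF pq(1)]] zpow_1[OF H[OF pq(2)]] using cong_comm_refl[OF S] pq
      by simp_all
    then show ?case using incl by blast
  next
    case (inv h)
    have "cong_comm S (iv p) (zpow p (-1) \<circ> zpow q 0)" "cong_comm S (iv q) (zpow p 0 \<circ> zpow q (-1))"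
      unfolding zpow_0 zpow_m1[OF H[OF pq(1)]] zpow_m1[OF H[OF pq(2)]]
      using cong_comm_refl[OF S gpD(4)[OF S]] pq by simp_all
    moreover have "inv\<^bsub>homeo_plus {0..1}\<^esub> h = iv h" using homeo01_inv inv car pq by blast
    ultimately show ?case using inv by (metis insertE singletonD)
  next
    case (eng h1 h2)
    then obtain m n m' n'
      where *: "cong_comm S h1 (zpow p m \<circ> zpow q n)" "cong_comm S h2 (zpow p m' \<circ> zpow q n')"
        by blast
    have "cong_comm S (h2 \<circ> h1) ((zpow p m' \<circ> zpow q n') \<circ> (zpow p m \<circ> zpow q n))"
      by (rule cong_comm_comp[OF S *(2,1)])
    moreover have "cong_comm S (zpow p m' \<circ> ((zpow q n' \<circ> zpow p m) \<circ> zpow q n)) (zpow p m' \<circ> ((zpow p m \<circ> zpow q n') \<circ> zpow q n))"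
      by (intro cong_comm_comp[OF S] cong_comm_refl[OF S] cong_comm_commute[OF S] mem)
    moreover have "zpow p m' \<circ> ((zpow p m \<circ> zpow q n') \<circ> zpow q n) = zpow p (m' + m) \<circ> zpow q (n' + n)"
      by (simp add: zpow_add H pq comp_assoc)
    ultimately have "cong_comm S (h2 \<circ> h1) (zpow p (m' + m) \<circ> zpow q (n' + n))"
      using cong_comm_trans[OF S] by (simp add: comp_assoc)
    then show ?case unfolding homeo_mult by blast
  }
qed

lemma log_slope_zpow:
  assumes "U = {r..} \<or> U = {..r}" "f \<in> PLc A" "f r = r"
  shows "log_slope r U (zpow f n) = n * log_slope r U f"
proof -
  have m: "zpow f n \<in> PLc A" for n by (rule zpow_perm_group[OF perm_group_PLc assms(2)])
  have p: "pl2 (zpow f n)" "zpow f n \<in> Homeo" for n using m by (auto simp: PLc_def)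
  have H: "f \<in> Homeo" "pl2 f" using assms by (auto simp: PLc_def)
  have fx: "zpow f n r = r" for n
  proof -
    have "perm_group {g \<in> Homeo. g r = r}" by (auto simp: perm_group_def iv_fix)
    then show ?thesis using zpow_perm_group[of "{g \<in> Homeo. g r = r}" f n] H assms by auto
  qed
  have s: "log_slope r U (zpow f (n + 1)) = log_slope r U (zpow f n) + log_slope r U f" for n
    using log_slope_comp[OF assms(1) H(2) assms(3) p(1) fx H(1)] zpow_add[OF H(1), of n 1] zpow_1[OF H(1)] by simp
  show ?thesis
  proof (induction n rule: int_induct[where k = 0])
    case base
    show ?case by (simp only: zpow_0 log_slope_id[OF assms(1)] mult_zero_left)
  next
    case (step1 i)
    then show ?case using s[of i] by (simp add: algebra_simps)
  next
    case (step2 i)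
    then show ?case using s[of "i - 1"] by (simp add: algebra_simps)
  qed
qed

text \<open>The slope at a common fixed point is a homomorphism to an abelian group, so it kills
  commutators.\<close>

lemma log_slope_cprod:
  assumes "U = {r..} \<or> U = {..r}" "f \<in> cprod (PLc A)" "\<And>g. g \<in> PLc A \<Longrightarrow> g r = r"
  shows "log_slope r U f = 0"
  using assms(2)
proof (induction rule: cprod.induct)
  case cprod_id
  then show ?case by (rule log_slope_id[OF assms(1)])
next
  case (cprod_step a b f)
  have P: "pl2 g" "g \<in> Homeo" if "g \<in> PLc A" for g using that by (auto simp: PLc_def)
  note P = P(1) assms(3) P(2)
  have ab: "a \<in> PLc A" "b \<in> PLc A" by fact+
  have m: "iv a \<in> PLc A" "iv b \<in> PLc A" using gpD(4)[OF perm_group_PLc] ab by blast+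
  have fB: "f \<in> PLc A" using cprod_step cprod_sub[OF _ perm_group_PLc] by blast
  have ab': "a \<circ> b \<in> PLc A" by (rule gpD(3)[OF perm_group_PLc ab])
  have ab'': "a \<circ> b \<circ> iv a \<in> PLc A" by (rule gpD(3)[OF perm_group_PLc ab' m(1)])
  have c: "commt a b \<in> PLc A" by (rule perm_group_commt[OF perm_group_PLc ab])
  have add: "log_slope r U (g \<circ> h) = log_slope r U h + log_slope r U g" if "h \<in> PLc A" "g \<in> PLc A"
    for g h
    by (rule log_slope_comp[OF assms(1) P(1)[OF that(1)] P(2)[OF that(1)] P(1)[OF that(2)] P(2)[OF that(2)] P(3)[OF that(1)]])
  have neg: "log_slope r U (iv g) = - log_slope r U g" if "g \<in> PLc A" for g
    by (rule log_slope_iv[OF assms(1) P(1)[OF that] P(2)[OF that] P(3)[OF that]])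
  have "log_slope r U (commt a b \<circ> f) = log_slope r U f + log_slope r U (commt a b)"
    by (rule add[OF fB c])
  also have "log_slope r U (commt a b) = log_slope r U (iv b) + log_slope r U (a \<circ> b \<circ> iv a)"
    unfolding commt_def by (rule add[OF m(2) ab''])
  also have "log_slope r U (a \<circ> b \<circ> iv a) = log_slope r U (iv a) + log_slope r U (a \<circ> b)"
    by (rule add[OF m(1) ab'])
  also have "log_slope r U (a \<circ> b) = log_slope r U b + log_slope r U a" by (rule add[OF ab(2,1)])
  finally show ?case using cprod_step.IH neg[OF ab(1)] neg[OF ab(2)] by simp
qed

text \<open>The integer matrix with rows \<open>(a, c)\<close> and \<open>(b, d)\<close> has a left
  inverse. Its determinant divides 1, so only the zero row vector is sent to zero.\<close>

lemma two_by_two_cancel: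
  fixes a b c d :: int
  assumes "m0 * a + n0 * b = 1" "m0 * c + n0 * d = 0" "m1 * a + n1 * b = 0" "m1 * c + n1 * d = 1"
    and "m * a + n * b = 0" "m * c + n * d = 0"
  shows "m = 0 \<and> n = 0"
proof -
  have "(m0 * n1 - n0 * m1) * (a * d - b * c) = 1" using assms by algebra
  then have nz: "a * d - b * c \<noteq> 0" by auto
  have "m * (a * d - b * c) = 0" "n * (a * d - b * c) = 0" using assms by algebra+
  then show ?thesis using nz by simp
qed

context thompson_gens
begin

text \<open>
  The germs at the two endpoints give two independent homomorphisms from the two-generated
  group \<open>F_on (1/16) (15/16)\<close> to the integers. Hence an element that is trivial
  near both endpoints has exponent sum zero in each of the generators.
\<close>

lemma perfect_core:
  assumes "h \<in> PLc {1/16<..<15/16}" shows "h \<in> cprod (PLc {1/16..15/16})"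
proof -
  let ?S = "PLc {1/16..15/16::real}"
  note S = perm_group_PLc[of "{1/16..15/16}"]
  have gen: "generate (homeo_plus {0..1}) {\<nu>2, \<nu>3} = ?S" using nu_gen by (simp add: F_on_PLc)
  have car: "?S \<subseteq> carrier (homeo_plus {0..1})"
    using PLc_fix[of _ "{1/16..15/16}"] by (auto simp: homeo01_iff PLc_Homeo)
  have nu: "\<nu>2 \<in> ?S" "\<nu>3 \<in> ?S" using gen generate.incl by (metis insertCI)+
  have sub: "\<exists>m n. cong_comm ?S f (zpow \<nu>2 m \<circ> zpow \<nu>3 n)" if "f \<in> ?S" for f
    using two_generated_cong_comm[OF S nu car] gen that by blast
  have fix0: "f (1/16) = 1/16" "f (15/16) = 15/16" if f: "f \<in> ?S" for f
  proof -
    have H: "f \<in> Homeo" using f PLc_Homeo by blast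
    have fo: "f x = x" if "x < 1/16 \<or> x > 15/16" for x using PLc_fix[OF f, of x] that by auto
    have a: "\<not> f (1/16) < 1/16" "\<not> f (15/16) > 15/16"
      using fo[of "f (1/16)"] fo[of "f (15/16)"] Homeo_inj[OF H, of "f (1/16)"
      "1/16"] Homeo_inj[OF H, of "f (15/16)" "15/16"] by auto
    have b: "\<not> iv f (1/16) < 1/16" "\<not> iv f (15/16) > 15/16"
      using fo[of "iv f (1/16)"] fo[of "iv f (15/16)"] f_iv[OF H] by auto
    show "f (1/16) = 1/16"
      using a(1) b(1) Homeo_less[OF H, of "iv f (1/16)" "1/16"] f_iv[OF H, of "1/16"] by simp
    show "f (15/16) = 15/16"
      using a(2) b(2) Homeo_less[OF H, of "15/16" "iv f (15/16)"] f_iv[OF H, of "15/16"] by simp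
  qed
  have P: "pl2 f" "f \<in> Homeo" if "f \<in> ?S" for f using that by (auto simp: PLc_def)
  let ?U = "{1/16..} :: real set" and ?V = "{..15/16} :: real set"
  have UV: "?U = {1/16..} \<or> ?U = {..1/16}" "?V = {15/16..} \<or> ?V = {..15/16}" by auto
  have lin: "log_slope (1/16) ?U f = m * log_slope (1/16) ?U \<nu>2 + n * log_slope (1/16) ?U \<nu>3 \<and>
      log_slope (15/16) ?V f = m * log_slope (15/16) ?V \<nu>2 + n * log_slope (15/16) ?V \<nu>3"
    if "cong_comm ?S f (zpow \<nu>2 m \<circ> zpow \<nu>3 n)" for f m n
  proof -
    let ?w = "zpow \<nu>2 m \<circ> zpow \<nu>3 n"
    have mem: "?w \<in> ?S" "f \<in> ?S" "iv ?w \<circ> f \<in> cprod ?S" "iv ?w \<in> ?S"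
      using that gpD(4)[OF S] by (auto simp: cong_comm_def)
    have "log_slope r X f = m * log_slope r X \<nu>2 + n * log_slope r X \<nu>3"
      if r: "X = {r..} \<or> X = {..r}" "\<And>g. g \<in> ?S \<Longrightarrow> g r = r" for r X
    proof -
      have add: "log_slope r X (g \<circ> h) = log_slope r X h + log_slope r X g" if "h \<in> ?S" "g \<in> ?S"
        for g h
        by (rule log_slope_comp[OF r(1) P(1)[OF that(1)] r(2)[OF that(1)] P(1)[OF that(2)] r(2)[OF that(2)] P(2)[OF that(1)]])
      have "0 = log_slope r X (iv ?w \<circ> f)"
        using log_slope_cprod[of X r "iv ?w \<circ> f" "{1/16..15/16}"] mem(3) r by metis
      also have "\<dots> = log_slope r X f + log_slope r X (iv ?w)" by (rule add[OF mem(2,4)])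
      also have "log_slope r X (iv ?w) = - log_slope r X ?w"
        by (rule log_slope_iv[OF r(1) P(1)[OF mem(1)] r(2)[OF mem(1)] P(2)[OF mem(1)]])
      also have "log_slope r X ?w = log_slope r X (zpow \<nu>3 n) + log_slope r X (zpow \<nu>2 m)"
        by (rule add[OF zpow_perm_group[OF S nu(2)] zpow_perm_group[OF S nu(1)]])
      finally show ?thesis
        using log_slope_zpow[OF r(1) nu(1) r(2)[OF nu(1)]] log_slope_zpow[OF r(1) nu(2) r(2)[OF nu(2)]] by simp
    qed
    then show ?thesis using UV fix0 by blast
  qed
  have c0_id: "c0 x = x" if "x \<le> 0 \<or> x \<ge> 1/4" for x
  proof -
    have "x \<notin> supp c0" using that c0_supp by auto
    then show ?thesis by (simp add: supp_def)
  qed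
  have c0_d: "c0 t = 2 * t" if "0 \<le> t" "t < 1/16" for t
    using that c0_double c0_id[of 0] by (cases "t = 0") auto
  \<comment> \<open>\<open>p\<close> is \<open>c0\<close> moved to the left end 1/16, and
    \<open>q\<close> is its mirror image at the right end 15/16. As \<open>c0\<close> doubles near
    0, their logarithmic slopes at the two ends are (1, 0) and (0, 1).\<close>
  define \<alpha> where "\<alpha> = (\<lambda>y::real. 1 * 2 powi 0 * y + 1/16)"
  define \<beta> where "\<beta> = (\<lambda>y::real. - 1 * 2 powi 0 * y + 15/16)"
  have d16: "1/16 \<in> dyadic" "15/16 \<in> dyadic"
    using dyadic_half[OF dyadic_half[OF dyadic_half[OF dyadic_half[OF dyadic_numeral(2)]]]]
      dyadic_half[OF dyadic_half[OF dyadic_half[OF dyadic_half[OF dyadic_of_int[of 15]]]]]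
        by simp_all
  have a: "aff \<alpha>" "aff \<beta>" unfolding \<alpha>_def \<beta>_def by (rule affI; simp add: d16)+
  define p where "p = \<alpha> \<circ> c0 \<circ> iv \<alpha>"
  define q where "q = \<beta> \<circ> c0 \<circ> iv \<beta>"
  have iva: "iv \<alpha> y = y - 1/16" for y
    using aff_iv_f[OF a(1), of "y - 1/16"] by (simp add: \<alpha>_def)
  have ivb: "iv \<beta> y = 15/16 - y" for y
    using aff_iv_f[OF a(2), of "15/16 - y"] by (simp add: \<beta>_def)
  have pe: "p y = c0 (y - 1/16) + 1/16" for y unfolding p_def o_apply iva by (simp add: \<alpha>_def)
  have qe: "q y = 15/16 - c0 (15/16 - y)" for y unfolding q_def o_apply ivb by (simp add: \<beta>_def)
  have "\<alpha> ` {0..1/4} \<subseteq> {1/16..15/16}" "\<beta> ` {0..1/4} \<subseteq> {1/16..15/16}" by (auto simp: \<alpha>_def \<beta>_def)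
  then have pq: "p \<in> ?S" "q \<in> ?S"
    unfolding p_def q_def using PLc_conj[OF c0_PLc] a PLc_mono by blast+
  have "germ_slope (1/16) ?U p 1"
  proof -
    have "p y = 1/16 + 2 powi 1 * (y - 1/16)" if "1/16 \<le> y" "y < 2/16" for y
      using that c0_d[of "y - 1/16"] unfolding pe by auto
    then show ?thesis
      unfolding germ_slope_def atLeast_iff eventually_nhds_ge_iff by (intro exI[of _ "2/16"]) simp
  qed
  moreover have "germ_slope (15/16) ?V p 0"
  proof -
    have "p y = 15/16 + 2 powi 0 * (y - 15/16)" if "14/16 < y" "y \<le> 15/16" for y
      using that c0_id[of "y - 1/16"] unfolding pe by auto
    then show ?thesis
      unfolding germ_slope_def atMost_iff eventually_nhds_le_iff by (intro exI[of _ "14/16"]) simp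
  qed
  moreover have "germ_slope (1/16) ?U q 0"
  proof -
    have "q y = 1/16 + 2 powi 0 * (y - 1/16)" if "1/16 \<le> y" "y < 2/16" for y
      using that c0_id[of "15/16 - y"] unfolding qe by auto
    then show ?thesis
      unfolding germ_slope_def atLeast_iff eventually_nhds_ge_iff by (intro exI[of _ "2/16"]) simp
  qed
  moreover have "germ_slope (15/16) ?V q 1"
  proof -
    have "q y = 15/16 + 2 powi 1 * (y - 15/16)" if "14/16 < y" "y \<le> 15/16" for y
      using that c0_d[of "15/16 - y"] unfolding qe by auto
    then show ?thesis
      unfolding germ_slope_def atMost_iff eventually_nhds_le_iff by (intro exI[of _ "14/16"]) simp
  qed
  ultimately have lpq: "log_slope (1/16) ?U p = 1" "log_slope (15/16) ?V p = 0"
    "log_slope (1/16) ?U q = 0" "log_slope (15/16) ?V q = 1"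
    using log_slope_eq UV by blast+
  obtain C where C: "compact C" "C \<subseteq> {1/16<..<15/16}" "\<And>x. x \<notin> C \<Longrightarrow> h x = x"
    using assms by (auto simp: PLc_def)
  have "open (- C)" using C(1) by (simp add: compact_imp_closed open_Compl)
  then have "\<forall>\<^sub>F y in nhds (1/16). y \<in> - C" "\<forall>\<^sub>F y in nhds (15/16). y \<in> - C"
    using subsetD[OF C(2), of "1/16"] subsetD[OF C(2), of "15/16"] eventually_nhds_in_open[of "- C"]
    by auto
  then have "germ_slope (1/16) ?U h 0" "germ_slope (15/16) ?V h 0"
    using C(3) unfolding germ_slope_def by (auto elim!: eventually_mono)
  then have lh: "log_slope (1/16) ?U h = 0" "log_slope (15/16) ?V h = 0" using log_slope_eq UV
    by blast+
  have hS: "h \<in> ?S" using assms by (rule PLc_mono) auto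
  obtain m n where mn: "cong_comm ?S h (zpow \<nu>2 m \<circ> zpow \<nu>3 n)" using sub[OF hS] by blast
  obtain m0 n0 where mn0: "cong_comm ?S p (zpow \<nu>2 m0 \<circ> zpow \<nu>3 n0)" using sub[OF pq(1)] by blast
  obtain m1 n1 where mn1: "cong_comm ?S q (zpow \<nu>2 m1 \<circ> zpow \<nu>3 n1)" using sub[OF pq(2)] by blast
  \<comment> \<open>The slope pairs of \<open>p\<close> and \<open>q\<close> are the unit vectors,
    so the slope matrix of the two generators is invertible; both slopes of \<open>h\<close> vanish,
    and with them its exponent sums.\<close>
  have "m = 0 \<and> n = 0"
    using lin[OF mn] lin[OF mn0] lin[OF mn1] lpq lh
    by (intro two_by_two_cancel[of m0 _ n0 _ _ _ m1 n1]) auto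
  then have "cong_comm ?S h id" using mn by (simp add: zpow_0)
  then show ?thesis by (simp add: cong_comm_def)
qed

text \<open>\<open>h\<close> is compressed into an affine copy of the core interval. There the
  commutators of \<open>perfect_core\<close> have entries supported in a closed interval, which lies
  inside \<open>{u<..<v}\<close>, so the ends of the copy do no harm.\<close>

lemma perfect:
  assumes "h \<in> PLc {u<..<v}" "u < v" shows "h \<in> cprod (PLc {u<..<v})"
proof -
  obtain \<alpha> where a: "aff \<alpha>" "\<alpha> \<in> Homeo" "\<alpha> ` {0..1} \<subseteq> {u<..<v}" using small_copy[OF assms(2)] .
  have "\<alpha> (1/16) < \<alpha> (15/16)" using Homeo_less[OF a(2)] by simp
  moreover have "\<alpha> (1/16) \<in> {u<..<v}" "\<alpha> (15/16) \<in> {u<..<v}"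
    by (rule subsetD[OF a(3)], rule imageI, simp)+
  ultimately obtain s where s: "s \<in> PLc {u<..<v}" "s \<circ> h \<circ> iv s \<in> PLc {\<alpha> (1/16)<..<\<alpha> (15/16)}"
    using squeeze_PLc[OF assms, of "\<alpha> (1/16)" "\<alpha> (15/16)"] by auto
  let ?h = "s \<circ> h \<circ> iv s"
  have sH: "s \<in> Homeo" "bij s" using s PLc_Homeo Homeo_bij by blast+
  have "iv \<alpha> ` {\<alpha> (1/16)<..<\<alpha> (15/16)} \<subseteq> {1/16<..<15/16}"
  proof clarify
    fix x assume x: "x \<in> {\<alpha> (1/16)<..<\<alpha> (15/16)}"
    then show "iv \<alpha> x \<in> {1/16<..<15/16}"
      using Homeo_less[OF a(2), of "1/16" "iv \<alpha> x"] Homeo_less[OF a(2), of "iv \<alpha> x"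
      "15/16"] f_iv[OF a(2), of x] by simp
  qed
  then have "iv \<alpha> \<circ> ?h \<circ> iv (iv \<alpha>) \<in> PLc {1/16<..<15/16}"
    using PLc_conj[OF s(2) aff_iv[OF a(1)]] PLc_mono by blast
  from perfect_core[OF this]
  have 1: "iv \<alpha> \<circ> ?h \<circ> \<alpha> \<in> cprod (PLc {1/16..15/16})" by (simp add: aff_iv_iv[OF a(1)])
  have "\<alpha> \<circ> (iv \<alpha> \<circ> ?h \<circ> \<alpha>) \<circ> iv \<alpha> \<in> cprod (PLc {u<..<v})"
  proof (rule cprod_conj[OF 1 perm_group_PLc aff_bij[OF a(1)]])
    fix b assume "b \<in> PLc {1/16..15/16}"
    then have "\<alpha> \<circ> b \<circ> iv \<alpha> \<in> PLc (\<alpha> ` {1/16..15/16})" by (rule PLc_conj[OF _ a(1)])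
    then show "\<alpha> \<circ> b \<circ> iv \<alpha> \<in> PLc {u<..<v}"
      by (rule PLc_mono) (intro subset_trans[OF image_mono a(3)], simp)
  qed
  moreover have "\<alpha> \<circ> (iv \<alpha> \<circ> ?h \<circ> \<alpha>) \<circ> iv \<alpha> = ?h"
    by (auto simp: fun_eq_iff aff_f_iv[OF a(1)])
  ultimately have 2: "?h \<in> cprod (PLc {u<..<v})" by metis
  have "iv s \<circ> ?h \<circ> iv (iv s) \<in> cprod (PLc {u<..<v})"
    by (rule cprod_normal[OF perm_group_PLc 2]) (use s gpD(4)[OF perm_group_PLc] in blast)
  moreover have "iv s \<circ> ?h \<circ> iv (iv s) = h" using sH by (auto simp: fun_eq_iff)
  ultimately show ?thesis by metis
qed

end

section \<open>Isometries and equivariant copies\<close>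

definition isom :: "(real \<Rightarrow> real) \<Rightarrow> bool" where
  "isom \<sigma> \<longleftrightarrow> (\<exists>e\<in>{1,-1}. \<exists>d::int. \<sigma> = (\<lambda>x. e * x + of_int d))"

definition slope :: "(real \<Rightarrow> real) \<Rightarrow> real" where
  "slope \<sigma> = \<sigma> 1 - \<sigma> 0"

lemma isoE:
  assumes "isom \<sigma>"
  obtains d :: int where "slope \<sigma> \<in> {1,-1}" "\<sigma> = (\<lambda>x. slope \<sigma> * x + of_int d)"
  using assms unfolding isom_def slope_def by fastforce

lemma isoI: "e \<in> {1,-1} \<Longrightarrow> d \<in> \<int> \<Longrightarrow> isom (\<lambda>x. e * x + d)"
  unfolding isom_def by (auto elim!: Ints_cases)

lemma slope_affine [simp]: "slope (\<lambda>x. e * x + d) = e"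
  by (simp add: slope_def)

lemma isom_id [simp]: "isom id" "slope id = 1"
  using isoI[of 1 0] by (auto simp: slope_def id_def)

lemma isom_aff: "isom \<sigma> \<Longrightarrow> aff \<sigma>"
  unfolding isom_def aff_def by (force intro: bexI[of _ "of_int _"] exI[of _ 0])

lemma isom_f_iv: "isom \<sigma> \<Longrightarrow> \<sigma> (iv \<sigma> x) = x"
  using aff_f_iv isom_aff by blast

lemma isom_iv_f: "isom \<sigma> \<Longrightarrow> iv \<sigma> (\<sigma> x) = x"
  using aff_iv_f isom_aff by blast

lemma isom_inj: "isom \<sigma> \<Longrightarrow> \<sigma> x = \<sigma> y \<longleftrightarrow> x = y"
  using isom_iv_f by metis

lemma isom_diff: "isom \<sigma> \<Longrightarrow> \<sigma> x - \<sigma> y = slope \<sigma> * (x - y)"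
  by (erule isoE) (simp add: fun_eq_iff right_diff_distrib)

lemma slope_cases: "isom \<sigma> \<Longrightarrow> slope \<sigma> = 1 \<or> slope \<sigma> = -1"
  by (erule isoE) auto

lemma isom_dist: "isom \<sigma> \<Longrightarrow> \<bar>\<sigma> x - \<sigma> y\<bar> = \<bar>x - y\<bar>"
  using isom_diff[of \<sigma> x y] slope_cases[of \<sigma>] by (auto simp: abs_mult)

lemma isom_comp:
  assumes "isom \<sigma>" "isom \<tau>" shows "isom (\<sigma> \<circ> \<tau>)" "slope (\<sigma> \<circ> \<tau>) = slope \<sigma> * slope \<tau>"
proof -
  obtain d where d: "slope \<sigma> \<in> {1,-1}" "\<sigma> = (\<lambda>x. slope \<sigma> * x + of_int d)" using isoE[OF assms(1)] .
  obtain d' where d': "slope \<tau> \<in> {1,-1}" "\<tau> = (\<lambda>x. slope \<tau> * x + of_int d')"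
    using isoE[OF assms(2)] .
  have eq: "\<sigma> \<circ> \<tau> = (\<lambda>x. (slope \<sigma> * slope \<tau>) * x + (slope \<sigma> * of_int d' + of_int d))"
    by (subst d(2), subst d'(2)) (auto simp: fun_eq_iff algebra_simps)
  show "isom (\<sigma> \<circ> \<tau>)" unfolding eq using d(1) d'(1) by (intro isoI) auto
  show "slope (\<sigma> \<circ> \<tau>) = slope \<sigma> * slope \<tau>" unfolding eq by simp
qed

lemma isom_iv:
  assumes "isom \<sigma>" shows "isom (iv \<sigma>)" "slope (iv \<sigma>) = slope \<sigma>"
proof -
  obtain d where d: "slope \<sigma> \<in> {1,-1}" "\<sigma> = (\<lambda>x. slope \<sigma> * x + of_int d)" using isoE[OF assms] .
  let ?t = "\<lambda>x. slope \<sigma> * x + (- slope \<sigma> * of_int d)"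
  have "\<sigma> (?t x) = x" for x
  proof -
    have "\<sigma> (?t x) = slope \<sigma> * ?t x + of_int d" using d(2) by metis
    also have "\<dots> = x" using d(1) by auto
    finally show ?thesis .
  qed
  then have eq: "iv \<sigma> = ?t" using isom_iv_f[OF assms] by (metis ext)
  show "isom (iv \<sigma>)" unfolding eq using d(1) by (intro isoI) auto
  show "slope (iv \<sigma>) = slope \<sigma>" unfolding eq by (rule slope_affine)
qed

lemma isom_eqI:
  assumes "isom \<sigma>" "isom \<tau>" "\<sigma> k = \<tau> k" "slope \<sigma> = slope \<tau>" shows "\<sigma> = \<tau>"
proof
  fix x show "\<sigma> x = \<tau> x" using isom_diff[OF assms(1), of x k] isom_diff[OF assms(2), of x k] assms
    by simp
qed

lemma half_ints_iff: "k \<in> half_ints \<longleftrightarrow> (\<exists>m::int. k = of_int m / 2)"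
  unfolding half_ints_def Ints_def by (auto simp: field_simps)

lemma half_ints_step: "k \<in> half_ints \<Longrightarrow> k + 1/2 \<in> half_ints" "k \<in> half_ints \<Longrightarrow> k - 1/2 \<in> half_ints"
  by (auto simp: half_ints_def)

lemma Ints_half [simp]: "k \<in> \<int> \<Longrightarrow> k \<in> half_ints"
  by (auto simp: half_ints_def)

lemma half_ints_less: assumes "j \<in> half_ints" "k \<in> half_ints" "j < k" shows "j + 1/2 \<le> k"
proof -
  obtain m n :: int where "j = of_int m / 2" "k = of_int n / 2" using assms
    by (auto simp: half_ints_iff)
  moreover from this have "m + 1 \<le> n" using assms(3) by auto
  then have "real_of_int m + 1 \<le> real_of_int n" by linarith
  ultimately show ?thesis by simp
qed

lemma isom_Ints: assumes "isom \<sigma>" shows "\<sigma> k \<in> \<int> \<longleftrightarrow> k \<in> \<int>"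
proof -
  have *: "\<sigma> k \<in> \<int>" if k: "k \<in> \<int>" "isom \<sigma>" for \<sigma> k
  proof -
    obtain d where d: "slope \<sigma> \<in> {1,-1}" "\<sigma> = (\<lambda>x. slope \<sigma> * x + of_int d)" using isoE[OF k(2)] .
    have "slope \<sigma> * k + of_int d \<in> \<int>" using d(1) k(1) by auto
    then show ?thesis using d(2) by metis
  qed
  show ?thesis using *[of k \<sigma>] *[of "\<sigma> k" "iv \<sigma>"] assms isom_iv(1) isom_iv_f by metis
qed

lemma isom_half: assumes "isom \<sigma>" shows "\<sigma> k \<in> half_ints \<longleftrightarrow> k \<in> half_ints"
proof -
  have *: "\<sigma> k \<in> half_ints" if k: "k \<in> half_ints" "isom \<sigma>" for \<sigma> k
  proof -
    obtain d where d: "slope \<sigma> \<in> {1,-1}" "\<sigma> = (\<lambda>x. slope \<sigma> * x + of_int d)" using isoE[OF k(2)] .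
    have "2 * \<sigma> k = slope \<sigma> * (2 * k) + of_int (2 * d)" by (subst d(2)) simp
    also have "\<dots> \<in> \<int>" using d(1) k(1) unfolding half_ints_def by auto
    finally show ?thesis by (simp add: half_ints_def)
  qed
  show ?thesis using *[of k \<sigma>] *[of "\<sigma> k" "iv \<sigma>"] assms isom_iv(1) isom_iv_f by metis
qed

text \<open>A reflection sends \<open>k\<close> to \<open>d - k\<close>, and
  \<open>d - 2 * k\<close> is an integer for a letter position \<open>k\<close>. So isometries keep
  positions of a-letters and of b-letters apart.\<close>

lemma isom_shift_Ints: assumes "isom \<sigma>" "k \<in> half_ints" shows "\<sigma> k - k \<in> \<int>"
proof -
  obtain d where d: "slope \<sigma> \<in> {1,-1}" "\<sigma> = (\<lambda>x. slope \<sigma> * x + of_int d)" using isoE[OF assms(1)] .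
  have "\<sigma> k = slope \<sigma> * k + of_int d" using d(2) by metis
  then have "\<sigma> k - k = of_int d \<or> \<sigma> k - k = of_int d - 2 * k" using d(1) by auto
  moreover have "of_int d - 2 * k \<in> \<int>" using assms(2) by (auto simp: half_ints_def)
  ultimately show ?thesis by (metis Ints_of_int)
qed

text \<open>Both inequalities are strict because the intervals of length 1 around half-integers
  overlap; \<open>k\<close> is half of the rounded value of \<open>2 * s\<close>.\<close>

lemma nearest_half: obtains k where "k \<in> half_ints" "k - 1/2 < s" "s < k + 1/2"
proof
  show "of_int \<lfloor>2 * s + 1/2\<rfloor> / 2 \<in> half_ints" by (auto simp: half_ints_iff)
  show "of_int \<lfloor>2 * s + 1/2\<rfloor> / 2 - 1/2 < s" "s < of_int \<lfloor>2 * s + 1/2\<rfloor> / 2 + 1/2" by linarith+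
qed

text \<open>
  A triple \<open>(\<sigma>, u, v)\<close> in a family stands for the copy of the interval from
  \<open>u\<close> to \<open>v\<close> under \<open>\<sigma>\<close>;
  \<open>spread \<S> h\<close> acts on each of these copies as the conjugate of \<open>h\<close>.
\<close>

definition indep :: "((real \<Rightarrow> real) \<times> real \<times> real) set \<Rightarrow> bool" where
  "indep \<S> \<longleftrightarrow> (\<forall>(\<sigma>,u,v)\<in>\<S>. isom \<sigma>) \<and>
     (\<forall>\<sigma> u v \<tau> u' v' x y. (\<sigma>,u,v) \<in> \<S> \<longrightarrow> (\<tau>,u',v') \<in> \<S> \<longrightarrow> u < x \<longrightarrow> x < v \<longrightarrow>
        u' < y \<longrightarrow> y < v' \<longrightarrow> \<sigma> x = \<tau> y \<longrightarrow> \<sigma> = \<tau> \<and> u = u' \<and> v = v')"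

definition region :: "((real \<Rightarrow> real) \<times> real \<times> real) set \<Rightarrow> real set" where
  "region \<S> = {\<sigma> y | \<sigma> u v y. (\<sigma>,u,v) \<in> \<S> \<and> u < y \<and> y < v}"

definition spread :: "((real \<Rightarrow> real) \<times> real \<times> real) set \<Rightarrow> (real \<Rightarrow> real) \<Rightarrow> real \<Rightarrow> real" where
  "spread \<S> h x = (if x \<in> region \<S>
     then (SOME z. \<exists>\<sigma> u v y. (\<sigma>,u,v) \<in> \<S> \<and> u < y \<and> y < v \<and> x = \<sigma> y \<and> z = \<sigma> (h y)) else x)"

text \<open>Maps that fix the ends of every source interval preserve these intervals, which is what
  makes \<open>spread\<close> multiplicative.\<close>

definition stabil :: "((real \<Rightarrow> real) \<times> real \<times> real) set \<Rightarrow> (real \<Rightarrow> real) set" where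
  "stabil \<S> = {h \<in> Homeo. \<forall>(\<sigma>,u,v)\<in>\<S>. h u = u \<and> h v = v}"

lemma indep_iso: "indep \<S> \<Longrightarrow> (\<sigma>,u,v) \<in> \<S> \<Longrightarrow> isom \<sigma>"
  unfolding indep_def by blast

lemma indep_eq:
  "indep \<S> \<Longrightarrow> (\<sigma>,u,v) \<in> \<S> \<Longrightarrow> (\<tau>,u',v') \<in> \<S> \<Longrightarrow> u < x \<Longrightarrow> x < v \<Longrightarrow>
    u' < y \<Longrightarrow> y < v' \<Longrightarrow> \<sigma> x = \<tau> y \<Longrightarrow> \<sigma> = \<tau> \<and> u = u' \<and> v = v'"
  unfolding indep_def by blast

lemma indep_sub: "indep \<S> \<Longrightarrow> \<S>' \<subseteq> \<S> \<Longrightarrow> indep \<S>'"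
  unfolding indep_def by blast

lemma perm_group_stabil: "perm_group (stabil \<S>)"
  unfolding perm_group_def stabil_def by (auto simp: iv_fix split: prod.splits)

lemma stabil_sub: "\<S>' \<subseteq> \<S> \<Longrightarrow> h \<in> stabil \<S> \<Longrightarrow> h \<in> stabil \<S>'"
  unfolding stabil_def by blast

lemma stabil_PLc:
  assumes "h \<in> PLc A" "\<And>\<sigma> u v. (\<sigma>,u,v) \<in> \<S> \<Longrightarrow> u \<notin> A \<and> v \<notin> A" shows "h \<in> stabil \<S>"
  using assms PLc_Homeo PLc_fix unfolding stabil_def by blast

lemma stabil_in:
  assumes "h \<in> stabil \<S>" "(\<sigma>,u,v) \<in> \<S>" "u < y" "y < v" shows "u < h y" "h y < v"
proof -
  have "h \<in> Homeo" "h u = u" "h v = v" using assms by (auto simp: stabil_def)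
  then show "u < h y" "h y < v" using Homeo_less[of h u y] Homeo_less[of h y v] assms by auto
qed

lemma region_iff: "x \<in> region \<S> \<longleftrightarrow> (\<exists>\<sigma> u v y. (\<sigma>,u,v) \<in> \<S> \<and> u < y \<and> y < v \<and> x = \<sigma> y)"
  unfolding region_def by blast

lemma spread_out: "x \<notin> region \<S> \<Longrightarrow> spread \<S> h x = x"
  by (simp add: spread_def)

text \<open>Independence leaves a single triple and a single preimage, so the choice operator has no
  freedom.\<close>

lemma spread_in:
  assumes "indep \<S>" "(\<sigma>,u,v) \<in> \<S>" "u < y" "y < v"
  shows "spread \<S> h (\<sigma> y) = \<sigma> (h y)"
proof -
  have r: "\<sigma> y \<in> region \<S>" using assms region_iff by blast
  let ?P = "\<lambda>z. \<exists>\<tau> u v y'. (\<tau>,u,v) \<in> \<S> \<and> u < y' \<and> y' < v \<and> \<sigma> y = \<tau> y' \<and> z = \<tau> (h y')"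
  have P: "?P (\<sigma> (h y))" using assms by blast
  have "z = \<sigma> (h y)" if z: "?P z" for z
  proof -
    obtain \<tau> u' v' y' where t: "(\<tau>,u',v') \<in> \<S>" "u' < y'" "y' < v'" "\<sigma> y = \<tau> y'" "z = \<tau> (h y')"
      using z by blast
    then have "\<sigma> = \<tau>" using indep_eq[OF assms(1,2) t(1) assms(3,4) t(2,3,4)] by blast
    then show ?thesis using t isom_inj[OF indep_iso[OF assms(1,2)]] by metis
  qed
  then have "(SOME z. ?P z) = \<sigma> (h y)" using P by (rule some_equality[rotated])
  then show ?thesis using r by (simp add: spread_def)
qed

lemma spread_cases:
  assumes "indep \<S>"
  obtains "x \<notin> region \<S>" | \<sigma> u v y where "(\<sigma>,u,v) \<in> \<S>" "u < y" "y < v" "x = \<sigma> y"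
  using region_iff by blast

lemma spread_sub_in:
  assumes "indep \<T>" "\<S> \<subseteq> \<T>" "(\<sigma>,u,v) \<in> \<T>" "u < y" "y < v"
  shows "spread \<S> h (\<sigma> y) = \<sigma> (if (\<sigma>,u,v) \<in> \<S> then h y else y)"
proof (cases "(\<sigma>,u,v) \<in> \<S>")
  case True
  then show ?thesis using spread_in[OF indep_sub[OF assms(1,2)] True assms(4,5)] by simp
next
  case False
  have "\<sigma> y \<notin> region \<S>"
  proof
    assume "\<sigma> y \<in> region \<S>"
    then obtain \<tau> u' v' y' where t: "(\<tau>,u',v') \<in> \<S>" "u' < y'" "y' < v'" "\<sigma> y = \<tau> y'"
      unfolding region_iff by blast
    then have "\<sigma> = \<tau> \<and> u = u' \<and> v = v'"
      using indep_eq[OF assms(1,3) subsetD[OF assms(2) t(1)] assms(4,5) t(2,3,4)] by blast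
    then show False using t(1) False by simp
  qed
  then show ?thesis using False by (simp add: spread_out)
qed

lemma region_mono: "\<S> \<subseteq> \<T> \<Longrightarrow> x \<in> region \<S> \<Longrightarrow> x \<in> region \<T>"
  unfolding region_def by blast

text \<open>The test family \<open>\<T>\<close> may be larger than \<open>\<S>\<close>: on copies in
  \<open>\<T>\<close> but not in \<open>\<S>\<close> the map must be the identity. Spreads over
  different families can thus be compared copy by copy.\<close>

lemma spread_eqI:
  assumes "indep \<T>" "\<S> \<subseteq> \<T>" "\<And>x. x \<notin> region \<T> \<Longrightarrow> f x = x"
    and "\<And>\<sigma> u v y. (\<sigma>,u,v) \<in> \<T> \<Longrightarrow> u < y \<Longrightarrow> y < v \<Longrightarrow>
      f (\<sigma> y) = \<sigma> (if (\<sigma>,u,v) \<in> \<S> then h y else y)"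
  shows "f = spread \<S> h"
proof
  fix x
  show "f x = spread \<S> h x"
  proof (cases rule: spread_cases[OF assms(1), of x])
    case 1
    then have "x \<notin> region \<S>" using region_mono[OF assms(2)] by blast
    then show ?thesis using 1 assms(3) spread_out by metis
  next
    case (2 \<sigma> u v y)
    then show ?thesis using assms(4)[OF 2(1-3)] spread_sub_in[OF assms(1,2) 2(1-3)] by simp
  qed
qed

lemma spread_id: assumes "indep \<S>" shows "spread \<S> id = id"
  by (rule spread_eqI[OF assms subset_refl, symmetric]) auto

lemma spread_comp:
  assumes "indep \<S>" "g \<in> stabil \<S>" shows "spread \<S> (f \<circ> g) = spread \<S> f \<circ> spread \<S> g"
proof (rule spread_eqI[OF assms(1) subset_refl, symmetric])
  fix x assume "x \<notin> region \<S>" then show "(spread \<S> f \<circ> spread \<S> g) x = x" by (simp add: spread_out)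
next
  fix \<sigma> u v y assume a: "(\<sigma>,u,v) \<in> \<S>" "u < y" "y < v"
  then show "(spread \<S> f \<circ> spread \<S> g) (\<sigma> y) = \<sigma> (if (\<sigma>,u,v) \<in> \<S> then (f \<circ> g) y else y)"
    using spread_in[OF assms(1) a] spread_in[OF assms(1) a(1) stabil_in[OF assms(2) a]] by simp
qed

lemma spread_bij:
  assumes "indep \<S>" "h \<in> stabil \<S>" shows "bij (spread \<S> h)" "iv (spread \<S> h) = spread \<S> (iv h)"
proof -
  have i: "iv h \<in> stabil \<S>" "h \<in> Homeo" using assms(2) perm_group_stabil gpD by blast+
  have "h \<circ> iv h = id" "iv h \<circ> h = id" using i(2) by (auto simp: fun_eq_iff f_iv)
  then have 1: "spread \<S> h \<circ> spread \<S> (iv h) = id" "spread \<S> (iv h) \<circ> spread \<S> h = id"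
    using spread_comp[OF assms(1) i(1), of h] spread_comp[OF assms, of "iv h"] spread_id[OF assms(1)] by simp_all
  then show "bij (spread \<S> h)" by (rule o_bij[rotated])
  show "iv (spread \<S> h) = spread \<S> (iv h)" using 1 by (rule inv_unique_comp)
qed

lemma spread_commt:
  assumes "indep \<S>" "a \<in> stabil \<S>"
    "b \<in> stabil \<S>" shows "spread \<S> (commt a b) = commt (spread \<S> a) (spread \<S> b)"
proof -
  have i: "iv a \<in> stabil \<S>" "iv b \<in> stabil \<S>" using assms perm_group_stabil gpD by blast+
  show ?thesis
    unfolding commt_def by (simp only: spread_comp[OF assms(1)] i assms spread_bij[OF assms(1)])
qed

text \<open>Conjugation by a spread over the larger family acts inside each copy and leaves the
  smaller family unchanged. Supports can therefore be moved without changing where a rule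
  applies.\<close>

lemma spread_conj_sub:
  assumes "indep \<S>" "\<S>' \<subseteq> \<S>" "s \<in> stabil \<S>" "h \<in> stabil \<S>"
  shows "spread \<S> s \<circ> spread \<S>' h \<circ> iv (spread \<S> s) = spread \<S>' (s \<circ> h \<circ> iv s)"
proof (rule spread_eqI[OF assms(1,2)])
  have i: "iv s \<in> stabil \<S>" "s \<in> Homeo" using assms(3) perm_group_stabil gpD by blast+
  note b = spread_bij(2)[OF assms(1,3)]
  {
    fix x assume "x \<notin> region \<S>"
    moreover then have "x \<notin> region \<S>'" using region_mono[OF assms(2)] by blast
    ultimately show "(spread \<S> s \<circ> spread \<S>' h \<circ> iv (spread \<S> s)) x = x" unfolding b
      by (simp add: spread_out)
  next
    fix \<sigma> u v y assume a: "(\<sigma>,u,v) \<in> \<S>" "u < y" "y < v"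
    note y1 = stabil_in[OF i(1) a]
    note y2 = stabil_in[OF assms(4) a(1) y1]
    show "(spread \<S> s \<circ> spread \<S>' h \<circ> iv (spread \<S> s)) (\<sigma> y) =
        \<sigma> (if (\<sigma>,u,v) \<in> \<S>' then (s \<circ> h \<circ> iv s) y else y)"
      unfolding b
      using spread_in[OF assms(1) a] spread_sub_in[OF assms(1,2) a(1) y1] spread_in[OF assms(1) a(1) y1, of s]
        spread_in[OF assms(1) a(1) y2, of s] i(2)
      by (simp add: f_iv)
  }
qed

text \<open>On a copy that belongs to only one of the two families, one entry is the identity and
  the commutator vanishes.\<close>

lemma spread_commt_sub:
  assumes "indep \<T>" "\<S>1 \<subseteq> \<T>" "\<S>2 \<subseteq> \<T>" "a \<in> stabil \<T>" "b \<in> stabil \<T>"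
  shows "commt (spread \<S>1 a) (spread \<S>2 b) = spread (\<S>1 \<inter> \<S>2) (commt a b)"
proof (rule spread_eqI[OF assms(1)])
  have i: "iv a \<in> stabil \<T>" "iv b \<in> stabil \<T>" "a \<in> Homeo" "b \<in> Homeo"
    using assms(4,5) perm_group_stabil gpD by blast+
  have b: "iv (spread \<S>1 a) = spread \<S>1 (iv a)" "iv (spread \<S>2 b) = spread \<S>2 (iv b)"
    by (rule spread_bij(2)[OF indep_sub[OF assms(1,2)] stabil_sub[OF assms(2,4)]],
        rule spread_bij(2)[OF indep_sub[OF assms(1,3)] stabil_sub[OF assms(3,5)]])
  show "\<S>1 \<inter> \<S>2 \<subseteq> \<T>" using assms(2) by blast
  {
    fix x assume "x \<notin> region \<T>"
    then have "x \<notin> region \<S>1" "x \<notin> region \<S>2" using region_mono assms(2,3) by blast+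
    then show "commt (spread \<S>1 a) (spread \<S>2 b) x = x" unfolding commt_def b
      by (simp add: spread_out)
  next
    fix \<sigma> u v y assume m: "(\<sigma>,u,v) \<in> \<T>" "u < y" "y < v"
    have 1: "spread \<S>1 h (\<sigma> z) = \<sigma> (if (\<sigma>,u,v) \<in> \<S>1 then h z else z)" if "u < z" "z < v" for h z
      using spread_sub_in[OF assms(1,2) m(1) that] .
    have 2: "spread \<S>2 h (\<sigma> z) = \<sigma> (if (\<sigma>,u,v) \<in> \<S>2 then h z else z)" if "u < z" "z < v" for h z
      using spread_sub_in[OF assms(1,3) m(1) that] .
    have st: "u < a z" "a z < v" "u < b z" "b z < v" "u < iv a z" "iv a z < v" "u < iv b z"
      "iv b z < v"
      if "u < z" "z < v" for z
      using stabil_in[OF assms(4) m(1) that] stabil_in[OF assms(5) m(1) that]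
        stabil_in[OF i(1) m(1) that] stabil_in[OF i(2) m(1) that] by auto
    show "commt (spread \<S>1 a) (spread \<S>2 b) (\<sigma> y) =
        \<sigma> (if (\<sigma>,u,v) \<in> \<S>1 \<inter> \<S>2 then commt a b y else y)"
      unfolding commt_def b using m(2,3) i(3,4) by (simp add: 1 2 st f_iv)
  }
qed

section \<open>All copies of one interval\<close>

definition copies :: "((real \<Rightarrow> real) \<Rightarrow> bool) \<Rightarrow> real \<Rightarrow> real \<Rightarrow> ((real \<Rightarrow> real) \<times> real \<times> real) set" where
  "copies P u v = {(\<sigma>,u,v) | \<sigma>. isom \<sigma> \<and> P \<sigma>}"

lemma copies_iff: "(\<sigma>,u',v') \<in> copies P u v \<longleftrightarrow> isom \<sigma> \<and> P \<sigma> \<and> u' = u \<and> v' = v"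
  unfolding copies_def by auto

lemma indep_copies_shrink: "indep (copies P u v) \<Longrightarrow> u \<le> u' \<Longrightarrow> v' \<le> v \<Longrightarrow> indep (copies P u' v')"
  unfolding indep_def copies_iff
  by (auto simp: copies_def) (metis dual_order.strict_trans1 dual_order.strict_trans2)+

lemma spread_shrink:
  assumes "indep (copies P u v)" "u \<le> u'" "v' \<le> v" "\<And>y. y \<notin> {u'<..<v'} \<Longrightarrow> h y = y"
  shows "spread (copies P u' v') h = spread (copies P u v) h"
proof (rule spread_eqI[OF assms(1) subset_refl])
  note w = indep_copies_shrink[OF assms(1-3)]
  {
    fix x assume "x \<notin> region (copies P u v)"
    then have "x \<notin> region (copies P u' v')"
      using assms(2,3) unfolding region_iff copies_iff by (metis le_less_trans less_le_trans)
    then show "spread (copies P u' v') h x = x" by (rule spread_out)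
  next
    fix \<sigma> p q y assume m: "(\<sigma>,p,q) \<in> copies P u v" "p < y" "y < q"
    then have s: "isom \<sigma>" "P \<sigma>" "p = u" "q = v" by (auto simp: copies_iff)
    show "spread (copies P u' v') h (\<sigma> y) = \<sigma> (if (\<sigma>,p,q) \<in> copies P u v then h y else y)"
    proof (cases "u' < y \<and> y < v'")
      case True
      then show ?thesis using spread_in[OF w, of \<sigma> u' v' y h] s m(1) by (simp add: copies_iff)
    next
      case False
      have "\<sigma> y \<notin> region (copies P u' v')"
      proof
        assume "\<sigma> y \<in> region (copies P u' v')"
        then obtain \<tau> z where t: "isom \<tau>" "P \<tau>" "u' < z" "z < v'" "\<sigma> y = \<tau> z"
          unfolding region_iff copies_iff by blast
        then have "\<sigma> = \<tau>"
          using indep_eq[OF assms(1), of \<sigma> u v \<tau> u v y z] s m assms(2,3) by (auto simp: copies_iff)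
        then show False using t False isom_inj[OF s(1)] by metis
      qed
      then show ?thesis using False assms(4)[of y] m(1) by (simp add: spread_out)
    qed
  }
qed

section \<open>The generators of the group of a labelling\<close>

text \<open>
  Whether a letter is an \<open>a\<close> or a \<open>b\<close> is determined by its position,
  and isometries \<open>x \<mapsto> \<plusminus>x + d\<close> with integral \<open>d\<close>
  preserve the type of the position. Hence occurrences of a block, in either direction, are
  matches of signs.
\<close>

definition letter_sign :: "(real \<Rightarrow> letter) \<Rightarrow> real \<Rightarrow> real" where
  "letter_sign \<rho> k = (if \<rho> k \<in> {La, Lb} then 1 else -1)"

text \<open>The inverse word has reversed order and inverted letters. A reflection reverses the
  order, so signs must change with it; the factor \<open>slope \<sigma>\<close> expresses
  this.\<close>

definition matches :: "(real \<Rightarrow> letter) \<Rightarrow> real set \<Rightarrow> (real \<Rightarrow> real) \<Rightarrow> bool" where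
  "matches \<rho> X \<sigma> \<longleftrightarrow> (\<forall>k\<in>X \<inter> half_ints. letter_sign \<rho> (\<sigma> k) = slope \<sigma> * letter_sign \<rho> k)"

definition equivariant :: "(real \<Rightarrow> letter) \<Rightarrow> real \<Rightarrow> (real \<Rightarrow> real) \<Rightarrow> bool" where
  "equivariant \<rho> M f \<longleftrightarrow> (\<forall>\<sigma> x. isom \<sigma> \<longrightarrow> matches \<rho> {x-M..x+M} \<sigma> \<longrightarrow> f (\<sigma> x) = \<sigma> (f x))"

text \<open>By \<open>gen_class\<close> only the class of \<open>k\<close> modulo the integers
  matters. Treating the two families of generators as one turns each pair of statements into a
  single one.\<close>

definition gen :: "(real \<Rightarrow> letter) \<Rightarrow> real \<Rightarrow> (real \<Rightarrow> real) \<Rightarrow> real \<Rightarrow> real" where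
  "gen \<rho> k \<nu> = (if k \<in> \<int> then chi \<rho> \<nu> else zeta \<rho> \<nu>)"

lemma letter_sign_cases: "letter_sign \<rho> k = 1 \<or> letter_sign \<rho> k = -1"
  by (simp add: letter_sign_def)

lemma letter_sign_sq [simp]: "letter_sign \<rho> k * letter_sign \<rho> k = 1"
  "letter_sign \<rho> k * (letter_sign \<rho> k * x) = x"
  using letter_sign_cases[of \<rho> k] by auto

lemma letter_sign_nz [simp]: "letter_sign \<rho> k \<noteq> 0" "letter_sign \<rho> k \<noteq> - letter_sign \<rho> k"
  using letter_sign_cases[of \<rho> k] by auto

lemma letter_sign_abs [simp]: "\<bar>letter_sign \<rho> k * x\<bar> = \<bar>x\<bar>"
  using letter_sign_cases[of \<rho> k] by auto

lemma letter_sign_bound: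
  assumes "\<bar>a\<bar> \<le> r" shows "letter_sign \<rho> k * a \<le> r" "- r \<le> letter_sign \<rho> k * a"
  using assms letter_sign_cases[of \<rho> k] by (auto simp: abs_le_iff)

lemma matches_mono: "matches \<rho> X \<sigma> \<Longrightarrow> Y \<subseteq> X \<Longrightarrow> matches \<rho> Y \<sigma>"
  unfolding matches_def by blast

lemma matches_Un: "matches \<rho> (X \<union> Y) \<sigma> \<longleftrightarrow> matches \<rho> X \<sigma> \<and> matches \<rho> Y \<sigma>"
  unfolding matches_def by blast

lemma matches_id: "matches \<rho> X id"
  unfolding matches_def by simp

lemma matches_comp:
  assumes "isom \<tau>" "isom \<sigma>" "matches \<rho> X \<tau>" "matches \<rho> (\<tau> ` X) \<sigma>" shows "matches \<rho> X (\<sigma> \<circ> \<tau>)"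
  unfolding matches_def
proof
  fix k assume k: "k \<in> X \<inter> half_ints"
  then have "\<tau> k \<in> \<tau> ` X \<inter> half_ints" using isom_half[OF assms(1)] by blast
  then have "letter_sign \<rho> (\<sigma> (\<tau> k)) = slope \<sigma> * letter_sign \<rho> (\<tau> k)" using assms(4)
    by (simp add: matches_def)
  also have "letter_sign \<rho> (\<tau> k) = slope \<tau> * letter_sign \<rho> k" using assms(3) k
    by (simp add: matches_def)
  finally show "letter_sign \<rho> ((\<sigma> \<circ> \<tau>) k) = slope (\<sigma> \<circ> \<tau>) * letter_sign \<rho> k"
    using isom_comp(2)[OF assms(2,1)] by simp
qed

lemma matches_iv:
  assumes "isom \<sigma>" "matches \<rho> X \<sigma>" shows "matches \<rho> (\<sigma> ` X) (iv \<sigma>)"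
  unfolding matches_def
proof
  fix k assume "k \<in> \<sigma> ` X \<inter> half_ints"
  then obtain j where j: "j \<in> X" "k = \<sigma> j" "j \<in> half_ints" using isom_half[OF assms(1)] by blast
  then have "letter_sign \<rho> k = slope \<sigma> * letter_sign \<rho> j" using assms(2) by (simp add: matches_def)
  then show "letter_sign \<rho> (iv \<sigma> k) = slope (iv \<sigma>) * letter_sign \<rho> k"
    using j(2) isom_iv_f[OF assms(1)] isom_iv(2)[OF assms(1)] slope_cases[OF assms(1)] by auto
qed

text \<open>The images of \<open>k\<close> differ by an integer, so they agree once they are closer
  than 1; the sign at this common position then forces equal slopes.\<close>

lemma match_coincide:
  assumes "isom \<sigma>" "isom \<tau>" "k \<in> half_ints" "matches \<rho> {k} \<sigma>" "matches \<rho> {k} \<tau>" "\<bar>\<sigma> k - \<tau> k\<bar> < 1"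
  shows "\<sigma> = \<tau>"
proof -
  have "(\<sigma> k - k) - (\<tau> k - k) \<in> \<int>"
    by (rule Ints_diff[OF isom_shift_Ints[OF assms(1,3)] isom_shift_Ints[OF assms(2,3)]])
  then have "\<sigma> k - \<tau> k \<in> \<int>" by simp
  then have eq: "\<sigma> k = \<tau> k" using assms(6) Ints_nonzero_abs_less1 by fastforce
  then have "slope \<sigma> * letter_sign \<rho> k = slope \<tau> * letter_sign \<rho> k" using assms(3,4,5)
    by (simp add: matches_def)
  then show ?thesis using isom_eqI[OF assms(1,2) eq] by simp
qed

lemma indep_letter:
  assumes "k \<in> half_ints" "k \<in> X" shows "indep (copies (matches \<rho> X) (k - 1/2) (k + 1/2))"
  unfolding indep_def
proof (intro conjI allI impI)
  show "\<forall>(\<sigma>,u,v)\<in>copies (matches \<rho> X) (k - 1/2) (k + 1/2). isom \<sigma>" by (auto simp: copies_def)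
  fix \<sigma> u v \<tau> u' v' x y
  assume a: "(\<sigma>,u,v) \<in> copies (matches \<rho> X) (k - 1/2) (k + 1/2)"
    "(\<tau>,u',v') \<in> copies (matches \<rho> X) (k - 1/2) (k + 1/2)"
    "u < x" "x < v" "u' < y" "y < v'" "\<sigma> x = \<tau> y"
  then have i: "isom \<sigma>" "isom \<tau>" "matches \<rho> {k} \<sigma>" "matches \<rho> {k} \<tau>"
    using assms matches_mono[of \<rho> X _ "{k}"] by (auto simp: copies_iff)
  have "k - 1/2 < x" "x < k + 1/2" "k - 1/2 < y" "y < k + 1/2" using a by (auto simp: copies_iff)
  then have "\<bar>\<sigma> k - \<sigma> x\<bar> < 1/2" "\<bar>\<tau> k - \<tau> y\<bar> < 1/2"
    unfolding isom_dist[OF i(1)] isom_dist[OF i(2)] by linarith+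
  then have "\<bar>\<sigma> k - \<tau> k\<bar> < 1" using a(7) by linarith
  then show "\<sigma> = \<tau>" using match_coincide[OF i(1,2) assms(1) i(3,4)] by blast
  show "u = u'" "v = v'" using a by (auto simp: copies_iff)
qed

text \<open>An interval between consecutive half-integers is a fundamental domain for all integral
  isometries, whatever \<open>P\<close> is. Opposite slopes would make \<open>x + y\<close> an
  integer strictly between \<open>2 * j\<close> and \<open>2 * j + 1\<close>; equal slopes make two
  translations differ by less than 1.\<close>

lemma indep_gap:
  assumes "j \<in> half_ints" shows "indep (copies P j (j + 1/2))"
  unfolding indep_def
proof (intro conjI allI impI)
  show "\<forall>(\<sigma>,u,v)\<in>copies P j (j + 1/2). isom \<sigma>" by (auto simp: copies_def)
  fix \<sigma> u v \<tau> u' v' x y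
  assume a: "(\<sigma>,u,v) \<in> copies P j (j + 1/2)" "(\<tau>,u',v') \<in> copies P j (j + 1/2)"
    "u < x" "x < v" "u' < y" "y < v'" "\<sigma> x = \<tau> y"
  then have b: "isom \<sigma>" "isom \<tau>" "j < x" "x < j + 1/2" "j < y" "y < j + 1/2"
    by (auto simp: copies_iff)
  obtain d where d: "slope \<sigma> \<in> {1,-1}" "\<sigma> = (\<lambda>x. slope \<sigma> * x + of_int d)" using isoE[OF b(1)] .
  obtain d' where d': "slope \<tau> \<in> {1,-1}" "\<tau> = (\<lambda>x. slope \<tau> * x + of_int d')" using isoE[OF b(2)] .
  obtain m :: int where m: "2 * j = of_int m" using assms by (auto simp: half_ints_def Ints_def)
  have eq: "slope \<sigma> * x + of_int d = slope \<tau> * y + of_int d'" using a(7) d(2) d'(2) by metis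
  have "slope \<sigma> = slope \<tau>"
  proof (rule ccontr)
    assume "slope \<sigma> \<noteq> slope \<tau>"
    then have "x + y = of_int (d' - d) \<or> x + y = of_int (d - d')" using d(1) d'(1) eq by auto
    moreover have "of_int m < x + y" "x + y < of_int (m + 1)" using b m by auto
    ultimately have "m < d' - d \<and> d' - d < m + 1 \<or> m < d - d' \<and> d - d' < m + 1"
      by (metis of_int_less_iff)
    then show False by linarith
  qed
  moreover from this have "d = d'"
  proof -
    have "slope \<sigma> * (x - y) = of_int (d' - d)" using eq \<open>slope \<sigma> = slope \<tau>\<close>
      by (simp add: right_diff_distrib)
    then have "\<bar>of_int (d' - d)\<bar> < (1::real)" using b d(1) by (auto simp: abs_less_iff)
    then show ?thesis by linarith
  qed
  ultimately show "\<sigma> = \<tau>" using d(2) d'(2) by metis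
  show "u = u'" "v = v'" using a by (auto simp: copies_iff)
qed

section \<open>Lifts of maps of the unit interval\<close>

definition unit_homeos :: "(real \<Rightarrow> real) set" where
  "unit_homeos = {\<nu> \<in> Homeo. \<forall>x. x \<notin> {0..1} \<longrightarrow> \<nu> x = x}"

lemma unit_homeos_perm_group: "perm_group unit_homeos"
  unfolding perm_group_def unit_homeos_def by (auto simp: iv_fix)

lemma unit_homeosD:
  assumes "\<nu> \<in> unit_homeos"
  shows "\<nu> \<in> Homeo" "\<nu> 0 = 0" "\<nu> 1 = 1" "0 \<le> t \<Longrightarrow> 0 \<le> \<nu> t" "t \<le> 1 \<Longrightarrow> \<nu> t \<le> 1"
proof -
  show H: "\<nu> \<in> Homeo" using assms by (simp add: unit_homeos_def)
  have o: "\<nu> x = x" if "x < 0 \<or> x > 1" for x using that assms by (auto simp: unit_homeos_def)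
  have a: "\<not> \<nu> 0 < 0" "\<not> \<nu> 1 > 1"
    using o[of "\<nu> 0"] o[of "\<nu> 1"] Homeo_inj[OF H, of "\<nu> 0" 0] Homeo_inj[OF H, of "\<nu> 1" 1] by auto
  have b: "\<not> iv \<nu> 0 < 0" "\<not> iv \<nu> 1 > 1" using o[of "iv \<nu> 0"] o[of "iv \<nu> 1"] f_iv[OF H] by auto
  show 0: "\<nu> 0 = 0" using a(1) b(1) Homeo_less[OF H, of "iv \<nu> 0" 0] f_iv[OF H, of 0] by simp
  show 1: "\<nu> 1 = 1" using a(2) b(2) Homeo_less[OF H, of 1 "iv \<nu> 1"] f_iv[OF H, of 1] by simp
  show "0 \<le> t \<Longrightarrow> 0 \<le> \<nu> t" "t \<le> 1 \<Longrightarrow> \<nu> t \<le> 1"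
    using Homeo_le[OF H, of 0 t] Homeo_le[OF H, of t 1] 0 1 by auto
qed

lemma unit_homeos_PLc: "\<nu> \<in> PLc {0..1} \<Longrightarrow> \<nu> \<in> unit_homeos"
  using PLc_fix PLc_Homeo by (auto simp: unit_homeos_def)

lemma flip_eq:
  assumes "\<nu> \<in> unit_homeos" "0 \<le> t" "t \<le> 1" shows "flip \<nu> t = 1 - \<nu> (1 - t)"
  using unit_homeosD(4,5)[OF assms(1), of "1 - t"] assms by (simp add: flip_def iota0_def)

lemma gen_class: "j - k \<in> \<int> \<Longrightarrow> gen \<rho> j = gen \<rho> k"
  unfolding gen_def by (metis Ints_diff diff_add_cancel Ints_add minus_diff_eq Ints_minus)

lemma gen_center:
  assumes "labelling \<rho>" "k \<in> half_ints" "\<nu> \<in> unit_homeos" "\<bar>s\<bar> \<le> 1/2"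
  shows "gen \<rho> k \<nu> (k + letter_sign \<rho> k * s) = k + letter_sign \<rho> k * (\<nu> (s + 1/2) - 1/2)"
proof -
  have nu: "\<nu> 0 = 0" "\<nu> 1 = 1" using unit_homeosD[OF assms(3)] by auto
  have t: "s + 1/2 \<in> {0..1}" "1/2 - s \<in> {0..1}"
    using assms(4) unfolding atLeastAtMost_iff by linarith+
  have fl: "flip \<nu> (1/2 - s) = 1 - \<nu> (s + 1/2)"
    using flip_eq[OF assms(3), of "1/2 - s"] t by (simp add: algebra_simps)
  show ?thesis
  proof (cases "k \<in> \<int>")
    case True
    then obtain n where n: "k = of_int n" by (auto elim: Ints_cases)
    have "\<rho> k = La \<or> \<rho> k = La_inv" using assms(1) True by (auto simp: labelling_def)
    then show ?thesis
    proof
      assume r: "\<rho> k = La"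
      have "gen \<rho> k \<nu> (k + letter_sign \<rho> k * s) = chi \<rho> \<nu> (of_int n - 1/2 + (s + 1/2))"
        using True n r by (simp add: gen_def letter_sign_def)
      also have "\<dots> = k + letter_sign \<rho> k * (\<nu> (s + 1/2) - 1/2)"
        using chi_eq[OF nu t(1), of \<rho> n] r n by (simp add: letter_sign_def)
      finally show ?thesis .
    next
      assume r: "\<rho> k = La_inv"
      have "gen \<rho> k \<nu> (k + letter_sign \<rho> k * s) = chi \<rho> \<nu> (of_int n - 1/2 + (1/2 - s))"
        using True n r by (simp add: gen_def letter_sign_def)
      also have "\<dots> = k + letter_sign \<rho> k * (\<nu> (s + 1/2) - 1/2)"
        using chi_eq[OF nu t(2), of \<rho> n] r n fl by (simp add: letter_sign_def)
      finally show ?thesis .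
    qed
  next
    case False
    obtain m :: int where m: "k = of_int m / 2" using assms(2) by (auto simp: half_ints_iff)
    have "odd m"
    proof
      assume "even m"
      then obtain q where "m = 2 * q" by blast
      then show False using False m by simp
    qed
    then obtain n where "m = 2 * n + 1" by (rule oddE)
    then have n: "k = of_int n + 1/2" using m by (simp add: add_divide_distrib)
    have "\<rho> k = Lb \<or> \<rho> k = Lb_inv" using assms(1,2) False by (auto simp: labelling_def)
    then show ?thesis
    proof
      assume r: "\<rho> k = Lb"
      have "gen \<rho> k \<nu> (k + letter_sign \<rho> k * s) = zeta \<rho> \<nu> (of_int n + (s + 1/2))"
        using False n r by (simp add: gen_def letter_sign_def add.commute add.left_commute)
      also have "\<dots> = k + letter_sign \<rho> k * (\<nu> (s + 1/2) - 1/2)"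
        using zeta_eq[OF nu t(1), of \<rho> n] r n by (simp add: letter_sign_def)
      finally show ?thesis .
    next
      assume r: "\<rho> k = Lb_inv"
      have "gen \<rho> k \<nu> (k + letter_sign \<rho> k * s) = zeta \<rho> \<nu> (of_int n + (1/2 - s))"
        using False n r by (simp add: gen_def letter_sign_def algebra_simps)
      also have "\<dots> = k + letter_sign \<rho> k * (\<nu> (s + 1/2) - 1/2)"
        using zeta_eq[OF nu t(2), of \<rho> n] r n fl by (simp add: letter_sign_def)
      finally show ?thesis .
    qed
  qed
qed

text \<open>The cells of length 1 around the positions congruent to \<open>k\<close> tile the line,
  and \<open>s\<close> is the coordinate of \<open>x\<close> in its cell, oriented by the letter. A
  boundary point is given to the cell on its right.\<close>

lemma cell_cover:
  assumes "k \<in> half_ints"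
  obtains j s where "j \<in> half_ints" "j - k \<in> \<int>" "\<bar>s\<bar> \<le> 1/2" "x = j + letter_sign \<rho> j * s"
    "j = k + of_int \<lfloor>x - k + 1/2\<rfloor>"
proof -
  let ?j = "k + of_int \<lfloor>x - k + 1/2\<rfloor>"
  have "?j \<in> half_ints" using assms by (auto simp: half_ints_def distrib_left)
  moreover have "\<bar>x - ?j\<bar> \<le> 1/2" by linarith
  then have "\<bar>letter_sign \<rho> ?j * (x - ?j)\<bar> \<le> 1/2" unfolding letter_sign_abs .
  moreover have "x = ?j + letter_sign \<rho> ?j * (letter_sign \<rho> ?j * (x - ?j))" by simp
  ultimately show ?thesis using that[of ?j "letter_sign \<rho> ?j * (x - ?j)"] by auto
qed

locale labelled_gens = thompson_gens +
  fixes \<rho> :: "real \<Rightarrow> letter"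
  assumes lab: "labelling \<rho>" and qp: "quasi_periodic \<rho>"
begin

lemma gen_at:
  assumes "k \<in> half_ints" "\<nu> \<in> unit_homeos" "j \<in> half_ints" "j - k \<in> \<int>" "\<bar>s\<bar> \<le> 1/2"
  shows "gen \<rho> k \<nu> (j + letter_sign \<rho> j * s) = j + letter_sign \<rho> j * (\<nu> (s + 1/2) - 1/2)"
    "\<bar>\<nu> (s + 1/2) - 1/2\<bar> \<le> 1/2"
proof -
  show "gen \<rho> k \<nu> (j + letter_sign \<rho> j * s) = j + letter_sign \<rho> j * (\<nu> (s + 1/2) - 1/2)"
    using gen_center[OF lab assms(3,2,5)] gen_class[OF assms(4)] by simp
  have "0 \<le> s + 1/2" "s + 1/2 \<le> 1" using assms(5) by linarith+
  then have "0 \<le> \<nu> (s + 1/2)" "\<nu> (s + 1/2) \<le> 1" using unit_homeosD[OF assms(2)] by auto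
  then show "\<bar>\<nu> (s + 1/2) - 1/2\<bar> \<le> 1/2" by linarith
qed

lemma gen_comp:
  assumes "k \<in> half_ints" "\<nu> \<in> unit_homeos" "\<mu> \<in> unit_homeos"
  shows "gen \<rho> k (\<mu> \<circ> \<nu>) = gen \<rho> k \<mu> \<circ> gen \<rho> k \<nu>"
proof
  fix x
  obtain j s where j: "j \<in> half_ints" "j - k \<in> \<int>" "\<bar>s\<bar> \<le> 1/2" "x = j + letter_sign \<rho> j * s"
    using cell_cover[OF assms(1)] by metis
  have c: "\<mu> \<circ> \<nu> \<in> unit_homeos" using gpD(3)[OF unit_homeos_perm_group] assms by blast
  show "gen \<rho> k (\<mu> \<circ> \<nu>) x = (gen \<rho> k \<mu> \<circ> gen \<rho> k \<nu>) x"
    unfolding j(4) o_apply gen_at(1)[OF assms(1) c j(1-3)] gen_at(1)[OF assms(1,2) j(1-3)]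
      gen_at(1)[OF assms(1,3) j(1,2) gen_at(2)[OF assms(1,2) j(1-3)]] by simp
qed

lemma gen_id: assumes "k \<in> half_ints" shows "gen \<rho> k id = id"
proof
  fix x
  obtain j s where j: "j \<in> half_ints" "j - k \<in> \<int>" "\<bar>s\<bar> \<le> 1/2" "x = j + letter_sign \<rho> j * s"
    using cell_cover[OF assms] by metis
  show "gen \<rho> k id x = id x"
    unfolding j(4) gen_at(1)[OF assms gpD(2)[OF unit_homeos_perm_group] j(1-3)] by simp
qed

lemma gen_bij:
  assumes "k \<in> half_ints" "\<nu> \<in> unit_homeos"
  shows "bij (gen \<rho> k \<nu>)" "iv (gen \<rho> k \<nu>) = gen \<rho> k (iv \<nu>)"
proof -
  have i: "iv \<nu> \<in> unit_homeos" "\<nu> \<in> Homeo" using assms(2) gpD[OF unit_homeos_perm_group] by blast+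
  have "\<nu> \<circ> iv \<nu> = id" "iv \<nu> \<circ> \<nu> = id" using i(2) by (auto simp: fun_eq_iff f_iv)
  then have 1: "gen \<rho> k \<nu> \<circ> gen \<rho> k (iv \<nu>) = id" "gen \<rho> k (iv \<nu>) \<circ> gen \<rho> k \<nu> = id"
    using gen_comp[OF assms(1) i(1) assms(2)] gen_comp[OF assms i(1)] gen_id[OF assms(1)]
    by simp_all
  then show "bij (gen \<rho> k \<nu>)" by (rule o_bij[rotated])
  show "iv (gen \<rho> k \<nu>) = gen \<rho> k (iv \<nu>)" using 1 by (rule inv_unique_comp)
qed

lemma gen_Homeo:
  assumes "k \<in> half_ints" "\<nu> \<in> unit_homeos" shows "gen \<rho> k \<nu> \<in> Homeo"
proof -
  let ?f = "gen \<rho> k \<nu>"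
  have b: "bij ?f" by (rule gen_bij[OF assms])
  have "strict_mono ?f"
    unfolding strict_mono_def
  proof (intro allI impI)
    fix x y :: real assume xy: "x < y"
    obtain j s where j: "j \<in> half_ints" "j - k \<in> \<int>" "\<bar>s\<bar> \<le> 1/2" "x = j + letter_sign \<rho> j * s"
      "j = k + of_int \<lfloor>x - k + 1/2\<rfloor>" using cell_cover[OF assms(1)] by metis
    obtain j' s'
      where j': "j' \<in> half_ints" "j' - k \<in> \<int>" "\<bar>s'\<bar> \<le> 1/2" "y = j' + letter_sign \<rho> j' * s'"
      "j' = k + of_int \<lfloor>y - k + 1/2\<rfloor>" using cell_cover[OF assms(1)] by metis
    note v = gen_at[OF assms j(1-3)] gen_at[OF assms j'(1-3)]
    have fl: "\<lfloor>x - k + 1/2\<rfloor> \<le> \<lfloor>y - k + 1/2\<rfloor>" using xy by (intro floor_mono) simp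
    show "?f x < ?f y"
    proof (cases "j = j'")
      case True
      have H: "\<nu> \<in> Homeo" using unit_homeosD[OF assms(2)] by blast
      show ?thesis
        using letter_sign_cases[of \<rho> j'] xy v Homeo_less[OF H, of "s + 1/2"
        "s' + 1/2"] Homeo_less[OF H, of "s' + 1/2" "s + 1/2"]
        unfolding j(4) j'(4) True by auto
    next
      case False
      then have "\<lfloor>x - k + 1/2\<rfloor> < \<lfloor>y - k + 1/2\<rfloor>" using fl j(5) j'(5) by fastforce
      then have "j + 1 \<le> j'" unfolding j(5) j'(5) by linarith
      moreover have "?f x \<le> j + 1/2" "j' - 1/2 \<le> ?f y"
        using letter_sign_bound(1)[OF v(2), of \<rho> j] letter_sign_bound(2)[OF v(4), of \<rho> j']
        unfolding j(4) j'(4) v(1,3) by simp_all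
      moreover have "?f x \<noteq> ?f y" using b xy by (metis bij_is_inj injD order_less_irrefl)
      ultimately show ?thesis by linarith
    qed
  qed
  then show ?thesis using b by (simp add: Homeo_def bij_is_surj)
qed

lemma gen_equivariant:
  assumes "k \<in> half_ints" "\<nu> \<in> unit_homeos" shows "equivariant \<rho> 1 (gen \<rho> k \<nu>)"
  unfolding equivariant_def
proof (intro allI impI)
  fix \<sigma> x assume s: "isom \<sigma>" "matches \<rho> {x - 1..x + 1} \<sigma>"
  obtain j s where j: "j \<in> half_ints" "j - k \<in> \<int>" "\<bar>s\<bar> \<le> 1/2" "x = j + letter_sign \<rho> j * s"
    using cell_cover[OF assms(1)] by metis
  have "\<bar>x - j\<bar> \<le> 1/2" using j letter_sign_cases[of \<rho> j] by auto
  then have "j \<in> {x - 1..x + 1}" unfolding atLeastAtMost_iff by linarith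
  then have e: "letter_sign \<rho> (\<sigma> j) = slope \<sigma> * letter_sign \<rho> j" using s(2) j(1)
    by (auto simp: matches_def)
  have j': "\<sigma> j \<in> half_ints" using isom_half[OF s(1)] j(1) by simp
  have "\<sigma> j - j + (j - k) \<in> \<int>" by (rule Ints_add[OF isom_shift_Ints[OF s(1) j(1)] j(2)])
  then have j'': "\<sigma> j - k \<in> \<int>" by simp
  have ex: "\<sigma> (j + letter_sign \<rho> j * z) = \<sigma> j + letter_sign \<rho> (\<sigma> j) * z" for z
    using isom_diff[OF s(1), of "j + letter_sign \<rho> j * z" j] e by simp
  show "gen \<rho> k \<nu> (\<sigma> x) = \<sigma> (gen \<rho> k \<nu> x)"
    unfolding j(4) ex gen_at(1)[OF assms j(1-3)] gen_at(1)[OF assms j' j'' j(3)] by simp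
qed

lemma gen_disp:
  assumes "k \<in> half_ints" "\<nu> \<in> unit_homeos" shows "\<bar>gen \<rho> k \<nu> x - x\<bar> \<le> 1"
proof -
  obtain j s where j: "j \<in> half_ints" "j - k \<in> \<int>" "\<bar>s\<bar> \<le> 1/2" "x = j + letter_sign \<rho> j * s"
    using cell_cover[OF assms(1)] by metis
  show ?thesis
    using letter_sign_bound[OF gen_at(2)[OF assms j(1-3)], of \<rho> j] letter_sign_bound[OF j(3), of \<rho> j]
    unfolding j(4) gen_at(1)[OF assms j(1-3)] by (simp add: abs_le_iff)
qed

text \<open>Affine chart from the unit interval onto the cell of \<open>j\<close>, oriented by its
  letter. The factor \<open>2 powi 0\<close> gives it the shape required by
  \<open>affI\<close>.\<close>

definition chart :: "real \<Rightarrow> real \<Rightarrow> real" where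
  "chart j = (\<lambda>t. letter_sign \<rho> j * 2 powi 0 * t + (j - letter_sign \<rho> j / 2))"

lemma half_ints_dyadic: "j \<in> half_ints \<Longrightarrow> j \<in> dyadic"
  using dyadic_half[OF dyadic_of_int] unfolding half_ints_iff by blast

lemma chart_aff: assumes "j \<in> half_ints" shows "aff (chart j)"
  unfolding chart_def
  by (rule affI) (use letter_sign_cases[of \<rho> j] half_ints_dyadic[OF assms] dyadic_of_int[of "-1"] in auto)

lemma chart_eq: "chart j (s + 1/2) = j + letter_sign \<rho> j * s"
  by (simp add: chart_def algebra_simps)

lemma gen_chart:
  assumes "k \<in> half_ints" "\<nu> \<in> unit_homeos" "j \<in> half_ints" "j - k \<in> \<int>" "\<bar>y - j\<bar> \<le> 1/2"
  shows "gen \<rho> k \<nu> y = (chart j \<circ> \<nu> \<circ> iv (chart j)) y"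
proof -
  define s where "s = letter_sign \<rho> j * (y - j)"
  have s: "\<bar>s\<bar> \<le> 1/2" "y = j + letter_sign \<rho> j * s"
    using assms(5) unfolding s_def letter_sign_abs by simp_all
  have "iv (chart j) y = s + 1/2" using aff_iv_f[OF chart_aff[OF assms(3)], of "s + 1/2"] s(2)
    by (simp add: chart_eq)
  then have "(chart j \<circ> \<nu> \<circ> iv (chart j)) y = chart j (\<nu> (s + 1/2) - 1/2 + 1/2)" by simp
  also have "\<dots> = j + letter_sign \<rho> j * (\<nu> (s + 1/2) - 1/2)" by (rule chart_eq)
  finally show ?thesis using gen_at(1)[OF assms(1-4) s(1)] s(2) by simp
qed

lemma gen_fix_boundary:
  assumes "k \<in> half_ints" "\<nu> \<in> unit_homeos" "x - k - 1/2 \<in> \<int>" shows "gen \<rho> k \<nu> x = x"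
proof -
  let ?j = "x - 1/2"
  have jk: "?j - k \<in> \<int>" using assms(3) by (simp add: algebra_simps)
  have "2 * ?j = 2 * (?j - k) + 2 * k" by simp
  also have "\<dots> \<in> \<int>"
    using assms(1) by (intro Ints_add Ints_mult[OF Ints_numeral jk]) (simp add: half_ints_def)
  finally have j: "?j \<in> half_ints" by (simp add: half_ints_def)
  have s: "\<bar>letter_sign \<rho> ?j / 2\<bar> \<le> 1/2" using letter_sign_cases[of \<rho> ?j] by auto
  have x: "x = ?j + letter_sign \<rho> ?j * (letter_sign \<rho> ?j / 2)" by simp
  have "gen \<rho> k \<nu> x = ?j + letter_sign \<rho> ?j * (\<nu> (letter_sign \<rho> ?j / 2 + 1/2) - 1/2)"
    using gen_at(1)[OF assms(1,2) j jk s] x by simp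
  also have "\<dots> = x" using letter_sign_cases[of \<rho> ?j] unit_homeosD[OF assms(2)] by auto
  finally show ?thesis .
qed

lemma gen_pl2:
  assumes "k \<in> half_ints" "\<nu> \<in> PLc {0..1}" shows "pl2 (gen \<rho> k \<nu>)"
  unfolding pl2_def
proof (intro allI)
  fix x
  have nu: "\<nu> \<in> unit_homeos" by (rule unit_homeos_PLc[OF assms(2)])
  have near: "\<forall>\<^sub>F z in nhds x. \<bar>z - y\<bar> < r" if "\<bar>x - y\<bar> < r" for y r :: real
  proof -
    have "x \<in> {y - r<..<y + r}" using that by (auto simp: abs_less_iff)
    then have "\<forall>\<^sub>F z in nhds x. z \<in> {y - r<..<y + r}" by (intro eventually_nhds_in_open) auto
    then show ?thesis by eventually_elim (auto simp: abs_less_iff)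
  qed
  have cell: "germ (gen \<rho> k \<nu>) x U"
    if j: "j \<in> half_ints" "j - k \<in> \<int>" and U: "U = {x..} \<or> U = {..x} \<or> U = UNIV \<and> x \<notin> dyadic"
      and ev: "\<forall>\<^sub>F y in nhds x. y \<in> U \<longrightarrow> \<bar>y - j\<bar> \<le> 1/2" for j U
  proof (rule germ_cong)
    have "pl2 (chart j \<circ> \<nu> \<circ> iv (chart j))"
      by (rule pl2_conj) (use assms(2) chart_aff[OF j(1)] in \<open>auto simp: PLc_def\<close>)
    then show "germ (chart j \<circ> \<nu> \<circ> iv (chart j)) x U" using U unfolding pl2_def by blast
    show "\<forall>\<^sub>F y in nhds x. y \<in> U \<longrightarrow> (chart j \<circ> \<nu> \<circ> iv (chart j)) y = gen \<rho> k \<nu> y"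
      using ev by eventually_elim (use gen_chart[OF assms(1) nu j] in auto)
  qed
  have hj: "k + of_int n \<in> half_ints" "k + of_int n - k \<in> \<int>" for n
    using assms(1) by (auto simp: half_ints_def distrib_left)
  define n where "n = \<lfloor>x - k + 1/2\<rfloor>"
  have n: "k + of_int n - 1/2 \<le> x" "x < k + of_int n + 1/2" unfolding n_def by linarith+
  have right: "germ (gen \<rho> k \<nu>) x {x..}"
  proof (rule cell[OF hj])
    have "\<forall>\<^sub>F z in nhds x. \<bar>z - x\<bar> < k + of_int n + 1/2 - x" by (rule near) (use n in auto)
    then show "\<forall>\<^sub>F y in nhds x. y \<in> {x..} \<longrightarrow> \<bar>y - (k + of_int n)\<bar> \<le> 1/2"
    proof eventually_elim
      case (elim y)
      then show ?case using n unfolding atLeast_iff by linarith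
    qed
  qed auto
  define m where "m = \<lceil>x - k - 1/2\<rceil>"
  have m: "k + of_int m - 1/2 < x" "x \<le> k + of_int m + 1/2" unfolding m_def by linarith+
  have left: "germ (gen \<rho> k \<nu>) x {..x}"
  proof (rule cell[OF hj])
    have "\<forall>\<^sub>F z in nhds x. \<bar>z - x\<bar> < x - (k + of_int m - 1/2)" by (rule near) (use m in auto)
    then show "\<forall>\<^sub>F y in nhds x. y \<in> {..x} \<longrightarrow> \<bar>y - (k + of_int m)\<bar> \<le> 1/2"
    proof eventually_elim
      case (elim y)
      then show ?case using m unfolding atMost_iff by linarith
    qed
  qed auto
  have "germ (gen \<rho> k \<nu>) x UNIV" if "x \<notin> dyadic"
  proof (rule cell[OF hj])
    have "k + of_int n - 1/2 \<in> dyadic"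
      using half_ints_dyadic[OF hj(1)[of n]] dyadic_half[OF dyadic_numeral(2)]
      by (intro dyadic_diff)
    then have "k + of_int n - 1/2 < x" using n(1) that by (cases "k + of_int n - 1/2 = x") auto
    then have "\<forall>\<^sub>F z in nhds x. \<bar>z - (k + of_int n)\<bar> < 1/2" using n(2) by (intro near) linarith
    then show "\<forall>\<^sub>F y in nhds x. y \<in> UNIV \<longrightarrow> \<bar>y - (k + of_int n)\<bar> \<le> 1/2"
      by eventually_elim auto
  qed (use that in auto)
  then show "germ (gen \<rho> k \<nu>) x {x..} \<and> germ (gen \<rho> k \<nu>) x {..x} \<and>
      (x \<notin> dyadic \<longrightarrow> germ (gen \<rho> k \<nu>) x UNIV)"
    using right left by blast
qed

text \<open>A lift fixes all boundaries of its cells and may be cut off there. Keeping three cells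
  puts \<open>x\<close> in the interior.\<close>

lemma gen_local_PLc:
  assumes "k \<in> half_ints" "\<nu> \<in> PLc {0..1}"
  shows "\<exists>h\<in>PLc UNIV. \<forall>\<^sub>F y in nhds x. h y = gen \<rho> k \<nu> y"
proof -
  let ?f = "gen \<rho> k \<nu>"
  have nu: "\<nu> \<in> unit_homeos" by (rule unit_homeos_PLc[OF assms(2)])
  define n where "n = \<lfloor>x - k + 1/2\<rfloor>"
  have n: "k + of_int n - 1/2 \<le> x" "x < k + of_int n + 1/2" unfolding n_def by linarith+
  let ?a = "k + of_int n - 3/2" and ?b = "k + of_int n + 3/2"
  have "k + of_int n \<in> dyadic" using half_ints_dyadic[OF assms(1)] by auto
  then have d: "?a \<in> dyadic" "?b \<in> dyadic" by auto
  have "?a - k - 1/2 = of_int (n - 2)" "?b - k - 1/2 = of_int (n + 1)" by auto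
  then have f: "?f ?a = ?a" "?f ?b = ?b" using gen_fix_boundary[OF assms(1) nu]
    by (metis Ints_of_int)+
  have "cut ?f ?a ?b \<in> PLc UNIV"
    by (rule cut_PLc[OF gen_Homeo[OF assms(1) nu] gen_pl2[OF assms] _ d f]) simp
  moreover have "\<forall>\<^sub>F y in nhds x. y \<in> {?a<..<?b}" using n by (intro eventually_nhds_in_open) auto
  then have "\<forall>\<^sub>F y in nhds x. cut ?f ?a ?b y = ?f y" by eventually_elim (auto simp: cut_def)
  ultimately show ?thesis by blast
qed

end

section \<open>Locally supported elements\<close>

context labelled_gens
begin

section \<open>The group and its generators\<close>

definition Grho :: "(real \<Rightarrow> real) set" where
  "Grho = generate (homeo_plus UNIV) (zeta \<rho> ` {nu1 c0, \<nu>2, \<nu>3} \<union> chi \<rho> ` {nu1 c0, \<nu>2, \<nu>3})"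

lemma c0_id: assumes "x \<le> 0 \<or> x \<ge> 1/4" shows "c0 x = x"
proof -
  have "x \<notin> supp c0" using assms c0_supp by auto
  then show ?thesis by (simp add: supp_def)
qed

lemma c0_mid: assumes "0 < x" "x < 1/4" shows "x < c0 x" "0 < c0 x" "c0 x < 1/4"
proof -
  have H: "c0 \<in> Homeo" using c0_PLc PLc_Homeo by blast
  show "x < c0 x" using c0_up assms by auto
  then show "0 < c0 x" using assms by simp
  show "c0 x < 1/4" using Homeo_less[OF H, of x "1/4"] c0_id[of "1/4"] assms by simp
qed

lemma flip_c0: "flip c0 x = 1 - c0 (1 - x)"
proof (cases "x \<in> {0..1}")
  case True
  then show ?thesis
    using flip_eq[OF unit_homeos_PLc, of c0 x] c0_PLc PLc_mono[of c0 "{0..1/4}" "{0..1}"] by auto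
next
  case False
  then show ?thesis using c0_id[of x] c0_id[of "1 - x"] by (auto simp: flip_def iota0_def)
qed

lemma nu1_PLc: "nu1 c0 \<in> PLc {0..1}"
proof -
  let ?r = "\<lambda>x::real. -1 * 2 powi 0 * x + 1"
  have a: "aff ?r" by (rule affI) auto
  have "iv ?r x = 1 - x" for x using aff_iv_f[OF a, of "1 - x"] by simp
  then have "flip c0 = ?r \<circ> c0 \<circ> iv ?r" by (auto simp: flip_c0 fun_eq_iff)
  also have "\<dots> \<in> PLc (?r ` {0..1/4})" by (rule PLc_conj[OF c0_PLc a])
  finally have "flip c0 \<in> PLc {0..1}" by (rule PLc_mono) auto
  moreover have "c0 \<in> PLc {0..1}" using c0_PLc by (rule PLc_mono) auto
  ultimately have "flip c0 \<circ> c0 \<in> PLc {0..1}" by (rule gpD(3)[OF perm_group_PLc])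
  then show ?thesis by (simp add: nu1_def fcomp_comp)
qed

lemma nu1_eq: "nu1 c0 x = 1 - c0 (1 - c0 x)"
  by (simp add: nu1_def flip_c0)

lemma nu1_up: "0 < x \<Longrightarrow> x < 1/4 \<Longrightarrow> x < nu1 c0 x"
  using c0_mid[of x] c0_id[of "1 - c0 x"] by (simp add: nu1_eq)

text \<open>\<open>c0\<close> and its mirror image have disjoint supports near the two ends. Because
  of this symmetry the powers of \<open>nu1 c0\<close> squeeze a compact set from both ends at once,
  as needed in \<open>unit_PLc_gen_lifts\<close>.\<close>

lemma nu1_sym: "nu1 c0 (1 - x) = 1 - nu1 c0 x"
proof -
  consider "0 < x" "x < 1/4" | "3/4 < x" "x < 1" | "x \<le> 0 \<or> x \<ge> 1/4" "1 - x \<le> 0 \<or> 1 - x \<ge> 1/4"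
    by linarith
  then show ?thesis
  proof cases
    case 1
    then show ?thesis using c0_mid[of x] c0_id[of "1 - x"] c0_id[of "1 - c0 x"]
      by (simp add: nu1_eq)
  next
    case 2
    then show ?thesis using c0_mid[of "1 - x"] c0_id[of x] c0_id[of "1 - c0 (1 - x)"]
      by (simp add: nu1_eq)
  next
    case 3
    then show ?thesis using c0_id[of x] c0_id[of "1 - x"] by (simp add: nu1_eq)
  qed
qed

lemma core_PLc: "F_on (1/16) (15/16) = PLc {1/16..15/16}"
  by (simp add: F_on_PLc)

lemma gens_PLc: "\<nu> \<in> {nu1 c0, \<nu>2, \<nu>3} \<Longrightarrow> \<nu> \<in> PLc {0..1}"
proof -
  have "\<nu>2 \<in> PLc {1/16..15/16}" "\<nu>3 \<in> PLc {1/16..15/16}"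
    using nu_gen core_PLc generate.incl[of _ "{\<nu>2, \<nu>3}" "homeo_plus {0..1}"] by blast+
  then have "\<nu>2 \<in> PLc {0..1}" "\<nu>3 \<in> PLc {0..1}" by (auto elim!: PLc_mono)
  then show "\<nu> \<in> {nu1 c0, \<nu>2, \<nu>3} \<Longrightarrow> \<nu> \<in> PLc {0..1}" using nu1_PLc by blast
qed

lemma generator_cases:
  assumes "f \<in> zeta \<rho> ` {nu1 c0, \<nu>2, \<nu>3} \<union> chi \<rho> ` {nu1 c0, \<nu>2, \<nu>3}"
  obtains k \<nu> where "k \<in> half_ints" "\<nu> \<in> {nu1 c0, \<nu>2, \<nu>3}" "f = gen \<rho> k \<nu>"
proof -
  have "(1/2 :: real) \<notin> \<int>"
  proof
    assume "(1/2 :: real) \<in> \<int>"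
    then obtain n :: int where "1/2 = real_of_int n" by (rule Ints_cases)
    then have "real_of_int (2 * n) = 1" by simp
    then have "2 * n = 1" by linarith
    then show False by presburger
  qed
  then have z: "zeta \<rho> = gen \<rho> (1/2)" "chi \<rho> = gen \<rho> 0" by (auto simp: gen_def)
  have "1/2 \<in> half_ints" "0 \<in> half_ints" by (auto simp: half_ints_def)
  have "f \<in> gen \<rho> (1/2) ` {nu1 c0, \<nu>2, \<nu>3} \<union> gen \<rho> 0 ` {nu1 c0, \<nu>2, \<nu>3}"
    using assms unfolding z .
  then show ?thesis using that \<open>1/2 \<in> half_ints\<close> \<open>0 \<in> half_ints\<close> by (elim UnE imageE) blast+
qed

lemma generators_Homeo: "zeta \<rho> ` {nu1 c0, \<nu>2, \<nu>3} \<union> chi \<rho> ` {nu1 c0, \<nu>2, \<nu>3} \<subseteq> Homeo"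
proof
  fix f assume "f \<in> zeta \<rho> ` {nu1 c0, \<nu>2, \<nu>3} \<union> chi \<rho> ` {nu1 c0, \<nu>2, \<nu>3}"
  then obtain k \<nu> where "k \<in> half_ints" "\<nu> \<in> {nu1 c0, \<nu>2, \<nu>3}" "f = gen \<rho> k \<nu>"
    by (rule generator_cases)
  then show "f \<in> Homeo" using gen_Homeo unit_homeos_PLc gens_PLc by metis
qed

lemma perm_group_Grho: "perm_group Grho"
proof -
  interpret G: group "homeo_plus UNIV" by (rule group_homeo_plus)
  have sub: "subgroup Grho (homeo_plus UNIV)"
    unfolding Grho_def by (rule G.generate_is_subgroup) (simp only: Homeo_carrier generators_Homeo)
  show ?thesis
    unfolding perm_group_def
  proof (intro conjI ballI)
    show H: "Grho \<subseteq> Homeo" using subgroup.subset[OF sub] by (simp add: Homeo_carrier)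
    show "id \<in> Grho" using subgroup.one_closed[OF sub] by (simp only: homeo_one)
    show "f \<circ> g \<in> Grho" if "f \<in> Grho" "g \<in> Grho" for f g
      using subgroup.m_closed[OF sub that(2,1)] by (simp only: homeo_mult)
    show "iv f \<in> Grho" if "f \<in> Grho" for f
      using subgroup.m_inv_closed[OF sub that] homeo_inv[of f] H that by auto
  qed
qed

lemma Grho_induct:
  assumes "perm_group S" "\<And>k \<nu>. k \<in> half_ints \<Longrightarrow> \<nu> \<in> {nu1 c0, \<nu>2, \<nu>3} \<Longrightarrow> gen \<rho> k \<nu> \<in> S"
  shows "Grho \<subseteq> S"
proof
  fix f assume "f \<in> Grho"
  then show "f \<in> S" unfolding Grho_def
  proof (induction rule: generate.induct)
    case one
    then show ?case using gpD(2)[OF assms(1)] by (simp only: homeo_one)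
  next
    case (incl f)
    then show ?case using assms(2) generator_cases by metis
  next
    case (inv f)
    then have "f \<in> S" using assms(2) generator_cases by metis
    then show ?case using gpD(1,4)[OF assms(1)] homeo_inv by metis
  next
    case (eng f g)
    then show ?case using gpD(3)[OF assms(1)] by (simp only: homeo_mult)
  qed
qed

lemma gen_incl:
  assumes "\<nu> \<in> {nu1 c0, \<nu>2, \<nu>3}" shows "gen \<rho> k \<nu> \<in> Grho"
  unfolding Grho_def gen_def using assms by (auto intro!: generate.incl)

text \<open>The lifts for both letter types are required together, so that one set serves both. It
  is a group containing the three generating maps, and from these it is shown to contain
  \<open>PLc {0<..<1}\<close>.\<close>

definition gen_lifts :: "(real \<Rightarrow> real) set" where
  "gen_lifts = {\<nu> \<in> unit_homeos. \<forall>k\<in>half_ints. gen \<rho> k \<nu> \<in> Grho}"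

lemma gen_lifts_iff: "\<nu> \<in> gen_lifts \<longleftrightarrow> \<nu> \<in> unit_homeos \<and> (\<forall>k\<in>half_ints. gen \<rho> k \<nu> \<in> Grho)"
  by (simp add: gen_lifts_def)

lemma perm_group_gen_lifts: "perm_group gen_lifts"
  unfolding perm_group_def
proof (intro conjI ballI)
  show "gen_lifts \<subseteq> Homeo" using unit_homeosD by (auto simp: gen_lifts_def)
  show "id \<in> gen_lifts"
    unfolding gen_lifts_iff
    using gpD(2)[OF unit_homeos_perm_group] gpD(2)[OF perm_group_Grho] gen_id by simp
  fix f assume f: "f \<in> gen_lifts"
  then have f': "f \<in> unit_homeos" "\<And>k. k \<in> half_ints \<Longrightarrow> gen \<rho> k f \<in> Grho"
    by (auto simp: gen_lifts_iff)
  have "gen \<rho> k (iv f) \<in> Grho" if "k \<in> half_ints" for k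
    using gpD(4)[OF perm_group_Grho f'(2)[OF that]] gen_bij(2)[OF that f'(1)] by simp
  then show "iv f \<in> gen_lifts" unfolding gen_lifts_iff using gpD(4)[OF unit_homeos_perm_group f'(1)]
    by blast
  fix g assume "g \<in> gen_lifts"
  then have g': "g \<in> unit_homeos" "\<And>k. k \<in> half_ints \<Longrightarrow> gen \<rho> k g \<in> Grho"
    by (auto simp: gen_lifts_iff)
  have "gen \<rho> k (f \<circ> g) \<in> Grho" if "k \<in> half_ints" for k
    unfolding gen_comp[OF that g'(1) f'(1)]
    by (rule gpD(3)[OF perm_group_Grho f'(2)[OF that] g'(2)[OF that]])
  then show "f \<circ> g \<in> gen_lifts" unfolding gen_lifts_iff
    using gpD(3)[OF unit_homeos_perm_group f'(1) g'(1)] by blast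
qed

lemma gens_gen_lifts: "\<nu> \<in> {nu1 c0, \<nu>2, \<nu>3} \<Longrightarrow> \<nu> \<in> gen_lifts"
  unfolding gen_lifts_def using gens_PLc unit_homeos_PLc gen_incl by blast

lemma core_gen_lifts: "PLc {1/16..15/16} \<subseteq> gen_lifts"
proof
  fix h assume "h \<in> PLc {1/16..15/16}"
  then have "h \<in> generate (homeo_plus {0..1}) {\<nu>2, \<nu>3}" using nu_gen core_PLc by simp
  then show "h \<in> gen_lifts"
  proof (induction rule: generate.induct)
    case one
    then show ?case using gpD(2)[OF perm_group_gen_lifts] by (simp only: homeo_one)
  next
    case (incl f)
    then show ?case using gens_gen_lifts by blast
  next
    case (inv f)
    then have "f \<in> gen_lifts" "inv\<^bsub>homeo_plus {0..1}\<^esub> f = iv f"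
      using gens_gen_lifts homeo01_inv nu2 nu3 by blast+
    then show ?case using gpD(4)[OF perm_group_gen_lifts] by simp
  next
    case (eng f g)
    then show ?case using gpD(3)[OF perm_group_gen_lifts] by (simp only: homeo_mult)
  qed
qed

text \<open>A power of \<open>nu1 c0\<close> carries the support into the core interval, where every
  element is a word in the other two generators; conjugating back gives \<open>h\<close>.\<close>

lemma unit_PLc_gen_lifts: assumes "h \<in> PLc {0<..<1}" shows "h \<in> gen_lifts"
proof -
  obtain c c' where c: "0 < c" "c \<le> c'" "c' < 1" "h \<in> PLc {c..c'}" using PLc_hull[OF assms] by auto
  \<comment> \<open>A bound for the distance of the support from both ends. The cap 1/8 puts
    \<open>\<delta>\<close> below 1/4, where \<open>nu1 c0\<close> moves points to the
    right.\<close>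
  define \<delta> where "\<delta> = min (min c (1 - c')) (1/8)"
  have \<delta>: "0 < \<delta>" "\<delta> \<le> c" "c' \<le> 1 - \<delta>" "\<delta> \<le> 1/8" using c unfolding \<delta>_def by linarith+
  let ?\<Gamma> = "{nu1 c0 ^^ n | n. True}"
  have nuH: "nu1 c0 \<in> Homeo" using nu1_PLc PLc_Homeo by blast
  have pH: "nu1 c0 ^^ n \<in> Homeo \<and> nu1 c0 ^^ n \<in> PLc {0..1} \<and> nu1 c0 ^^ n \<in> gen_lifts" for n
  proof (induction n)
    case 0
    then show ?case using gpD(2)[OF perm_group_gen_lifts] gpD(2)[OF perm_group_PLc]
      by (simp add: id_def[symmetric])
  next
    case (Suc n)
    then show ?case
      unfolding funpow.simps(2)
      using gpD(3)[OF perm_group_gen_lifts gens_gen_lifts[of "nu1 c0"]] gpD(3)[OF perm_group_PLc nu1_PLc] Homeo_comp[OF nuH] by blast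
  qed
  have "\<exists>t\<in>?\<Gamma>. 1/16 < t \<delta>"
  proof (rule push[where u = 0 and v = "1/4"])
    fix f g assume "f \<in> ?\<Gamma>" "g \<in> ?\<Gamma>"
    then show "f \<circ> g \<in> ?\<Gamma>" by (auto simp: funpow_add[symmetric])
  next
    show "id \<in> ?\<Gamma>" by (auto intro: exI[of _ 0])
  next
    fix s :: real assume "0 < s" "s < 1/4"
    moreover have "nu1 c0 ^^ 1 \<in> ?\<Gamma>" by blast
    then have "nu1 c0 \<in> ?\<Gamma>" by simp
    ultimately show "\<exists>b\<in>?\<Gamma>. s < b s" using nu1_up by blast
  qed (use pH \<delta> in auto)
  then obtain n where n: "1/16 < (nu1 c0 ^^ n) \<delta>" by blast
  let ?t = "nu1 c0 ^^ n"
  have sym: "(nu1 c0 ^^ m) (1 - x) = 1 - (nu1 c0 ^^ m) x" for m x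
    by (induction m) (auto simp: nu1_sym)
  have tH: "?t \<in> Homeo" "?t \<in> PLc {0..1}" "?t \<in> gen_lifts" using pH by auto
  have "?t ` {c..c'} \<subseteq> {1/16..15/16}"
  proof clarify
    fix x assume "x \<in> {c..c'}"
    then have "?t \<delta> \<le> ?t x" "?t x \<le> ?t (1 - \<delta>)" using \<delta> Homeo_le[OF tH(1)] by auto
    then show "?t x \<in> {1/16..15/16}" using n sym[of n \<delta>] by auto
  qed
  then have "?t \<circ> h \<circ> iv ?t \<in> gen_lifts" using PLc_conj_Homeo[OF c(4) tH(2)] PLc_mono core_gen_lifts
    by blast
  then have "iv ?t \<circ> (?t \<circ> h \<circ> iv ?t) \<circ> ?t \<in> gen_lifts"
    using gpD(3,4)[OF perm_group_gen_lifts] tH(3) by metis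
  moreover have "iv ?t \<circ> (?t \<circ> h \<circ> iv ?t) \<circ> ?t = h" using tH(1) by (auto simp: fun_eq_iff)
  ultimately show ?thesis by metis
qed

text \<open>The rule acting by \<open>h\<close> around \<open>k\<close> at every occurrence, in either direction, of the word on \<open>X\<close>.\<close>

definition word_rule :: "real \<Rightarrow> real set \<Rightarrow> bool" where
  "word_rule k X \<longleftrightarrow> (\<forall>h\<in>PLc {k - 1/2<..<k + 1/2}. spread (copies (matches \<rho> X) (k - 1/2) (k + 1/2)) h \<in> Grho)"

text \<open>The occurrences of a single letter are the cells of all congruent positions, each
  oriented by its sign. On these cells the lift of \<open>h\<close>, read in the chart of
  \<open>k\<close>, acts as the spread of \<open>h\<close>.\<close>

lemma word_rule_base: assumes k: "k \<in> half_ints" shows "word_rule k {k}"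
  unfolding word_rule_def
proof
  fix h assume h: "h \<in> PLc {k - 1/2<..<k + 1/2}"
  let ?\<nu> = "iv (chart k) \<circ> h \<circ> chart k"
  have a: "aff (chart k)" by (rule chart_aff[OF k])
  have ivc: "iv (chart k) y = letter_sign \<rho> k * (y - k) + 1/2" for y
  proof -
    have "chart k (letter_sign \<rho> k * (y - k) + 1/2) = y" unfolding chart_eq by simp
    then show ?thesis using aff_iv_f[OF a] by metis
  qed
  have "?\<nu> = iv (chart k) \<circ> h \<circ> iv (iv (chart k))" by (simp add: aff_iv_iv[OF a])
  also have "\<dots> \<in> PLc (iv (chart k) ` {k - 1/2<..<k + 1/2})" by (rule PLc_conj[OF h aff_iv[OF a]])
  finally have "?\<nu> \<in> PLc {0<..<1}"
    by (rule PLc_mono) (use letter_sign_cases[of \<rho> k] in \<open>auto simp: ivc\<close>)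
  then have nu: "?\<nu> \<in> gen_lifts" by (rule unit_PLc_gen_lifts)
  then have u: "?\<nu> \<in> unit_homeos" "gen \<rho> k ?\<nu> \<in> Grho" using k by (auto simp: gen_lifts_def)
  have hc: "k + letter_sign \<rho> k * (?\<nu> (s + 1/2) - 1/2) = h (k + letter_sign \<rho> k * s)" for s
  proof -
    have "h (k + letter_sign \<rho> k * s) = chart k (?\<nu> (s + 1/2))"
      using aff_f_iv[OF a] by (simp add: chart_eq)
    also have "\<dots> = k + letter_sign \<rho> k * (?\<nu> (s + 1/2) - 1/2)"
      using chart_eq[of k "?\<nu> (s + 1/2) - 1/2"] by simp
    finally show ?thesis by simp
  qed
  have "gen \<rho> k ?\<nu> = spread (copies (matches \<rho> {k}) (k - 1/2) (k + 1/2)) h"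
  proof (rule spread_eqI[OF indep_letter[OF k] subset_refl])
    fix x assume x: "x \<notin> region (copies (matches \<rho> {k}) (k - 1/2) (k + 1/2))"
    obtain j s where j: "j \<in> half_ints" "j - k \<in> \<int>" "\<bar>s\<bar> \<le> 1/2" "x = j + letter_sign \<rho> j * s"
      using cell_cover[OF k] by metis
    have "\<not> \<bar>s\<bar> < 1/2"
    proof
      assume s: "\<bar>s\<bar> < 1/2"
      \<comment> \<open>The isometry carrying \<open>k\<close> to \<open>j\<close> whose slope is
        the product of the two signs; it is the occurrence whose copy would contain
        \<open>x\<close>.\<close>
      let ?e = "letter_sign \<rho> j * letter_sign \<rho> k"
      let ?\<sigma> = "\<lambda>y. ?e * y + (j - ?e * k)"
      have e: "?e = 1 \<or> ?e = -1" using letter_sign_cases[of \<rho> j] letter_sign_cases[of \<rho> k] by auto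
      have "j + k = (j - k) + 2 * k" by simp
      also have "\<dots> \<in> \<int>" using j(2) k by (intro Ints_add) (auto simp: half_ints_def)
      finally have "j - ?e * k \<in> \<int>" using e j(2) by auto
      then have i: "isom ?\<sigma>" using e by (intro isoI) auto
      have "matches \<rho> {k} ?\<sigma>" unfolding matches_def slope_affine by (simp add: mult.assoc)
      then have m: "(?\<sigma>, k - 1/2, k + 1/2) \<in> copies (matches \<rho> {k}) (k - 1/2) (k + 1/2)" using i
        by (simp add: copies_iff)
      have "\<bar>letter_sign \<rho> k * s\<bar> < 1/2" using s by simp
      then have "k - 1/2 < k + letter_sign \<rho> k * s" "k + letter_sign \<rho> k * s < k + 1/2" by linarith+
      moreover have "?\<sigma> (k + letter_sign \<rho> k * s) = x" unfolding j(4) by (simp add: algebra_simps)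
      ultimately show False using x m unfolding region_iff by metis
    qed
    then have "s = 1/2 \<or> s = -1/2" using j(3) by linarith
    then show "gen \<rho> k ?\<nu> x = x"
    proof
      assume s: "s = 1/2"
      show ?thesis
        unfolding j(4) gen_at(1)[OF k u(1) j(1-3)] unfolding s using unit_homeosD(3)[OF u(1)]
        by simp
    next
      assume s: "s = -1/2"
      show ?thesis
        unfolding j(4) gen_at(1)[OF k u(1) j(1-3)] unfolding s using unit_homeosD(2)[OF u(1)]
        by simp
    qed
  next
    fix \<sigma> u v y assume a: "(\<sigma>,u,v) \<in> copies (matches \<rho> {k}) (k - 1/2) (k + 1/2)" "u < y" "y < v"
    then have s: "isom \<sigma>" "matches \<rho> {k} \<sigma>" "k - 1/2 < y" "y < k + 1/2" by (auto simp: copies_iff)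
    define z where "z = letter_sign \<rho> k * (y - k)"
    have y: "y = k + letter_sign \<rho> k * z" by (simp add: z_def)
    have "\<bar>y - k\<bar> \<le> 1/2" using s(3,4) by linarith
    then have z: "\<bar>z\<bar> \<le> 1/2" by (simp add: z_def)
    have e: "letter_sign \<rho> (\<sigma> k) = slope \<sigma> * letter_sign \<rho> k" using s(2) k
      by (simp add: matches_def)
    have ex: "\<sigma> (k + letter_sign \<rho> k * w) = \<sigma> k + letter_sign \<rho> (\<sigma> k) * w" for w
      using isom_diff[OF s(1), of "k + letter_sign \<rho> k * w" k] e by simp
    have "gen \<rho> k ?\<nu> (\<sigma> y) = \<sigma> k + letter_sign \<rho> (\<sigma> k) * (?\<nu> (z + 1/2) - 1/2)"
      unfolding y ex
      using gen_at(1)[OF k u(1) iffD2[OF isom_half[OF s(1)] k] isom_shift_Ints[OF s(1) k] z] .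
    also have "\<dots> = \<sigma> (h y)" unfolding ex[symmetric] hc y ..
    finally show "gen \<rho> k ?\<nu> (\<sigma> y) = \<sigma> (if (\<sigma>,u,v) \<in> copies (matches \<rho> {k}) (k - 1/2) (k + 1/2) then h y else y)"
      using a by simp
  qed simp
  then show "spread (copies (matches \<rho> {k}) (k - 1/2) (k + 1/2)) h \<in> Grho" using u(2) by simp
qed

lemma stabil_copies: "h \<in> PLc {u'<..<v'} \<Longrightarrow> u \<le> u' \<Longrightarrow> v' \<le> v \<Longrightarrow> h \<in> stabil (copies P u v)"
  by (rule stabil_PLc) (auto simp: copies_iff)

text \<open>
  The commutator of two rules around neighbouring letters survives only where both blocks
  occur.
\<close>

lemma word_rule_step:
  assumes "word_rule k X" "word_rule k' Y" "k \<in> half_ints" "k' \<in> half_ints" "k \<in> X" "k' \<in> Y"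
    and "k' = k + 1/2 \<or> k' = k - 1/2"
  shows "word_rule k (X \<union> Y)"
proof -
  \<comment> \<open>The cells of \<open>k\<close> and \<open>k'\<close> overlap exactly in
    \<open>{p..p + 1/2}\<close>.\<close>
  define p where "p = min k k'"
  have p: "p \<in> half_ints" "k - 1/2 \<le> p" "p + 1/2 \<le> k + 1/2" "k' - 1/2 \<le> p" "p + 1/2 \<le> k' + 1/2"
    using assms(3,4,7) by (auto simp: p_def min_def)
  let ?gap = "\<lambda>Z. copies (matches \<rho> Z) p (p + 1/2)"
  note iX = indep_letter[OF assms(3,5)] and iY = indep_letter[OF assms(4,6)]
  have iT: "indep (copies (\<lambda>_. True) p (p + 1/2))" by (rule indep_gap[OF p(1)])
  have gX: "spread (?gap X) a \<in> Grho" and gY: "spread (?gap Y) a \<in> Grho"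
    if a: "a \<in> PLc {p<..<p + 1/2}" for a
  proof -
    have "a \<in> PLc {k - 1/2<..<k + 1/2}" "a \<in> PLc {k' - 1/2<..<k' + 1/2}" using a p
      by (auto elim!: PLc_mono)
    then have "spread (copies (matches \<rho> X) (k - 1/2) (k + 1/2)) a \<in> Grho"
      "spread (copies (matches \<rho> Y) (k' - 1/2) (k' + 1/2)) a \<in> Grho"
      using assms(1,2) by (auto simp: word_rule_def)
    then show "spread (?gap X) a \<in> Grho" "spread (?gap Y) a \<in> Grho"
      using spread_shrink[OF iX p(2,3) PLc_fix[OF a]] spread_shrink[OF iY p(4,5) PLc_fix[OF a]]
      by simp_all
  qed
  have iXY: "indep (?gap (X \<union> Y))" by (rule indep_sub[OF iT]) (auto simp: copies_def)
  \<comment> \<open>Each commutator in a decomposition of \<open>h\<close> gets its first entry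
    spread over the occurrences of \<open>X\<close> and its second over those of \<open>Y\<close>.
    Both families consist of copies of one gap, so \<open>indep_gap\<close> makes their union
    independent.\<close>
  have gap: "spread (?gap (X \<union> Y)) h \<in> Grho" if "h \<in> PLc {p<..<p + 1/2}" for h
  proof -
    have "h \<in> cprod (PLc {p<..<p + 1/2})" by (rule perfect[OF that]) simp
    then show ?thesis
    proof (induction rule: cprod.induct)
      case cprod_id
      show ?case unfolding spread_id[OF iXY] by (rule gpD(2)[OF perm_group_Grho])
    next
      case (cprod_step a b f)
      have f: "f \<in> stabil (?gap (X \<union> Y))"
        using cprod_sub[OF cprod_step(3) perm_group_PLc] by (rule stabil_copies) auto
      have "?gap X \<inter> ?gap Y = ?gap (X \<union> Y)" by (auto simp: copies_def matches_Un)
      moreover have "commt (spread (?gap X) a) (spread (?gap Y) b) = spread (?gap X \<inter> ?gap Y) (commt a b)"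
        by (rule spread_commt_sub[OF iT]) (auto simp: copies_def intro!: stabil_PLc[OF cprod_step(1)] stabil_PLc[OF cprod_step(2)])
      ultimately have "spread (?gap (X \<union> Y)) (commt a b) \<in> Grho"
        using perm_group_commt[OF perm_group_Grho gX[OF cprod_step(1)] gY[OF cprod_step(2)]] by simp
      then show ?case using spread_comp[OF iXY f] gpD(3)[OF perm_group_Grho] cprod_step(4) by metis
    qed
  qed
  show ?thesis
    unfolding word_rule_def
  proof
    fix h assume h: "h \<in> PLc {k - 1/2<..<k + 1/2}"
    let ?I = "\<lambda>Z. copies (matches \<rho> Z) (k - 1/2) (k + 1/2)"
    \<comment> \<open>A map supported in the whole cell of \<open>k\<close> is first compressed into
      the overlap. Undoing the compression by the rule for \<open>X\<close> alone is enough, since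
      occurrences of the union are occurrences of \<open>X\<close>.\<close>
    obtain s where s: "s \<in> PLc {k - 1/2<..<k + 1/2}" "s \<circ> h \<circ> iv s \<in> PLc {p<..<p + 1/2}"
      using squeeze_PLc[OF h _ p(2) _ p(3)] by auto
    let ?h = "s \<circ> h \<circ> iv s"
    have sub: "?I (X \<union> Y) \<subseteq> ?I X" by (auto simp: copies_def matches_Un)
    have iI: "indep (?I (X \<union> Y))" by (rule indep_sub[OF iX sub])
    have ivs: "iv s \<in> PLc {k - 1/2<..<k + 1/2}" "s \<in> Homeo"
      using s(1) gpD(4)[OF perm_group_PLc] PLc_Homeo by blast+
    have st: "iv s \<in> stabil (?I X)" "?h \<in> stabil (?I X)"
      using stabil_copies[OF ivs(1)] stabil_copies[OF s(2) p(2,3)] by auto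
    have l: "spread (?I X) (iv s) \<in> Grho" using assms(1) ivs(1) by (simp add: word_rule_def)
    have "spread (?I (X \<union> Y)) ?h \<in> Grho"
      using gap[OF s(2)] spread_shrink[OF iI p(2,3), of ?h] PLc_fix[OF s(2)] by metis
    then have "spread (?I X) (iv s) \<circ> spread (?I (X \<union> Y)) ?h \<circ> iv (spread (?I X) (iv s)) \<in> Grho"
      using l gpD(3,4)[OF perm_group_Grho] by blast
    moreover have "iv s \<circ> ?h \<circ> iv (iv s) = h" using ivs(2) by (auto simp: fun_eq_iff)
    ultimately show "spread (?I (X \<union> Y)) h \<in> Grho" using spread_conj_sub[OF iX sub st] by metis
  qed
qed

lemma matches_cong: "X \<inter> half_ints = Y \<inter> half_ints \<Longrightarrow> matches \<rho> X = matches \<rho> Y"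
  unfolding matches_def fun_eq_iff by simp

lemma word_rule_cong: "X \<inter> half_ints = Y \<inter> half_ints \<Longrightarrow> word_rule k X \<Longrightarrow> word_rule k Y"
  unfolding word_rule_def using matches_cong[of X Y] by simp

lemma half_split:
  assumes "k \<in> half_ints" "a \<le> k" "k + 1/2 \<le> b"
  shows "({a..k} \<union> {k + 1/2..b}) \<inter> half_ints = {a..b} \<inter> half_ints"
  using assms half_ints_less[of k] by force

text \<open>Induction on the length. The block is split next to \<open>k\<close> into the part
  ending at \<open>k\<close> and a rest that is a block around the neighbouring letter;
  \<open>word_rule_step\<close> joins them. The rest is taken on the right if there is one,
  otherwise on the left.\<close>

lemma word_rule_interval:
  assumes "k \<in> half_ints" "a \<le> k" "k \<le> b" shows "word_rule k {a..b}"
proof -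
  have "\<forall>k a b. k \<in> half_ints \<longrightarrow> a \<le> k \<longrightarrow> k \<le> b \<longrightarrow> b - a < real n / 2 \<longrightarrow> word_rule k {a..b}" for n
  proof (induction n)
    case 0
    then show ?case by auto
  next
    case (Suc n)
    show ?case
    proof (intro allI impI)
      fix k a b assume k: "k \<in> half_ints" "a \<le> k" "k \<le> b" "b - a < real (Suc n) / 2"
      have d: "b - a < real n / 2 + 1/2" using k(4) by (simp add: add_divide_distrib)
      show "word_rule k {a..b}"
      proof (cases "k + 1/2 \<le> b")
        case True
        have h: "k + 1/2 \<in> half_ints" by (rule half_ints_step(1)[OF k(1)])
        have "word_rule k {a..k}" using Suc k(1,2) d True by auto
        moreover have "word_rule (k + 1/2) {k + 1/2..b}" using Suc h d k(2) True by auto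
        ultimately have "word_rule k ({a..k} \<union> {k + 1/2..b})"
          by (rule word_rule_step[OF _ _ k(1) h]) (use k True in auto)
        then show ?thesis by (rule word_rule_cong[OF half_split[OF k(1,2) True]])
      next
        case F1: False
        show ?thesis
        proof (cases "a \<le> k - 1/2")
          case True
          have h: "k - 1/2 \<in> half_ints" by (rule half_ints_step(2)[OF k(1)])
          have "word_rule (k - 1/2) {a..k - 1/2}" using Suc h d k(3) True by auto
          moreover have "word_rule k {k..b}" using Suc k(1,3) d True by auto
          ultimately have "word_rule k ({k..b} \<union> {a..k - 1/2})"
            by (intro word_rule_step[OF _ _ k(1) h]) (use k True in auto)
          moreover have "({k..b} \<union> {a..k - 1/2}) \<inter> half_ints = {a..b} \<inter> half_ints"
            using half_split[OF h True, of b] k(3) by auto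
          ultimately show ?thesis using word_rule_cong by blast
        next
          case False
          have "{k} \<inter> half_ints = {a..b} \<inter> half_ints"
            using k F1 False half_ints_less[of k] half_ints_less[of _ k] by force
          then show ?thesis using word_rule_base[OF k(1)] word_rule_cong by blast
        qed
      qed
    qed
  qed
  moreover obtain n :: nat where "2 * (b - a) < real n" using reals_Archimedean2 by blast
  ultimately show ?thesis using assms by (metis less_divide_eq_numeral1(1) mult.commute)
qed

text \<open>Elements supported in one letter cell are available by
  \<open>word_rule_interval\<close>. They generate enough motion to push any compact support into
  the cell at the right end, where the conjugated element is again of this small type. The margin
  1/2 keeps in the block every letter whose cell meets the interval.\<close>

lemma spread_block:
  assumes "indep (copies (matches \<rho> {a..b}) u v)" "a \<le> u - 1/2" "v + 1/2 \<le> b" "u < v"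
    and "h \<in> PLc {u<..<v}"
  shows "spread (copies (matches \<rho> {a..b}) u v) h \<in> Grho"
proof -
  let ?S = "copies (matches \<rho> {a..b}) u v"
  define \<Gamma> where "\<Gamma> = {h \<in> PLc {u<..<v}. spread ?S h \<in> Grho}"
  have st: "h \<in> stabil ?S" if "h \<in> PLc {u<..<v}" for h using that by (rule stabil_copies) auto
  have perm_group: "perm_group \<Gamma>"
    unfolding perm_group_def
  proof (intro conjI ballI)
    show "\<Gamma> \<subseteq> Homeo" using PLc_Homeo by (auto simp: \<Gamma>_def)
    show "id \<in> \<Gamma>" using gpD(2)[OF perm_group_PLc] gpD(2)[OF perm_group_Grho] spread_id[OF assms(1)]
      by (simp add: \<Gamma>_def)
    fix f assume f: "f \<in> \<Gamma>"
    then have "f \<in> PLc {u<..<v}" "iv f \<in> PLc {u<..<v}" "spread ?S f \<in> Grho"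
      using gpD(4)[OF perm_group_PLc] by (auto simp: \<Gamma>_def)
    then show "iv f \<in> \<Gamma>" using spread_bij(2)[OF assms(1) st] gpD(4)[OF perm_group_Grho]
      unfolding \<Gamma>_def by fastforce
    fix g assume g: "g \<in> \<Gamma>"
    then have "f \<circ> g \<in> PLc {u<..<v}" using f gpD(3)[OF perm_group_PLc] by (auto simp: \<Gamma>_def)
    moreover have "spread ?S (f \<circ> g) = spread ?S f \<circ> spread ?S g" using g
      by (intro spread_comp[OF assms(1) st]) (simp add: \<Gamma>_def)
    then have "spread ?S (f \<circ> g) \<in> Grho" using f g gpD(3)[OF perm_group_Grho] by (simp add: \<Gamma>_def)
    ultimately show "f \<circ> g \<in> \<Gamma>" by (simp add: \<Gamma>_def)
  qed
  have local: "f \<in> \<Gamma>"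
    if k: "k \<in> half_ints" and f: "f \<in> PLc {max u (k - 1/2)<..<min v (k + 1/2)}"
      and ne: "max u (k - 1/2) < min v (k + 1/2)" for k f
  proof -
    have kab: "a \<le> k" "k \<le> b" using ne assms(2,3) by auto
    have "f \<in> PLc {u<..<v}" using f by (rule PLc_mono) auto
    moreover have "f \<in> PLc {k - 1/2<..<k + 1/2}" using f by (rule PLc_mono) auto
    then have "spread (copies (matches \<rho> {a..b}) (k - 1/2) (k + 1/2)) f \<in> Grho"
      using word_rule_interval[OF k kab] by (simp add: word_rule_def)
    moreover have "indep (copies (matches \<rho> {a..b}) (k - 1/2) (k + 1/2))" using k kab
      by (intro indep_letter) auto
    then have "spread (copies (matches \<rho> {a..b}) (max u (k - 1/2)) (min v (k + 1/2))) f
        = spread (copies (matches \<rho> {a..b}) (k - 1/2) (k + 1/2)) f"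
      by (rule spread_shrink) (use PLc_fix[OF f] in auto)
    moreover have "spread (copies (matches \<rho> {a..b}) (max u (k - 1/2)) (min v (k + 1/2))) f = spread ?S f"
      by (rule spread_shrink[OF assms(1)]) (use PLc_fix[OF f] in auto)
    ultimately show ?thesis by (simp add: \<Gamma>_def)
  qed
  obtain c c' where c: "u < c" "c \<le> c'" "c' < v" "h \<in> PLc {c..c'}" using PLc_hull[OF assms(5,4)] .
  \<comment> \<open>This cell has \<open>v\<close> in its interior, so whatever is pushed beyond its
    left end, while staying below \<open>v\<close>, lies in one cell.\<close>
  obtain k where k: "k \<in> half_ints" "k - 1/2 < v" "v < k + 1/2" using nearest_half .
  let ?v = "max u (k - 1/2)"
  have "\<exists>t\<in>\<Gamma>. ?v < t c"
  proof (rule push)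
    fix s assume s: "u < s" "s < v"
    obtain j where j: "j \<in> half_ints" "j - 1/2 < s" "s < j + 1/2" using nearest_half .
    obtain b where "b \<in> PLc {max u (j - 1/2)<..<min v (j + 1/2)}" "s < b s"
      using bump[of "max u (j - 1/2)" s "min v (j + 1/2)"] s j by auto
    then show "\<exists>b\<in>\<Gamma>. s < b s" using local[OF j(1)] s j by auto
  qed (use gpD[OF perm_group] c k assms(4) in auto)
  then obtain t where t: "t \<in> \<Gamma>" "?v < t c" by blast
  then have tB: "t \<in> PLc {u<..<v}" and tH: "t \<in> Homeo" using PLc_Homeo by (auto simp: \<Gamma>_def)
  have "t ` {c..c'} \<subseteq> {?v<..<min v (k + 1/2)}"
  proof clarify
    fix x assume "x \<in> {c..c'}"
    then have "t c \<le> t x" "t x < v" using Homeo_le[OF tH] PLc_less(1)[OF tB] c by auto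
    then show "t x \<in> {?v<..<min v (k + 1/2)}" using t k by auto
  qed
  then have "t \<circ> h \<circ> iv t \<in> \<Gamma>"
    using PLc_conj_Homeo[OF c(4) tB] PLc_mono k assms(4) by (intro local[OF k(1)]) auto
  then have "iv t \<circ> (t \<circ> h \<circ> iv t) \<circ> t \<in> \<Gamma>" using t(1) gpD(3,4)[OF perm_group] by blast
  moreover have "iv t \<circ> (t \<circ> h \<circ> iv t) \<circ> t = h" using tH by (auto simp: fun_eq_iff)
  ultimately have "h \<in> \<Gamma>" by metis
  then show ?thesis by (simp add: \<Gamma>_def)
qed

end

section \<open>Equivariance and occurrences of blocks\<close>

lemma letter_sign_letter_inv: "\<rho> j = letter_inv (\<rho> k) \<Longrightarrow> letter_sign \<rho> j = - letter_sign \<rho> k"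
  by (cases "\<rho> k") (auto simp: letter_sign_def)

context labelled_gens
begin

text \<open>Radii add under composition only after enlargement by the displacement of the inner map,
  so the displacement bound has to be carried along with the radius.\<close>

lemma Grho_equivariant:
  assumes "f \<in> Grho" shows "\<exists>M D. 0 \<le> M \<and> equivariant \<rho> M f \<and> (\<forall>x. \<bar>f x - x\<bar> \<le> D)"
proof -
  let ?S = "{f \<in> Homeo. \<exists>M D. 0 \<le> M \<and> equivariant \<rho> M f \<and> (\<forall>x. \<bar>f x - x\<bar> \<le> D)}"
  have "perm_group ?S"
    unfolding perm_group_def
  proof (intro conjI ballI)
    have "equivariant \<rho> 0 id" by (simp add: equivariant_def)
    then show "id \<in> ?S" by (auto intro!: exI[of _ 0])
    fix f assume "f \<in> ?S"
    then obtain M D where f: "f \<in> Homeo" "0 \<le> M" "equivariant \<rho> M f" "\<And>x. \<bar>f x - x\<bar> \<le> D" by blast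
    have D: "0 \<le> D" using f(4)[of 0] by linarith
    have d: "\<bar>x - iv f x\<bar> \<le> D" for x using f(4)[of "iv f x"] f_iv[OF f(1)] by simp
    have "equivariant \<rho> (M + D) (iv f)"
      unfolding equivariant_def
    proof (intro allI impI)
      fix \<sigma> x assume s: "isom \<sigma>" "matches \<rho> {x - (M + D)..x + (M + D)} \<sigma>"
      have "\<bar>x - iv f x\<bar> \<le> D" by (rule d)
      then have "{iv f x - M..iv f x + M} \<subseteq> {x - (M + D)..x + (M + D)}" by auto
      then have "f (\<sigma> (iv f x)) = \<sigma> (f (iv f x))" using f(3) s matches_mono
        unfolding equivariant_def by blast
      then show "iv f (\<sigma> x) = \<sigma> (iv f x)" using f_iv[OF f(1)] by (intro iv_eqI[OF f(1)]) simp
    qed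
    moreover have "\<bar>iv f x - x\<bar> \<le> D" for x using d[of x] by linarith
    ultimately show "iv f \<in> ?S" using f D
      by (intro CollectI conjI exI[of _ "M + D"] exI[of _ D]) auto
    fix g assume "g \<in> ?S"
    then obtain M' D' where g: "g \<in> Homeo" "0 \<le> M'" "equivariant \<rho> M' g" "\<And>x. \<bar>g x - x\<bar> \<le> D'"
      by blast
    have D': "0 \<le> D'" using g(4)[of 0] by linarith
    let ?M = "M + D' + M'"
    have "equivariant \<rho> ?M (f \<circ> g)"
      unfolding equivariant_def
    proof (intro allI impI)
      fix \<sigma> x assume s: "isom \<sigma>" "matches \<rho> {x - ?M..x + ?M} \<sigma>"
      have "\<bar>g x - x\<bar> \<le> D'" by (rule g(4))
      then have "{g x - M..g x + M} \<subseteq> {x - ?M..x + ?M}" using g(2) by auto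
      then have 1: "f (\<sigma> (g x)) = \<sigma> (f (g x))" using f(3) s matches_mono unfolding equivariant_def
        by blast
      have "{x - M'..x + M'} \<subseteq> {x - ?M..x + ?M}" using f(2) D' by auto
      then have "g (\<sigma> x) = \<sigma> (g x)" using g(3) s matches_mono unfolding equivariant_def by blast
      then show "(f \<circ> g) (\<sigma> x) = \<sigma> ((f \<circ> g) x)" using 1 by simp
    qed
    moreover have "\<bar>(f \<circ> g) x - x\<bar> \<le> D + D'" for x using f(4)[of "g x"] g(4)[of x] unfolding o_apply
      by linarith
    moreover have "0 \<le> ?M" using f(2) g(2) D' by simp
    ultimately show "f \<circ> g \<in> ?S" using f(1) g(1) Homeo_comp by blast
  qed auto
  moreover have "gen \<rho> k \<nu> \<in> ?S" if "k \<in> half_ints" "\<nu> \<in> {nu1 c0, \<nu>2, \<nu>3}" for k \<nu>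
  proof -
    have u: "\<nu> \<in> unit_homeos" using gens_PLc unit_homeos_PLc that by blast
    show ?thesis
      using gen_Homeo[OF that(1) u] gen_equivariant[OF that(1) u] gen_disp[OF that(1) u] zero_le_one
      by blast
  qed
  ultimately show ?thesis using Grho_induct[of ?S] assms by blast
qed

text \<open>The second claim supplies, in \<open>conj_prod_all\<close>, a compactly supported map
  that agrees with \<open>f\<close> near 0 and can be spread.\<close>

lemma Grho_local:
  assumes "f \<in> Grho" shows "pl2 f" "\<exists>h\<in>PLc UNIV. \<forall>\<^sub>F y in nhds x. h y = f y"
proof -
  let ?S = "{f \<in> Homeo. pl2 f \<and> (\<forall>x. \<exists>h\<in>PLc UNIV. \<forall>\<^sub>F y in nhds x. h y = f y)}"
  have "perm_group ?S"
    unfolding perm_group_def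
  proof (intro conjI ballI)
    show "id \<in> ?S" using gpD(2)[OF perm_group_PLc] pl2_id by (auto intro!: bexI[of _ id])
    fix f assume "f \<in> ?S"
    then have f: "f \<in> Homeo" "pl2 f" "\<And>x. \<exists>h\<in>PLc UNIV. \<forall>\<^sub>F y in nhds x. h y = f y" by blast+
    have "\<exists>h\<in>PLc UNIV. \<forall>\<^sub>F y in nhds x. h y = iv f y" for x
    proof -
      obtain h where h: "h \<in> PLc UNIV" "\<forall>\<^sub>F y in nhds (iv f x). h y = f y" using f(3) by blast
      have "\<forall>\<^sub>F z in nhds x. h (iv f z) = f (iv f z)"
        by (rule eventually_compose_filterlim[OF h(2) isCont_nhds[OF Homeo_cont[OF Homeo_iv[OF f(1)]]]])
      then have "\<forall>\<^sub>F z in nhds x. iv h z = iv f z"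
      proof eventually_elim
        case (elim z)
        show ?case by (rule iv_eqI[OF PLc_Homeo[OF h(1)]]) (simp add: elim f_iv[OF f(1)])
      qed
      then show ?thesis using gpD(4)[OF perm_group_PLc h(1)] by blast
    qed
    then show "iv f \<in> ?S" using f(1,2) pl2_iv by simp
    fix g assume "g \<in> ?S"
    then have g: "g \<in> Homeo" "pl2 g" "\<And>x. \<exists>h\<in>PLc UNIV. \<forall>\<^sub>F y in nhds x. h y = g y" by blast+
    have "\<exists>h\<in>PLc UNIV. \<forall>\<^sub>F y in nhds x. h y = (f \<circ> g) y" for x
    proof -
      obtain h where h: "h \<in> PLc UNIV" "\<forall>\<^sub>F y in nhds (g x). h y = f y" using f(3) by blast
      obtain h' where h': "h' \<in> PLc UNIV" "\<forall>\<^sub>F y in nhds x. h' y = g y" using g(3) by blast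
      have "\<forall>\<^sub>F z in nhds x. h (g z) = f (g z)"
        by (rule eventually_compose_filterlim[OF h(2) isCont_nhds[OF Homeo_cont[OF g(1)]]])
      then have "\<forall>\<^sub>F z in nhds x. (h \<circ> h') z = (f \<circ> g) z" using h'(2) by eventually_elim simp
      then show ?thesis using gpD(3)[OF perm_group_PLc h(1) h'(1)] by blast
    qed
    then show "f \<circ> g \<in> ?S" using f(1,2) g(1,2) pl2_comp Homeo_comp by blast
  qed auto
  moreover have "gen \<rho> k \<nu> \<in> ?S" if "k \<in> half_ints" "\<nu> \<in> {nu1 c0, \<nu>2, \<nu>3}" for k \<nu>
    using gen_Homeo[OF that(1) unit_homeos_PLc[OF gens_PLc[OF that(2)]]] gen_pl2[OF that(1) gens_PLc[OF that(2)]]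
      gen_local_PLc[OF that(1) gens_PLc[OF that(2)]] by blast
  ultimately have "f \<in> ?S" using Grho_induct[of ?S] assms by blast
  then show "pl2 f" "\<exists>h\<in>PLc UNIV. \<forall>\<^sub>F y in nhds x. h y = f y" by blast+
qed

section \<open>Recurrence and reversal of words\<close>

lemma lab_Ints:
  assumes "k \<in> half_ints" "\<rho> k \<in> {La, La_inv}" shows "k \<in> \<int>"
  using lab assms unfolding labelling_def by (metis DiffI insertE letter.distinct singletonD)

lemma lab_zero: "\<rho> 0 \<in> {La, La_inv}"
  using lab unfolding labelling_def by (metis Ints_0)

lemma block_set:
  assumes "k \<in> half_ints" "\<bar>k\<bar> \<le> real m"
  obtains i where "i \<le> 4 * m" "k = - real m + real i / 2"
proof -
  obtain n :: int where n: "k = of_int n / 2" using assms(1) by (auto simp: half_ints_iff)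
  have "\<bar>real_of_int n\<bar> \<le> 2 * real m" using assms(2) n by simp
  then have "- 2 * int m \<le> n" "n \<le> 2 * int m" by linarith+
  then show ?thesis
    by (intro that[of "nat (n + 2 * int m)"]) (auto simp: n add_divide_distrib)
qed

text \<open>The first axiom of quasi-periodicity finds the central word in every window of bounded
  length. Windows start at the first integer from \<open>z\<close> on, so \<open>R\<close> is the
  window length plus 1 for rounding.\<close>

lemma recurrence:
  fixes m :: nat
  shows "\<exists>R>0. \<forall>z. \<exists>d::int. z \<le> of_int d - real m \<and> of_int d + real m \<le> z + R \<and>
    matches \<rho> {- real m..real m} (\<lambda>x. 1 * x + of_int d)"
proof -
  let ?X = "{- real m + of_nat i / 2 | i. i \<le> 4 * m}"
  have "is_block ?X" unfolding is_block_def by (intro bexI[of _ "- real m"] exI[of _ "4 * m"]) auto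
  then obtain N :: nat where N: "\<And>Y. is_block Y \<Longrightarrow> card Y \<ge> N \<Longrightarrow> sublist (word \<rho> ?X) (word \<rho> Y)"
    using qp unfolding quasi_periodic_def by blast
  have "\<exists>d::int. z \<le> of_int d - real m \<and> of_int d + real m \<le> z + (real N / 2 + 1) \<and>
    matches \<rho> {- real m..real m} (\<lambda>x. 1 * x + of_int d)" for z
  proof -
    define k where "k = real_of_int \<lceil>z\<rceil>"
    have k: "z \<le> k" "k \<le> z + 1" "k \<in> \<int>" by (auto simp: k_def)
    let ?Y = "{k + of_nat i / 2 | i. i \<le> N}"
    have "is_block ?Y" unfolding is_block_def using k(3) by (intro bexI[of _ k] exI[of _ N]) auto
    moreover have "?Y = (\<lambda>i. k + real i / 2) ` {..N}" by auto
    then have "card ?Y = Suc N" by (simp add: card_image inj_on_def)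
    ultimately have "sublist (word \<rho> ?X) (word \<rho> ?Y)" using N by simp
    then obtain ps ss where w: "word \<rho> ?Y = ps @ word \<rho> ?X @ ss" by (auto simp: sublist_def)
    let ?p = "length ps"
    have len: "length (word \<rho> ?X) = Suc (4 * m)" "length (word \<rho> ?Y) = Suc N"
      unfolding word_block by (simp_all del: upt_Suc)
    then have lenp: "?p + 4 * m \<le> N" using arg_cong[OF w, of length] by simp
    have eq: "\<rho> (- real m + real i / 2) = \<rho> (k + real (?p + i) / 2)" if "i \<le> 4 * m" for i
    proof -
      have "word \<rho> ?Y ! (?p + i) = word \<rho> ?X ! i"
        unfolding w using that len(1) by (simp add: nth_append)
      moreover have "word \<rho> ?Y ! (?p + i) = \<rho> (k + real (?p + i) / 2)"
        unfolding word_block using that lenp by (subst nth_map) (auto simp del: upt_Suc)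
      moreover have "word \<rho> ?X ! i = \<rho> (- real m + real i / 2)"
        unfolding word_block using that by (subst nth_map) (auto simp del: upt_Suc)
      ultimately show ?thesis by simp
    qed
    define d where "d = k + real ?p / 2 + real m"
    have eq': "\<rho> (j + d) = \<rho> j" if j: "j \<in> half_ints" "\<bar>j\<bar> \<le> real m" for j
    proof -
      obtain i where i: "i \<le> 4 * m" "j = - real m + real i / 2" using block_set[OF j] .
      have "j + d = k + real (?p + i) / 2" unfolding d_def i(2) by (simp add: add_divide_distrib)
      then show ?thesis using eq[OF i(1)] i(2) by simp
    qed
    have "d \<in> half_ints"
    proof -
      have "2 * d = 2 * k + real ?p + 2 * real m" by (simp add: d_def)
      also have "\<dots> \<in> \<int>" using k(3) by (intro Ints_add Ints_mult) auto
      finally show ?thesis by (simp add: half_ints_def)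
    qed
    \<comment> \<open>A shift by a proper half-integer would put the a-letter of position 0 on a
      b-position.\<close>
    then have "d \<in> \<int>" using lab_Ints[of d] eq'[of 0] lab_zero by simp
    then obtain n where n: "d = of_int n" by (auto elim: Ints_cases)
    have "matches \<rho> {- real m..real m} (\<lambda>x. 1 * x + of_int n)"
      unfolding matches_def slope_affine
    proof
      fix j assume "j \<in> {- real m..real m} \<inter> half_ints"
      then have "\<rho> (j + d) = \<rho> j" by (intro eq') auto
      then show "letter_sign \<rho> (1 * j + of_int n) = 1 * letter_sign \<rho> j"
        by (simp add: letter_sign_def n)
    qed
    moreover have "z \<le> of_int n - real m" using k unfolding n[symmetric] d_def by simp
    moreover have "real ?p + 4 * real m \<le> real N" using lenp by linarith
    then have "of_int n + real m \<le> z + (real N / 2 + 1)" using k unfolding n[symmetric] d_def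
      by simp
    ultimately show ?thesis by blast
  qed
  then show ?thesis by (intro exI[of _ "real N / 2 + 1"]) auto
qed

text \<open>An occurrence of the inverse word is a reflection about \<open>of_int c / 2\<close> that
  negates signs. The letter type at position 0 again makes \<open>c\<close> an integer.\<close>

lemma reflection:
  fixes m :: nat
  shows "\<exists>c::int. \<forall>k\<in>half_ints. \<bar>k\<bar> \<le> real m \<longrightarrow> letter_sign \<rho> (of_int c - k) = - letter_sign \<rho> k"
proof -
  let ?X = "{- real m + of_nat i / 2 | i. i \<le> 4 * m}"
  have "is_block ?X" unfolding is_block_def by (intro bexI[of _ "- real m"] exI[of _ "4 * m"]) auto
  then obtain Y where Y: "is_block Y" "word \<rho> Y = inverse_word (word \<rho> ?X)"
    using qp unfolding quasi_periodic_def by blast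
  obtain k n where k: "k \<in> half_ints" "Y = {k + of_nat i / 2 | i. i \<le> n}" using Y(1)
    unfolding is_block_def by blast
  have len: "length (word \<rho> ?X) = Suc (4 * m)" "length (word \<rho> Y) = Suc n"
    unfolding k(2) word_block by (simp_all del: upt_Suc)
  then have n: "n = 4 * m" using Y(2) by (simp add: inverse_word_def)
  define c where "c = k + real m"
  have eq: "\<rho> (c - j) = letter_inv (\<rho> j)" if j: "j \<in> half_ints" "\<bar>j\<bar> \<le> real m" for j
  proof -
    obtain i where i: "i \<le> 4 * m" "j = - real m + real i / 2" using block_set[OF j] .
    let ?l = "4 * m - i"
    have l: "?l < Suc n" "real ?l = 4 * real m - real i" using i(1) n by auto
    have "word \<rho> Y ! ?l = \<rho> (k + real ?l / 2)"
      unfolding k(2) word_block using l by (subst nth_map) (auto simp del: upt_Suc)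
    also have "k + real ?l / 2 = c - j" unfolding c_def i(2) l(2) by (simp add: field_simps)
    finally have 1: "word \<rho> Y ! ?l = \<rho> (c - j)" .
    have "inverse_word (word \<rho> ?X) ! ?l = letter_inv (word \<rho> ?X ! i)"
      unfolding inverse_word_def using len(1) i(1) by (simp add: rev_nth)
    also have "word \<rho> ?X ! i = \<rho> j"
      unfolding word_block i(2) using i(1) by (subst nth_map) (auto simp del: upt_Suc)
    finally show ?thesis using 1 Y(2) by simp
  qed
  have "\<rho> c = letter_inv (\<rho> 0)" using eq[of 0] by simp
  then have "\<rho> c \<in> {La, La_inv}" using lab_zero by auto
  moreover have "2 * c = 2 * k + 2 * real m" by (simp add: c_def)
  then have "c \<in> half_ints" using k(1) by (auto simp: half_ints_def)
  ultimately obtain d where "c = of_int d" using lab_Ints Ints_cases by metis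
  then show ?thesis using eq letter_sign_letter_inv by blast
qed

text \<open>
  In a periodic labelling, reading a long block backwards would give a reflection that fixes
  the position of some letter, which then equals its own inverse.
\<close>

lemma not_periodic:
  fixes d :: int
  assumes "d \<noteq> 0" shows "\<exists>k\<in>half_ints. letter_sign \<rho> (k + of_int d) \<noteq> letter_sign \<rho> k"
proof (rule ccontr)
  assume "\<not> ?thesis"
  then have p: "letter_sign \<rho> (k + of_int d) = letter_sign \<rho> k" if "k \<in> half_ints" for k using that
    by blast
  have h: "k + of_int i \<in> half_ints" if "k \<in> half_ints" for k i
    using that by (auto simp: half_ints_def distrib_left)
  have q: "letter_sign \<rho> (k + of_int (j * d)) = letter_sign \<rho> k" if "k \<in> half_ints" for k j
  proof (induction j rule: int_induct[where k = 0])
    case (step1 i)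
    then show ?case using p[OF h[OF that, of "i * d"]] by (simp add: algebra_simps)
  next
    case (step2 i)
    then show ?case using p[OF h[OF that, of "(i - 1) * d"]] by (simp add: algebra_simps)
  qed simp
  obtain c :: int
    where c: "\<And>k. k \<in> half_ints \<Longrightarrow> \<bar>k\<bar> \<le> real (nat \<bar>d\<bar>) \<Longrightarrow> letter_sign \<rho> (of_int c - k) = - letter_sign \<rho> k"
    using reflection by blast
  \<comment> \<open>Twice \<open>?t\<close> is congruent to \<open>c\<close> modulo
    \<open>d\<close>, so reflecting \<open>?t\<close> moves it by a multiple of the period: up to
    the period, \<open>?t\<close> is a centre of reflection.\<close>
  let ?t = "of_int (c mod d) / 2 :: real"
  have t: "?t \<in> half_ints" unfolding half_ints_iff by blast
  have "\<bar>c mod d\<bar> \<le> \<bar>d\<bar>" using abs_mod_less[OF assms] by (simp add: less_imp_le)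
  then have "\<bar>real_of_int (c mod d)\<bar> \<le> real_of_int \<bar>d\<bar>" by linarith
  then have "\<bar>?t\<bar> \<le> real (nat \<bar>d\<bar>)" by simp
  then have "letter_sign \<rho> (of_int c - ?t) = - letter_sign \<rho> ?t" by (rule c[OF t])
  moreover have "real_of_int c = of_int (c div d * d) + of_int (c mod d)"
    using div_mult_mod_eq[of c d] by (metis of_int_add)
  then have "of_int c - ?t = ?t + of_int (c div d * d)" by simp
  ultimately show False using q[OF t, of "c div d"] letter_sign_nz(2) by metis
qed

section \<open>Occurrences of the central block are far apart\<close>

definition occs :: "real \<Rightarrow> (real \<Rightarrow> real) set" where
  "occs m = {\<sigma>. isom \<sigma> \<and> matches \<rho> {- m..m} \<sigma>}"

lemma occs_mono: "m \<le> m' \<Longrightarrow> occs m' \<subseteq> occs m"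
  unfolding occs_def using matches_mono[of \<rho> "{- m'..m'}" _ "{- m..m}"] by auto

text \<open>Two close occurrences differ by an isometry \<open>\<kappa>\<close> that respects signs
  near 0 and moves 0 little. As a translation it is one of finitely many, each with a bad position
  by \<open>not_periodic\<close>; as a reflection it fixes a letter position.\<close>

lemma sparse: "\<exists>m. \<forall>\<sigma>\<in>occs m. \<forall>\<tau>\<in>occs m. \<sigma> \<noteq> \<tau> \<longrightarrow> L < \<bar>\<sigma> 0 - \<tau> 0\<bar>"
proof -
  let ?D = "{d::int. d \<noteq> 0 \<and> \<bar>real_of_int d\<bar> \<le> L}"
  have "?D \<subseteq> {- \<lceil>L\<rceil>..\<lceil>L\<rceil>}" by (auto simp: abs_le_iff) linarith+
  then have fin: "finite ?D" by (rule finite_subset) simp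
  obtain kd
    where kd: "\<And>d. d \<in> ?D \<Longrightarrow> kd d \<in> half_ints \<and> letter_sign \<rho> (kd d + of_int d) \<noteq> letter_sign \<rho> (kd d)"
    using not_periodic by (metis (mono_tags, lifting) mem_Collect_eq)
  define K where "K = (\<Sum>d\<in>?D. \<bar>kd d\<bar>)"
  have K: "\<bar>kd d\<bar> \<le> K" if "d \<in> ?D" for d unfolding K_def by (rule member_le_sum[OF that _ fin]) auto
  have K0: "0 \<le> K" unfolding K_def by (rule sum_nonneg) auto
  \<comment> \<open>\<open>K\<close> covers a bad position for every short translation. One summand
    \<open>\<bar>L\<bar>\<close> covers the centre of a reflection, the other the shift by at most
    \<open>L\<close> that \<open>\<kappa>\<close> makes.\<close>
  let ?m = "K + 2 * \<bar>L\<bar>"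
  have "L < \<bar>\<sigma> 0 - \<tau> 0\<bar>" if st: "\<sigma> \<in> occs ?m" "\<tau> \<in> occs ?m" "\<sigma> \<noteq> \<tau>" for \<sigma> \<tau>
  proof (rule ccontr)
    assume "\<not> ?thesis"
    then have le: "\<bar>\<sigma> 0 - \<tau> 0\<bar> \<le> L" by simp
    have L: "0 \<le> L" using le by linarith
    have i: "isom \<sigma>" "isom \<tau>" "matches \<rho> {- ?m..?m} \<sigma>" "matches \<rho> {- ?m..?m} \<tau>" using st
      by (auto simp: occs_def)
    define \<kappa> where "\<kappa> = iv \<tau> \<circ> \<sigma>"
    have k: "isom \<kappa>" "slope \<kappa> = slope \<tau> * slope \<sigma>" unfolding \<kappa>_def
      using isom_comp[OF isom_iv(1)[OF i(2)] i(1)] isom_iv(2)[OF i(2)] by auto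
    have tk: "\<tau> (\<kappa> x) = \<sigma> x" for x by (simp add: \<kappa>_def isom_f_iv[OF i(2)])
    have k0: "\<bar>\<kappa> 0\<bar> \<le> L" using isom_dist[OF i(2), of "\<kappa> 0" 0] le by (simp add: tk)
    have mk: "letter_sign \<rho> (\<kappa> x) = slope \<kappa> * letter_sign \<rho> x" if x: "x \<in> half_ints" "\<bar>x\<bar> \<le> K + L"
      for x
    proof -
      have "\<bar>\<kappa> x - \<kappa> 0\<bar> = \<bar>x\<bar>" using isom_dist[OF k(1), of x 0] by simp
      then have "\<bar>\<kappa> x\<bar> \<le> ?m" using k0 x(2) L by linarith
      then have "\<kappa> x \<in> {- ?m..?m}" by (simp add: abs_le_iff)
      moreover have "\<kappa> x \<in> half_ints" using isom_half[OF k(1)] x(1) by simp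
      ultimately have 1: "letter_sign \<rho> (\<sigma> x) = slope \<tau> * letter_sign \<rho> (\<kappa> x)"
        using i(4)[unfolded matches_def, rule_format, of "\<kappa> x"] unfolding tk by blast
      have "\<bar>x\<bar> \<le> ?m" using x(2) L by simp
      then have "letter_sign \<rho> (\<sigma> x) = slope \<sigma> * letter_sign \<rho> x" using i(3) x(1)
        by (auto simp: matches_def abs_le_iff)
      then have "slope \<tau> * letter_sign \<rho> (\<kappa> x) = slope \<sigma> * letter_sign \<rho> x" using 1 by simp
      then show ?thesis using slope_cases[OF i(2)] k(2) by auto
    qed
    obtain d where d: "slope \<kappa> \<in> {1,-1}" "\<kappa> = (\<lambda>x. slope \<kappa> * x + of_int d)" using isoE[OF k(1)] .
    have kx: "\<kappa> x = slope \<kappa> * x + of_int d" for x using d(2) by metis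
    have dL: "\<bar>real_of_int d\<bar> \<le> L" using k0 kx[of 0] by simp
    show False
    proof (cases "slope \<kappa> = 1")
      case True
      have "d \<noteq> 0"
      proof
        assume "d = 0"
        then have "\<sigma> x = \<tau> x" for x using tk[of x] kx[of x] True by simp
        then show False using st(3) by blast
      qed
      then have dD: "d \<in> ?D" using dL by simp
      have "\<bar>kd d\<bar> \<le> K + L" using K[OF dD] L by simp
      then show False using mk[of "kd d"] kd[OF dD] kx[of "kd d"] True by simp
    next
      case False
      then have s: "slope \<kappa> = -1" using d(1) by simp
      \<comment> \<open>The centre of the reflection, at which a sign would equal its own
        negative.\<close>
      let ?t = "of_int d / 2 :: real"
      have "?t \<in> half_ints" unfolding half_ints_iff by blast
      moreover have "\<bar>?t\<bar> \<le> K + L" using dL L K0 by simp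
      ultimately show False using mk[of ?t] kx[of ?t] s by simp
    qed
  qed
  then show ?thesis by blast
qed

end

section \<open>Products of commutators as products of conjugates\<close>

lemma disjoint_commute:
  assumes "f \<in> Homeo" "g \<in> Homeo" "\<And>x. x \<notin> X \<Longrightarrow> f x = x" "\<And>x. x \<notin> Y \<Longrightarrow> g x = x" "X \<inter> Y = {}"
  shows "f (g x) = g (f x)"
proof -
  have f: "f z \<in> X" if "z \<in> X" "f z \<noteq> z" for z
    using assms(3)[of "f z"] Homeo_inj[OF assms(1), of "f z" z] that by auto
  have g: "g z \<in> Y" if "z \<in> Y" "g z \<noteq> z" for z
    using assms(4)[of "g z"] Homeo_inj[OF assms(2), of "g z" z] that by auto
  consider "f x \<noteq> x" | "g x \<noteq> x" | "f x = x" "g x = x" by blast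
  then show ?thesis
  proof cases
    case 1
    then have "x \<in> X" "f x \<in> X" using assms(3) f by blast+
    then have "g x = x" "g (f x) = f x" using assms(4,5) by blast+
    then show ?thesis by simp
  next
    case 2
    then have "x \<in> Y" "g x \<in> Y" using assms(4) g by blast+
    then have "f x = x" "f (g x) = g x" using assms(3,5) by blast+
    then show ?thesis by simp
  qed simp
qed

lemma commt_fix:
  assumes "a \<in> Homeo" "b \<in> Homeo" "a x = x" "b x = x" shows "commt a b x = x"
  using assms by (simp add: commt_def iv_fix)

lemma cprod_fix:
  assumes "f \<in> cprod {a \<in> S. \<forall>x. x \<notin> C \<longrightarrow> a x = x}" "S \<subseteq> Homeo" "x \<notin> C"
  shows "f x = x"
  using assms(1)
proof (induction rule: cprod.induct)
  case (cprod_step a b f)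
  then have "commt a b x = x" using assms(2,3) by (intro commt_fix) auto
  then show ?case using cprod_step.IH by simp
qed simp

lemma commt_comp_commuting:
  assumes H: "a \<in> Homeo" "b \<in> Homeo" "a' \<in> Homeo" "b' \<in> Homeo"
    and X: "\<And>x. x \<notin> X \<Longrightarrow> a' x = x" "\<And>x. x \<notin> X \<Longrightarrow> b' x = x"
    and Y: "\<And>x. x \<notin> Y \<Longrightarrow> a x = x" "\<And>x. x \<notin> Y \<Longrightarrow> b x = x" and XY: "X \<inter> Y = {}"
  shows "commt (a' \<circ> a) (b' \<circ> b) = commt a' b' \<circ> commt a b"
proof -
  have c: "y (z x) = z (y x)" if y: "y \<in> {a, b, iv a, iv b}" and z: "z \<in> {a', b', iv a', iv b'}"
    for y z x
  proof (rule disjoint_commute)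
    show "y \<in> Homeo" "z \<in> Homeo" using y z H by auto
    show "y w = w" if "w \<notin> Y" for w using y Y[OF that] H iv_fix[of a w] iv_fix[of b w] by auto
    show "z w = w" if "w \<notin> X" for w using z X[OF that] H iv_fix[of a' w] iv_fix[of b' w] by auto
    show "Y \<inter> X = {}" using XY by blast
  qed
  have r: "a (b' x) = b' (a x)" "b (iv a' x) = iv a' (b x)" "iv a (iv a' x) = iv a' (iv a x)"
    "b (iv b' x) = iv b' (b x)" "iv a (iv b' x) = iv b' (iv a x)" "iv b (iv b' x) = iv b' (iv b x)"
    "a (iv a' x) = iv a' (a x)" "a (iv b' x) = iv b' (a x)" for x
    by (rule c; simp)+
  show ?thesis
    using H by (simp add: commt_def fun_eq_iff iv_comp r)
qed

text \<open>
  If \<open>t\<close> moves \<open>C\<close> off itself forever, a product of any number of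
  commutators supported in \<open>C\<close> is a product of two commutators: spread the factors
  over the translates of \<open>C\<close> under powers of \<open>t\<close>, which turns them
  into one commutator, and correct by a commutator with \<open>t\<close>.
\<close>

lemma shift_trick:
  assumes S: "perm_group S" and t: "t \<in> S" and CC: "C \<inter> C' = {}" "\<And>x. x \<in> C \<union> C' \<Longrightarrow> t x \<in> C'"
    and f: "f \<in> cprod {a \<in> S. \<forall>x. x \<notin> C \<longrightarrow> a x = x}"
  shows "\<exists>\<psi>\<in>S. \<exists>a\<in>S. \<exists>b\<in>S. (\<forall>x. x \<notin> C' \<longrightarrow> a x = x \<and> b x = x) \<and> f = commt \<psi> t \<circ> commt a b"
  using f
proof (induction rule: cprod.induct)
  case cprod_id
  have tH: "t \<in> Homeo" using gpD(1)[OF S t] .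
  have "id = commt id t \<circ> commt id id" using tH by (auto simp: commt_def fun_eq_iff f_iv inv_id)
  then have *: "(\<forall>x. x \<notin> C' \<longrightarrow> id x = x \<and> id x = x) \<and> id = commt id t \<circ> commt id id"
    by (intro conjI allI impI id_apply)
  show ?case
    by (rule bexI[where x = id], rule bexI[where x = id], rule bexI[where x = id], rule *) (rule gpD(2)[OF S])+
next
  case (cprod_step a0 b0 f)
  then obtain \<psi> a b where IH: "\<psi> \<in> S" "a \<in> S" "b \<in> S" "\<And>x. x \<notin> C' \<Longrightarrow> a x = x" "\<And>x. x \<notin> C' \<Longrightarrow> b x = x"
    "f = commt \<psi> t \<circ> commt a b" by blast
  have S0: "a0 \<in> S" "b0 \<in> S" "\<And>x. x \<notin> C \<Longrightarrow> a0 x = x" "\<And>x. x \<notin> C \<Longrightarrow> b0 x = x"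
    using cprod_step by auto
  note H = gpD(1)[OF S]
  have Hs: "t \<in> Homeo" "\<psi> \<in> Homeo" "a \<in> Homeo" "b \<in> Homeo" "a0 \<in> Homeo" "b0 \<in> Homeo" using H t IH S0
    by auto
  let ?c = "commt a b" and ?dd = "commt a0 b0"
  have cS: "?c \<in> S" "?dd \<in> S" "commt \<psi> t \<in> S" using perm_group_commt[OF S] IH S0 t by auto
  have fS: "f \<in> S" using IH(6) gpD(3)[OF S cS(3,1)] by simp
  have cH: "?c \<in> Homeo" "?dd \<in> Homeo" "f \<in> Homeo" using cS fS H by auto
  have ff: "f x = x" if "x \<notin> C" for x
    using cprod_fix[OF cprod_step(3) _ that] H by blast
  have cf: "?c x = x" if "x \<notin> C'" for x using commt_fix Hs IH(4,5) that by blast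
  have comm: "f (iv ?c x) = iv ?c (f x)" for x
    by (rule disjoint_commute[OF cH(3) Homeo_iv[OF cH(1)] ff _ CC(1)]) (use cf iv_fix[OF cH(1)] in auto)
  let ?f = "?dd \<circ> f"
  \<comment> \<open>Conjugation by \<open>t\<close> carries the accumulated entries and the new ones
    together into \<open>C'\<close>. This \<open>?\<psi>\<close> is chosen so that
    \<open>commt ?\<psi> t\<close> equals \<open>?f\<close> followed by cancellation of exactly
    \<open>commt ?a ?b\<close>; it uses that \<open>f\<close>, supported in \<open>C\<close>,
    commutes with \<open>?c\<close>, supported in \<open>C'\<close>.\<close>
  let ?\<psi> = "?f \<circ> (t \<circ> \<psi> \<circ> iv t)"
  let ?a = "t \<circ> (a0 \<circ> a) \<circ> iv t" and ?b = "t \<circ> (b0 \<circ> b) \<circ> iv t"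
  have bt: "bij t" using Hs(1) by (rule Homeo_bij)
  have "commt ?a ?b = t \<circ> commt (a0 \<circ> a) (b0 \<circ> b) \<circ> iv t"
    using commt_conj[OF bt, of "a0 \<circ> a" "b0 \<circ> b"] Hs by simp
  also have "commt (a0 \<circ> a) (b0 \<circ> b) = ?dd \<circ> ?c"
    by (rule commt_comp_commuting[OF Hs(3-6) S0(3,4) IH(4,5) CC(1)])
  finally have cab: "commt ?a ?b = t \<circ> (?dd \<circ> ?c) \<circ> iv t" .
  have e1: "commt \<psi> t = f \<circ> iv ?c" using IH(6) cH(1) by (auto simp: fun_eq_iff f_iv)
  have "commt ?\<psi> t = ?f \<circ> t \<circ> commt \<psi> t \<circ> iv ?f \<circ> iv t"
    using Hs cH by (simp add: commt_def[of "?\<psi>"] commt_def[of \<psi>] iv_comp fun_eq_iff)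
  also have "\<dots> = ?f \<circ> t \<circ> iv ?c \<circ> iv ?dd \<circ> iv t"
    unfolding e1 using cH by (simp add: iv_comp fun_eq_iff comm f_iv)
  finally have "commt ?\<psi> t \<circ> commt ?a ?b = ?f"
    unfolding cab using Hs cH by (auto simp: fun_eq_iff f_iv)
  moreover have "?f \<in> S" "t \<circ> \<psi> \<circ> iv t \<in> S" "?a \<in> S" "?b \<in> S"
    using gpD(3,4)[OF S] cS fS t IH S0 by auto
  moreover from this have "?\<psi> \<in> S" using gpD(3)[OF S] by blast
  moreover have "?a x = x \<and> ?b x = x" if "x \<notin> C'" for x
  proof -
    have "iv t x \<notin> C \<union> C'" using CC(2)[of "iv t x"] that f_iv[OF Hs(1)] by auto
    then show ?thesis using S0(3,4) IH(4,5) f_iv[OF Hs(1)] by simp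
  qed
  ultimately show ?case by (metis (no_types, lifting))
qed

section \<open>Maps supported in finitely many disjoint intervals\<close>

definition ivls :: "(real \<times> real) set \<Rightarrow> real set" where
  "ivls \<A> = {x. \<exists>u v. (u,v) \<in> \<A> \<and> u < x \<and> x < v}"

text \<open>Dyadic ends allow maps to be cut there without leaving \<open>pl2\<close>.\<close>

definition disjoint_ivls :: "(real \<times> real) set \<Rightarrow> bool" where
  "disjoint_ivls \<A> \<longleftrightarrow> (\<forall>u v. (u,v) \<in> \<A> \<longrightarrow> u < v \<and> u \<in> dyadic \<and> v \<in> dyadic) \<and>
     (\<forall>u v u' v' x. (u,v) \<in> \<A> \<longrightarrow> (u',v') \<in> \<A> \<longrightarrow> u < x \<longrightarrow> x < v \<longrightarrow> u' < x \<longrightarrow> x < v' \<longrightarrow>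
        u = u' \<and> v = v')"

lemma disD:
  assumes "disjoint_ivls \<A>" "(u,v) \<in> \<A>"
  shows "u < v" "u \<in> dyadic" "v \<in> dyadic"
  using assms unfolding disjoint_ivls_def by blast+

lemma disjoint_ivls_eq:
  "disjoint_ivls \<A> \<Longrightarrow> (u,v) \<in> \<A> \<Longrightarrow> (u',v') \<in> \<A> \<Longrightarrow> u < x \<Longrightarrow> x < v \<Longrightarrow> u' < x \<Longrightarrow> x < v' \<Longrightarrow> u = u' \<and> v = v'"
  unfolding disjoint_ivls_def by blast

lemma disjoint_ivls_sub: "disjoint_ivls \<A> \<Longrightarrow> \<A>' \<subseteq> \<A> \<Longrightarrow> disjoint_ivls \<A>'"
  unfolding disjoint_ivls_def by blast

lemma disjoint_ivls_endpoints:
  assumes "disjoint_ivls \<A>" "(u,v) \<in> \<A>" shows "u \<notin> ivls \<A>" "v \<notin> ivls \<A>"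
proof -
  have uv: "u < v" by (rule disD[OF assms])
  show "u \<notin> ivls \<A>"
  proof
    assume "u \<in> ivls \<A>"
    then obtain u' v' where a: "(u',v') \<in> \<A>" "u' < u" "u < v'" unfolding ivls_def by blast
    obtain x where "u < x" "x < min v v'" using dense[of u "min v v'"] uv a by auto
    then show False using disjoint_ivls_eq[OF assms a(1), of x] a by auto
  qed
  show "v \<notin> ivls \<A>"
  proof
    assume "v \<in> ivls \<A>"
    then obtain u' v' where a: "(u',v') \<in> \<A>" "u' < v" "v < v'" unfolding ivls_def by blast
    obtain x where "max u u' < x" "x < v" using dense[of "max u u'" v] uv a by auto
    then show False using disjoint_ivls_eq[OF assms a(1), of x] a by auto
  qed
qed

lemma ivls_insert: "ivls (insert (u,v) \<A>) = {u<..<v} \<union> ivls \<A>"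
  unfolding ivls_def by (rule Set.set_eqI, simp, blast)

lemma ivls_member: "(u,v) \<in> \<A> \<Longrightarrow> {u<..<v} \<subseteq> ivls \<A>"
  unfolding ivls_def by (intro subsetI CollectI exI[of _ u] exI[of _ v]) auto

lemma cut_local_PLc:
  assumes "h \<in> Homeo" "pl2 h" "u < v" "u \<in> dyadic" "v \<in> dyadic" "h u = u" "h v = v"
    and "u < c" "c' < v" "\<And>x. u < x \<Longrightarrow> x < v \<Longrightarrow> x < c \<or> c' < x \<Longrightarrow> h x = x"
  shows "cut h u v \<in> PLc {u<..<v}"
proof -
  have "cut h u v x = x" if "x \<notin> {c..c'}" for x
    using assms(6,7) assms(10)[of x] that by (cases "x = u"; cases "x = v") (auto simp: cut_def)
  moreover have "{c..c'} \<subseteq> {u<..<v}" using assms by auto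
  ultimately show ?thesis
    using cut_Homeo[OF assms(1,6,7)] cut_pl2[OF assms(2-7)] unfolding PLc_def
    by (intro CollectI conjI exI[of _ "{c..c'}"]) auto
qed

text \<open>The support avoids \<open>u\<close> and \<open>v\<close>, so \<open>h\<close> fixes both
  and preserves the interval between them; its restriction can be split off as a factor.\<close>

lemma PLc_split:
  assumes "disjoint_ivls (insert (u,v) \<A>)" "(u,v) \<notin> \<A>" "h \<in> PLc (ivls (insert (u,v) \<A>))"
  shows "\<exists>h1\<in>PLc {u<..<v}. \<exists>h2\<in>PLc (ivls \<A>). h = h1 \<circ> h2"
proof -
  let ?O = "ivls (insert (u,v) \<A>)"
  note m = disD[OF assms(1) insertI1]
  note e = disjoint_ivls_endpoints[OF assms(1) insertI1]
  obtain C where C: "compact C" "C \<subseteq> ?O" "\<And>x. x \<notin> C \<Longrightarrow> h x = x" "h \<in> Homeo" "pl2 h"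
    using assms(3) by (auto simp: PLc_def)
  have fix_uv: "h u = u" "h v = v" using C(2,3) e by blast+
  obtain c c' where c: "u < c" "c' < v" "\<And>x. x \<in> C \<Longrightarrow> u < x \<Longrightarrow> x < v \<Longrightarrow> c \<le> x \<and> x \<le> c'"
    using compact_hull[OF C(1,2) m(1) e] by metis
  let ?h1 = "cut h u v"
  have h1: "?h1 \<in> PLc {u<..<v}"
    by (rule cut_local_PLc[OF C(4,5) m fix_uv c(1,2)]) (use c(3) C(3) in force)
  then have h1H: "?h1 \<in> Homeo" by (rule PLc_Homeo)
  let ?h2 = "iv ?h1 \<circ> h"
  have io: "u < h x \<and> h x < v \<longleftrightarrow> u < x \<and> x < v" for x
    using Homeo_less[OF C(4), of u x] Homeo_less[OF C(4), of x v] fix_uv by simp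
  have h2x: "?h2 x = (if u < x \<and> x < v then x else h x)" for x
  proof (cases "u < x \<and> x < v")
    case True
    then have "?h1 x = h x" by (simp add: cut_def)
    then show ?thesis using True iv_eqI[OF h1H, of x "h x"] by simp
  next
    case False
    then have "?h1 (h x) = h x" using io[of x] PLc_fix[OF h1, of "h x"] by auto
    then have "iv ?h1 (h x) = h x" by (rule iv_fix[OF h1H])
    then show ?thesis unfolding if_not_P[OF False] o_apply .
  qed
  have "?h2 \<in> PLc (ivls \<A>)"
    unfolding PLc_def
  proof (intro CollectI conjI exI[of _ "C - {u<..<v}"])
    show "?h2 \<in> Homeo" using h1H C(4) by simp
    show "pl2 ?h2" using h1 C(4,5) by (intro pl2_comp pl2_iv) (auto simp: PLc_def)
    show "compact (C - {u<..<v})" using C(1) by (intro compact_diff) auto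
    show "C - {u<..<v} \<subseteq> ivls \<A>" using C(2) by (auto simp: ivls_insert)
    show "\<forall>x. x \<notin> C - {u<..<v} \<longrightarrow> ?h2 x = x" using C(3) h2x by auto
  qed
  moreover have "h = ?h1 \<circ> ?h2" using h1H by (auto simp: fun_eq_iff f_iv)
  ultimately show ?thesis using h1 by blast
qed

lemma PLc_ivls_induct:
  assumes "finite \<A>" "disjoint_ivls \<A>" "id \<in> S" "\<And>f g. f \<in> S \<Longrightarrow> g \<in> S \<Longrightarrow> f \<circ> g \<in> S"
    and "\<And>u v f. (u,v) \<in> \<A> \<Longrightarrow> f \<in> PLc {u<..<v} \<Longrightarrow> f \<in> S" and "h \<in> PLc (ivls \<A>)"
  shows "h \<in> S"
  using assms(1,2,5,6)
proof (induction \<A> arbitrary: h rule: finite_induct)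
  case empty
  then have "h x = x" for x using PLc_fix[of h "ivls {}" x] by (simp add: ivls_def)
  then have "h = id" by auto
  then show ?case using assms(3) by (simp only:)
next
  case (insert A \<A>)
  obtain u v where A: "A = (u,v)" by (cases A)
  obtain h1 h2 where h: "h1 \<in> PLc {u<..<v}" "h2 \<in> PLc (ivls \<A>)" "h = h1 \<circ> h2"
    using PLc_split[of u v \<A> h] insert A by auto
  have "h1 \<in> S" using insert.prems(2)[of u v] A h(1) by blast
  moreover have "disjoint_ivls \<A>" using insert.prems(1) by (rule disjoint_ivls_sub) blast
  then have "h2 \<in> S" using insert.IH[OF _ _ h(2)] insert.prems(2) by blast
  ultimately show ?case unfolding h(3) using assms(4) by blast
qed

lemma PLc_glue:
  assumes "finite \<A>" "disjoint_ivls \<A>" "\<And>u v. (u,v) \<in> \<A> \<Longrightarrow> t u v \<in> PLc {u<..<v}"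
  shows "\<exists>s\<in>PLc (ivls \<A>). \<forall>u v x. (u,v) \<in> \<A> \<longrightarrow> u < x \<longrightarrow> x < v \<longrightarrow> s x = t u v x"
  using assms
proof (induction \<A> rule: finite_induct)
  case empty
  then show ?case using gpD(2)[OF perm_group_PLc] by blast
next
  case (insert A \<A>)
  obtain u v where A: "A = (u,v)" by (cases A)
  have "disjoint_ivls \<A>" using insert.prems(1) by (rule disjoint_ivls_sub) blast
  then obtain s where s: "s \<in> PLc (ivls \<A>)" "\<And>u v x. (u,v) \<in> \<A> \<Longrightarrow> u < x \<Longrightarrow> x < v \<Longrightarrow> s x = t u v x"
    using insert.IH insert.prems(2) by blast
  have tB: "t u v \<in> PLc {u<..<v}" using insert.prems(2) A by blast
  have "t u v \<in> PLc (ivls (insert A \<A>))" "s \<in> PLc (ivls (insert A \<A>))"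
    using PLc_mono[OF tB] PLc_mono[OF s(1)] unfolding A ivls_insert by blast+
  then have "t u v \<circ> s \<in> PLc (ivls (insert A \<A>))" by (rule gpD(3)[OF perm_group_PLc])
  moreover have "(t u v \<circ> s) x = t u' v' x" if m: "(u',v') \<in> insert A \<A>" "u' < x" "x < v'"
    for u' v' x
  proof (cases "(u',v') = A")
    case True
    have "x \<notin> ivls \<A>"
    proof
      assume "x \<in> ivls \<A>"
      then obtain u'' v'' where "(u'',v'') \<in> \<A>" "u'' < x" "x < v''" unfolding ivls_def by blast
      then show False
        using disjoint_ivls_eq[OF insert.prems(1) m(1), of u'' v'' x] m True insert.hyps by auto
    qed
    then show ?thesis using PLc_fix[OF s(1)] True A by simp
  next
    case False
    then have m': "(u',v') \<in> \<A>" using m by blast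
    have sx: "s x = t u' v' x" by (rule s(2)[OF m' m(2,3)])
    have "u' < s x" "s x < v'"
      using PLc_less[OF insert.prems(2)[OF m(1)]] m sx by auto
    then have "\<not> (u < s x \<and> s x < v)"
      using disjoint_ivls_eq[OF insert.prems(1) m(1), of u v "s x"] A False by auto
    then show ?thesis using PLc_fix[OF tB, of "s x"] sx by auto
  qed
  ultimately show ?case by blast
qed

text \<open>\<open>shift_trick\<close> needs one set that carries all entries; for a finite product
  the union of their compact supports is still compact.\<close>

lemma cprod_common_support:
  assumes "f \<in> cprod (PLc A)"
  shows "\<exists>C. compact C \<and> C \<subseteq> A \<and> f \<in> cprod {a \<in> PLc A. \<forall>x. x \<notin> C \<longrightarrow> a x = x}"
  using assms
proof (induction rule: cprod.induct)
  case cprod_id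
  show ?case by (intro exI[of _ "{}"] conjI cprod.cprod_id) auto
next
  case (cprod_step a b f)
  obtain C where C: "compact C" "C \<subseteq> A" "f \<in> cprod {a \<in> PLc A. \<forall>x. x \<notin> C \<longrightarrow> a x = x}"
    using cprod_step.IH by blast
  obtain C1 C2 where *: "compact C1" "C1 \<subseteq> A" "\<And>x. x \<notin> C1 \<Longrightarrow> a x = x"
    "compact C2" "C2 \<subseteq> A" "\<And>x. x \<notin> C2 \<Longrightarrow> b x = x"
    using cprod_step(1,2) unfolding PLc_def by blast
  let ?C = "C \<union> C1 \<union> C2"
  have "f \<in> cprod {a \<in> PLc A. \<forall>x. x \<notin> ?C \<longrightarrow> a x = x}" by (rule cprod_mono[OF C(3)]) blast
  then have "commt a b \<circ> f \<in> cprod {a \<in> PLc A. \<forall>x. x \<notin> ?C \<longrightarrow> a x = x}"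
    using * cprod_step(1,2) by (intro cprod.cprod_step) auto
  moreover have "compact ?C" using * C(1) by (intro compact_Un)
  ultimately show ?case using * C(2) by (intro exI[of _ ?C]) blast
qed

context labelled_gens
begin

section \<open>Counting conjugates\<close>

inductive conj_prod :: "(real \<Rightarrow> real) \<Rightarrow> nat \<Rightarrow> (real \<Rightarrow> real) \<Rightarrow> bool" for g where
  conj_prod_id: "conj_prod g 0 id"
| conj_prod_step: "s \<in> Grho \<Longrightarrow> e = g \<or> e = iv g \<Longrightarrow> conj_prod g n f \<Longrightarrow> conj_prod g (Suc n) (f \<circ> (s \<circ> e \<circ> iv s))"

lemma conj_prod_comp: "conj_prod g n f \<Longrightarrow> conj_prod g m f' \<Longrightarrow> conj_prod g (n + m) (f' \<circ> f)"
proof (induction rule: conj_prod.induct)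
  case (conj_prod_step s e n f)
  have "conj_prod g (n + m) (f' \<circ> f)" using conj_prod_step.IH conj_prod_step.prems by blast
  from conj_prod.conj_prod_step[OF conj_prod_step(1,2) this]
  show ?case by (simp only: comp_assoc add_Suc)
next
  case conj_prod_id
  then show ?case by (simp only: comp_id add_0)
qed

lemma conj_prod_conj:
  assumes "conj_prod g n f" "g \<in> Grho" "s \<in> Grho" shows "conj_prod g n (s \<circ> f \<circ> iv s)"
  using assms(1)
proof (induction rule: conj_prod.induct)
  case conj_prod_id
  have "s \<circ> id \<circ> iv s = id" using gpD(1)[OF perm_group_Grho assms(3)]
    by (auto simp: fun_eq_iff f_iv)
  then show ?case using conj_prod.conj_prod_id by metis
next
  case (conj_prod_step s' e n f)
  have H: "s \<in> Homeo" "s' \<in> Homeo" using gpD(1)[OF perm_group_Grho] assms(3) conj_prod_step(1)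
    by auto
  have "conj_prod g (Suc n) ((s \<circ> f \<circ> iv s) \<circ> ((s \<circ> s') \<circ> e \<circ> iv (s \<circ> s')))"
    by (rule conj_prod.conj_prod_step[OF gpD(3)[OF perm_group_Grho assms(3) conj_prod_step(1)] conj_prod_step(2) conj_prod_step.IH])
  also have "(s \<circ> f \<circ> iv s) \<circ> ((s \<circ> s') \<circ> e \<circ> iv (s \<circ> s')) = s \<circ> (f \<circ> (s' \<circ> e \<circ> iv s')) \<circ> iv s"
    using H by (simp add: fun_eq_iff iv_comp)
  finally show ?case .
qed

lemma conj_prod_one: assumes "s \<in> Grho" "e = g \<or> e = iv g" shows "conj_prod g 1 (s \<circ> e \<circ> iv s)"
  using conj_prod_step[OF assms conj_prod_id] by simp

text \<open>The map \<open>g \<circ> iv a \<circ> iv g\<close> lives on the image of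
  \<open>D\<close>, hence commutes with \<open>b\<close>. Therefore
  \<open>commt a b = commt (commt a g) b\<close>, and the right-hand side spells out as four
  conjugates of \<open>g\<close> and its inverse.\<close>

lemma conj_prod_commutator:
  assumes Grho: "g \<in> Grho" "a \<in> Grho" "b \<in> Grho"
    and D: "\<And>x. x \<in> D \<Longrightarrow> g x \<notin> D" "\<And>x. x \<notin> D \<Longrightarrow> a x = x" "\<And>x. x \<notin> D \<Longrightarrow> b x = x"
  shows "conj_prod g 4 (commt a b)"
proof -
  have H: "g \<in> Homeo" "a \<in> Homeo" "b \<in> Homeo" using Grho gpD(1)[OF perm_group_Grho] by auto
  let ?p = "a \<circ> g \<circ> iv a" and ?q = "id \<circ> iv g \<circ> iv id" and ?r = "b \<circ> g \<circ> iv b"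
    and ?s = "(b \<circ> a) \<circ> iv g \<circ> iv (b \<circ> a)"
  have "conj_prod g 1 ?p" "conj_prod g 1 ?q" "conj_prod g 1 ?r" "conj_prod g 1 ?s"
    using Grho gpD(2)[OF perm_group_Grho] gpD(3)[OF perm_group_Grho Grho(3,2)] conj_prod_one
    by blast+
  then have "conj_prod g (((1 + 1) + 1) + 1) (?p \<circ> (?q \<circ> (?r \<circ> ?s)))" by (intro conj_prod_comp)
  moreover have "?p \<circ> (?q \<circ> (?r \<circ> ?s)) = commt a b"
  proof
    fix x
    let ?c = "g \<circ> iv a \<circ> iv g"
    have comm: "?c (b y) = b (?c y)" for y
    proof (rule disjoint_commute)
      show "?c z = z" if "z \<notin> g ` D" for z
      proof -
        have "iv g z \<notin> D" using that f_iv[OF H(1), of z] by force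
        then have "iv a (iv g z) = iv g z" using D(2) iv_fix[OF H(2)] by blast
        then show ?thesis using f_iv[OF H(1)] by simp
      qed
      show "g ` D \<inter> D = {}" using D(1) by auto
      show "?c \<in> Homeo" by (intro Homeo_comp Homeo_iv H)
    qed (use H D(3) in auto)
    let ?y = "iv b x"
    have "(?p \<circ> (?q \<circ> (?r \<circ> ?s))) x = a (?c (b (g (a (iv g (iv a ?y))))))"
      using H by (simp add: iv_comp inv_id)
    also have "\<dots> = a (b (?c (g (a (iv g (iv a ?y))))))" by (simp only: comm)
    also have "\<dots> = a (b (iv a ?y))" using H by (simp add: f_iv)
    finally show "(?p \<circ> (?q \<circ> (?r \<circ> ?s))) x = commt a b x" by (simp add: commt_def)
  qed
  ultimately show ?thesis by (simp add: eval_nat_numeral)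
qed

text \<open>\<open>shift_trick\<close>, applied on all intervals at once, writes \<open>h\<close> as
  two commutators, however many each interval needs. A compression glued from pieces moves their
  supports into the windows between \<open>e1\<close> and \<open>e2\<close>. The copies of the
  windows form a set displaced by \<open>g\<close>, so each spread commutator costs four
  conjugates.\<close>

lemma conj_prod_local:
  assumes fin: "finite \<A>" and disjoint_ivls: "disjoint_ivls \<A>" and ind: "indep \<S>"
    and SA: "\<And>\<sigma> u v. (\<sigma>,u,v) \<in> \<S> \<Longrightarrow> (u,v) \<in> \<A>"
    and LG: "\<And>h. h \<in> PLc (ivls \<A>) \<Longrightarrow> spread \<S> h \<in> Grho" and g: "g \<in> Grho"
    and e: "\<And>u v. (u,v) \<in> \<A> \<Longrightarrow> u \<le> e1 u v \<and> e1 u v < e2 u v \<and> e2 u v \<le> v"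
    and disp: "\<And>\<sigma> u v y \<tau> u' v' z. (\<sigma>,u,v) \<in> \<S> \<Longrightarrow> e1 u v < y \<Longrightarrow> y < e2 u v \<Longrightarrow>
      (\<tau>,u',v') \<in> \<S> \<Longrightarrow> e1 u' v' < z \<Longrightarrow> z < e2 u' v' \<Longrightarrow> g (\<sigma> y) \<noteq> \<tau> z"
    and h: "h \<in> PLc (ivls \<A>)"
  shows "conj_prod g 8 (spread \<S> h)"
proof -
  note gpB = perm_group_PLc[of "ivls \<A>"]
  have st: "f \<in> stabil \<S>" if "f \<in> PLc (ivls \<A>)" for f
    by (rule stabil_PLc[OF that]) (use disjoint_ivls_endpoints[OF disjoint_ivls] SA in blast)
  have hc: "h \<in> cprod (PLc (ivls \<A>))"
  proof (rule PLc_ivls_induct[OF fin disjoint_ivls cprod_id cprod_comp _ h])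
    fix u v f assume A: "(u,v) \<in> \<A>" "f \<in> PLc {u<..<v}"
    have "PLc {u<..<v} \<subseteq> PLc (ivls \<A>)" using PLc_mono ivls_member[OF A(1)] by blast
    then show "f \<in> cprod (PLc (ivls \<A>))"
      using perfect[OF A(2) disD(1)[OF disjoint_ivls A(1)]] cprod_mono by blast
  qed
  then obtain C
    where C: "compact C" "C \<subseteq> ivls \<A>" "h \<in> cprod {a \<in> PLc (ivls \<A>). \<forall>x. x \<notin> C \<longrightarrow> a x = x}"
    using cprod_common_support by blast
  have hull: "\<exists>c c'. u < c \<and> c \<le> c' \<and> c' < v \<and> (\<forall>x\<in>K. u < x \<longrightarrow> x < v \<longrightarrow> c \<le> x \<and> x \<le> c')"
    if K: "compact K" "K \<subseteq> ivls \<A>" "(u,v) \<in> \<A>" for K u v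
    using compact_hull[OF K(1,2) disD(1)[OF disjoint_ivls K(3)] disjoint_ivls_endpoints[OF disjoint_ivls K(3)]] by metis
  obtain c c' where c: "\<And>u v. (u,v) \<in> \<A> \<Longrightarrow> u < c u v \<and> c u v \<le> c' u v \<and> c' u v < v \<and>
      (\<forall>x\<in>C. u < x \<longrightarrow> x < v \<longrightarrow> c u v \<le> x \<and> x \<le> c' u v)"
    using hull[OF C(1,2)] by metis
  have "\<exists>t\<in>PLc {u<..<v}. c' u v < t (c u v)" if "(u,v) \<in> \<A>" for u v
    using c[OF that] by (intro push_PLc) auto
  then obtain t0 where t0: "\<And>u v. (u,v) \<in> \<A> \<Longrightarrow> t0 u v \<in> PLc {u<..<v} \<and> c' u v < t0 u v (c u v)"
    by metis
  obtain t where t: "t \<in> PLc (ivls \<A>)" "\<And>u v x. (u,v) \<in> \<A> \<Longrightarrow> u < x \<Longrightarrow> x < v \<Longrightarrow> t x = t0 u v x"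
    using PLc_glue[OF fin disjoint_ivls, of t0] t0 by blast
  \<comment> \<open>In each interval, the part to the right of the hull of \<open>C\<close>. The
    increasing push \<open>t\<close> sends the hull into it and never brings points back.\<close>
  let ?C' = "{x. \<exists>u v. (u,v) \<in> \<A> \<and> u < x \<and> x < v \<and> c' u v < x}"
  have "C \<inter> ?C' = {}" using c by force
  moreover have "t x \<in> ?C'" if "x \<in> C \<union> ?C'" for x
  proof -
    obtain u v where uv: "(u,v) \<in> \<A>" "u < x" "x < v" "c u v \<le> x"
    proof (cases "x \<in> C")
      case True
      then obtain u v where "(u,v) \<in> \<A>" "u < x" "x < v" using C(2) by (auto simp: ivls_def)
      then show ?thesis using that c True by blast
    next
      case False
      then obtain u v where "(u,v) \<in> \<A>" "u < x" "x < v" "c' u v < x" using \<open>x \<in> C \<union> ?C'\<close> by blast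
      then show ?thesis using that c[of u v] by force
    qed
    note tB = t0[OF uv(1)]
    have tx: "t x = t0 u v x" by (rule t(2)[OF uv(1-3)])
    have "t0 u v (c u v) \<le> t0 u v x" using Homeo_le[OF PLc_Homeo[OF conjunct1[OF tB]]] uv(4)
      by blast
    moreover have "u < t0 u v x" "t0 u v x < v" using PLc_less[OF conjunct1[OF tB]] uv by auto
    ultimately show ?thesis using tB uv(1) tx by force
  qed
  ultimately obtain \<psi> a b
    where ab: "\<psi> \<in> PLc (ivls \<A>)" "a \<in> PLc (ivls \<A>)" "b \<in> PLc (ivls \<A>)" "h = commt \<psi> t \<circ> commt a b"
    using shift_trick[OF gpB t(1), of C ?C' h] C(3) by blast
  have supp: "\<exists>K. compact K \<and> K \<subseteq> ivls \<A> \<and> (\<forall>x. x \<notin> K \<longrightarrow> f x = x)" if "f \<in> PLc (ivls \<A>)" for f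
    using that by (auto simp: PLc_def)
  obtain K1 K2 K3 K4 where K: "compact K1" "compact K2" "compact K3" "compact K4"
    "K1 \<subseteq> ivls \<A>" "K2 \<subseteq> ivls \<A>" "K3 \<subseteq> ivls \<A>" "K4 \<subseteq> ivls \<A>"
    "\<And>x. x \<notin> K1 \<Longrightarrow> \<psi> x = x" "\<And>x. x \<notin> K2 \<Longrightarrow> t x = x" "\<And>x. x \<notin> K3 \<Longrightarrow> a x = x" "\<And>x. x \<notin> K4 \<Longrightarrow> b x = x"
    using supp[OF ab(1)] supp[OF t(1)] supp[OF ab(2)] supp[OF ab(3)] by metis
  let ?K = "K1 \<union> K2 \<union> K3 \<union> K4"
  have cK: "compact ?K" "?K \<subseteq> ivls \<A>" using K by (auto intro!: compact_Un)
  obtain d d' where d: "\<And>u v. (u,v) \<in> \<A> \<Longrightarrow> u < d u v \<and> d u v \<le> d' u v \<and> d' u v < v \<and>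
      (\<forall>x\<in>?K. u < x \<longrightarrow> x < v \<longrightarrow> d u v \<le> x \<and> x \<le> d' u v)"
    using hull[OF cK] by metis
  \<comment> \<open>\<open>d\<close> and \<open>d'\<close> enclose the supports of all four entries,
    so one compression per interval brings them into the window together.\<close>
  have "\<exists>s\<in>PLc {u<..<v}. e1 u v < s (d u v) \<and> s (d' u v) < e2 u v" if "(u,v) \<in> \<A>" for u v
    using d[OF that] e[OF that] by (intro squeeze) auto
  then obtain s0
    where s0: "\<And>u v. (u,v) \<in> \<A> \<Longrightarrow> s0 u v \<in> PLc {u<..<v} \<and> e1 u v < s0 u v (d u v) \<and> s0 u v (d' u v) < e2 u v"
    by metis
  obtain s where s: "s \<in> PLc (ivls \<A>)" "\<And>u v x. (u,v) \<in> \<A> \<Longrightarrow> u < x \<Longrightarrow> x < v \<Longrightarrow> s x = s0 u v x"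
    using PLc_glue[OF fin disjoint_ivls, of s0] s0 by blast
  have sH: "s \<in> Homeo" "bij s" using s(1) PLc_Homeo Homeo_bij by blast+
  have ivs: "iv s \<in> PLc (ivls \<A>)" using gpD(4)[OF gpB s(1)] .
  let ?D = "{\<sigma> y | \<sigma> u v y. (\<sigma>,u,v) \<in> \<S> \<and> e1 u v < y \<and> y < e2 u v}"
  have cjB: "s \<circ> f \<circ> iv s \<in> PLc (ivls \<A>)" if "f \<in> PLc (ivls \<A>)" for f
    using gpD(3)[OF gpB gpD(3)[OF gpB s(1) that] ivs] .
  have supD: "spread \<S> (s \<circ> f \<circ> iv s) x = x"
    if f: "f \<in> PLc (ivls \<A>)" "\<And>x. x \<notin> ?K \<Longrightarrow> f x = x" and x: "x \<notin> ?D" for f x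
  proof (cases rule: spread_cases[OF ind, of x])
    case (2 \<sigma> u v y)
    have uv: "(u,v) \<in> \<A>" by (rule SA[OF 2(1)])
    note sB = conjunct1[OF s0[OF uv]]
    have ny: "\<not> (e1 u v < y \<and> y < e2 u v)" using x 2 by blast
    have "iv s y \<notin> ?K"
    proof
      assume k: "iv s y \<in> ?K"
      have "iv (s0 u v) y = iv s y"
      proof (rule sym, rule iv_eqI[OF sH(1)])
        have "iv (s0 u v) \<in> PLc {u<..<v}" by (rule gpD(4)[OF perm_group_PLc sB])
        then have "u < iv (s0 u v) y" "iv (s0 u v) y < v" using PLc_less 2 by auto
        then have "s (iv (s0 u v) y) = s0 u v (iv (s0 u v) y)" by (rule s(2)[OF uv])
        then show "s (iv (s0 u v) y) = y" using f_iv[OF PLc_Homeo[OF sB]] by simp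
      qed
      moreover have "iv (s0 u v) \<in> PLc {u<..<v}" by (rule gpD(4)[OF perm_group_PLc sB])
      then have "u < iv (s0 u v) y" "iv (s0 u v) y < v" using PLc_less 2 by auto
      ultimately have w: "d u v \<le> iv s y" "iv s y \<le> d' u v" "u < iv s y" "iv s y < v"
        using d[OF uv] k by auto
      have "s (iv s y) = y" using f_iv[OF sH(1)] .
      then have "s0 u v (iv s y) = y" using s(2)[OF uv w(3,4)] by simp
      then have "s0 u v (d u v) \<le> y" "y \<le> s0 u v (d' u v)"
        using Homeo_le[OF PLc_Homeo[OF sB]] w by metis+
      then show False using s0[OF uv] ny by auto
    qed
    then have "(s \<circ> f \<circ> iv s) y = y" using f(2) f_iv[OF sH(1)] by simp
    then show ?thesis using spread_in[OF ind 2(1-3), of "s \<circ> f \<circ> iv s"] 2(4) by simp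
  qed (simp add: spread_out)
  have gD: "g x \<notin> ?D" if "x \<in> ?D" for x using that disp by blast
  have four: "conj_prod g 4 (commt (spread \<S> (s \<circ> f \<circ> iv s)) (spread \<S> (s \<circ> f' \<circ> iv s)))"
    if f: "f \<in> PLc (ivls \<A>)" "\<And>x. x \<notin> ?K \<Longrightarrow> f x = x"
      and f': "f' \<in> PLc (ivls \<A>)" "\<And>x. x \<notin> ?K \<Longrightarrow> f' x = x" for f f'
    by (rule conj_prod_commutator[OF g LG[OF cjB[OF f(1)]] LG[OF cjB[OF f'(1)]] gD supD[OF f] supD[OF f']])
  have Lcm: "spread \<S> (s \<circ> commt f f' \<circ> iv s) = commt (spread \<S> (s \<circ> f \<circ> iv s)) (spread \<S> (s \<circ> f' \<circ> iv s))"
    if "f \<in> PLc (ivls \<A>)" "f' \<in> PLc (ivls \<A>)" for f f'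
    unfolding commt_conj[OF sH(2) PLc_Homeo[OF that(1)] PLc_Homeo[OF that(2)]]
    by (rule spread_commt[OF ind st[OF cjB[OF that(1)]] st[OF cjB[OF that(2)]]])
  have "s \<circ> h \<circ> iv s = (s \<circ> commt \<psi> t \<circ> iv s) \<circ> (s \<circ> commt a b \<circ> iv s)"
    unfolding ab(4) using sH(1) by (auto simp: fun_eq_iff)
  moreover have "s \<circ> commt a b \<circ> iv s \<in> stabil \<S>"
    using st[OF cjB[OF perm_group_commt[OF gpB ab(2,3)]]] .
  ultimately have "spread \<S> (s \<circ> h \<circ> iv s) = spread \<S> (s \<circ> commt \<psi> t \<circ> iv s) \<circ> spread \<S> (s \<circ> commt a b \<circ> iv s)"
    using spread_comp[OF ind] by metis
  also have "\<dots> = commt (spread \<S> (s \<circ> \<psi> \<circ> iv s)) (spread \<S> (s \<circ> t \<circ> iv s)) \<circ>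
      commt (spread \<S> (s \<circ> a \<circ> iv s)) (spread \<S> (s \<circ> b \<circ> iv s))"
    using Lcm ab t by simp
  \<comment> \<open>Two commutators at four conjugates each. Conjugating back by the spread of
    \<open>s\<close>, which lies in the group, keeps this number.\<close>
  finally have "conj_prod g (4 + 4) (spread \<S> (s \<circ> h \<circ> iv s))"
    using conj_prod_comp[OF four[OF ab(2) _ ab(3)] four[OF ab(1) _ t(1)]] K by auto
  then have "conj_prod g 8 (spread \<S> (iv s) \<circ> spread \<S> (s \<circ> h \<circ> iv s) \<circ> iv (spread \<S> (iv s)))"
    using conj_prod_conj[OF _ g LG[OF ivs]] by simp
  moreover have "spread \<S> (iv s) \<circ> spread \<S> (s \<circ> h \<circ> iv s) \<circ> iv (spread \<S> (iv s)) = spread \<S> (iv s \<circ> (s \<circ> h \<circ> iv s) \<circ> iv (iv s))"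
    by (rule spread_conj_sub[OF ind subset_refl st[OF ivs] st[OF cjB[OF h]]])
  moreover have "iv s \<circ> (s \<circ> h \<circ> iv s) \<circ> iv (iv s) = h" using sH(1) by (auto simp: fun_eq_iff)
  ultimately show ?thesis by metis
qed

end

section \<open>Uniform simplicity\<close>

lemma isom_ends:
  assumes "isom \<sigma>" "p < q" "p' < q'" "\<sigma> p = p' \<and> \<sigma> q = q' \<or> \<sigma> p = q' \<and> \<sigma> q = p'"
  shows "x \<in> {p - a..q + a} \<longleftrightarrow> \<sigma> x \<in> {p' - a..q' + a}"
  using isom_diff[OF assms(1), of x p] isom_diff[OF assms(1), of x q] isom_diff[OF assms(1), of q p]
    slope_cases[OF assms(1)] assms(2-4) by auto

lemma isom_ends_image:
  assumes "isom \<sigma>" "p < q" "p' < q'" "\<sigma> p = p' \<and> \<sigma> q = q' \<or> \<sigma> p = q' \<and> \<sigma> q = p'"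
  shows "\<sigma> ` {p - a..q + a} = {p' - a..q' + a}"
proof -
  have "y \<in> \<sigma> ` {p - a..q + a}" if "y \<in> {p' - a..q' + a}" for y
    using isom_ends[OF assms, of "iv \<sigma> y" a] that isom_f_iv[OF assms(1), of y]
    by (intro image_eqI[of _ _ "iv \<sigma> y"]) auto
  then show ?thesis using isom_ends[OF assms] by auto
qed

context labelled_gens
begin

text \<open>A small window around a point moved by \<open>g\<close> is displaced together with its
  copies at all occurrences of a long block. Recurrence puts an occurrence into every interval of
  length \<open>R\<close>, and \<open>R\<close> is fixed before any family is given.\<close>

lemma conj_prod_family:
  assumes g: "g \<in> Grho" "g \<noteq> id"
  obtains R where "R > 0" "\<And>\<A> \<S> h. finite \<A> \<Longrightarrow> disjoint_ivls \<A> \<Longrightarrow> indep \<S> \<Longrightarrow>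
      (\<And>\<sigma> u v. (\<sigma>,u,v) \<in> \<S> \<Longrightarrow> (u,v) \<in> \<A> \<and> matches \<rho> {u..v} \<sigma>) \<Longrightarrow>
      (\<And>h. h \<in> PLc (ivls \<A>) \<Longrightarrow> spread \<S> h \<in> Grho) \<Longrightarrow>
      (\<And>u v. (u,v) \<in> \<A> \<Longrightarrow> R \<le> v - u) \<Longrightarrow> h \<in> PLc (ivls \<A>) \<Longrightarrow> conj_prod g 8 (spread \<S> h)"
proof -
  have gH: "g \<in> Homeo" using gpD(1)[OF perm_group_Grho g(1)] .
  obtain y0 where y0: "g y0 \<noteq> y0" using g(2) by (meson eq_id_iff)
  define r where "r = \<bar>g y0 - y0\<bar>"
  have r: "r > 0" using y0 by (simp add: r_def)
  obtain \<delta>0 where \<delta>0: "\<delta>0 > 0" "\<And>y. \<bar>y - y0\<bar> < \<delta>0 \<Longrightarrow> \<bar>g y - g y0\<bar> < r / 2"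
    using Homeo_cont[OF gH, of y0] r unfolding continuous_at_eps_delta dist_real_def
    by (metis half_gt_zero_iff)
  define \<delta> where "\<delta> = min \<delta>0 (r / 2)"
  have \<delta>: "\<delta> > 0" using \<delta>0 r by (simp add: \<delta>_def)
  have sep: "g y \<noteq> z" if "\<bar>y - y0\<bar> < \<delta>" "\<bar>z - y0\<bar> < \<delta>" for y z
  proof -
    have "\<bar>g y - g y0\<bar> < r / 2" "\<bar>z - y0\<bar> < r / 2" using that \<delta>0(2)[of y] by (auto simp: \<delta>_def)
    then have "2 * \<bar>g y - g y0\<bar> < r" "2 * \<bar>z - y0\<bar> < r" by simp_all
    moreover have "\<bar>g y0 - y0\<bar> \<le> \<bar>g y - g y0\<bar> + \<bar>g y - y0\<bar>" by linarith
    ultimately show ?thesis unfolding r_def by auto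
  qed
  obtain M D where MD: "0 \<le> M" "equivariant \<rho> M g" "\<And>x. \<bar>g x - x\<bar> \<le> D"
    using Grho_equivariant[OF g(1)] by blast
  \<comment> \<open>If \<open>g\<close> carried a point of one window copy into another copy, the
    two occurrences would be within this distance: windows reach at most
    \<open>\<bar>y0\<bar> + \<delta>\<close> from 0, and \<open>g\<close> moves points by at most
    \<open>D\<close>.\<close>
  let ?L = "2 * (\<bar>y0\<bar> + \<delta>) + D"
  obtain m0 where m0: "\<And>\<sigma> \<tau>. \<sigma> \<in> occs m0 \<Longrightarrow> \<tau> \<in> occs m0 \<Longrightarrow> \<sigma> \<noteq> \<tau> \<Longrightarrow> ?L < \<bar>\<sigma> 0 - \<tau> 0\<bar>"
    using sparse[of ?L] by blast
  \<comment> \<open>The block also covers the window with the radius \<open>M\<close> around it, so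
    \<open>g\<close> commutes with occurrences there.\<close>
  obtain m :: nat where m: "max m0 (\<bar>y0\<bar> + \<delta> + M) \<le> real m" using real_arch_simple by blast
  have disp: "g (\<sigma> y) \<noteq> \<tau> z"
    if st: "\<sigma> \<in> occs m" "\<tau> \<in> occs m" and yz: "\<bar>y - y0\<bar> < \<delta>" "\<bar>z - y0\<bar> < \<delta>" for \<sigma> \<tau> y z
  proof
    assume eq: "g (\<sigma> y) = \<tau> z"
    have i: "isom \<sigma>" "isom \<tau>" "matches \<rho> {- real m..real m} \<sigma>" using st by (auto simp: occs_def)
    have yb: "\<bar>y\<bar> \<le> \<bar>y0\<bar> + \<delta>" "\<bar>z\<bar> \<le> \<bar>y0\<bar> + \<delta>" using yz by linarith+
    then have "{y - M..y + M} \<subseteq> {- real m..real m}" using m MD(1) by auto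
    then have "g (\<sigma> y) = \<sigma> (g y)" using MD(2) i matches_mono unfolding equivariant_def by blast
    then have e: "\<sigma> (g y) = \<tau> z" using eq by simp
    \<comment> \<open>For one and the same occurrence \<open>sep\<close> forbids this; for two
      different ones the distance forbids it.\<close>
    have "\<sigma> \<noteq> \<tau>" using e isom_inj[OF i(1)] sep[OF yz] by blast
    then have "?L < \<bar>\<sigma> 0 - \<tau> 0\<bar>" using m0 st occs_mono[of m0 m] m by auto
    moreover have "\<bar>\<sigma> 0 - \<sigma> (g y)\<bar> = \<bar>g y\<bar>" "\<bar>\<tau> z - \<tau> 0\<bar> = \<bar>z\<bar>"
      using isom_dist[OF i(1), of 0 "g y"] isom_dist[OF i(2), of z 0] by auto
    moreover have "\<bar>g y\<bar> \<le> \<bar>y\<bar> + D" using MD(3)[of y] by linarith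
    moreover have "\<bar>\<sigma> 0 - \<tau> 0\<bar> \<le> \<bar>\<sigma> 0 - \<sigma> (g y)\<bar> + \<bar>\<tau> z - \<tau> 0\<bar>" unfolding e by linarith
    ultimately show False using yb by simp
  qed
  obtain R where R: "R > 0" "\<And>z. \<exists>d::int. z \<le> of_int d - real m \<and> of_int d + real m \<le> z + R \<and>
    matches \<rho> {- real m..real m} (\<lambda>x. 1 * x + of_int d)" using recurrence[of m] by blast
  then obtain d :: "real \<Rightarrow> int"
    where d: "\<And>z. z \<le> of_int (d z) - real m" "\<And>z. of_int (d z) + real m \<le> z + R"
    "\<And>z. matches \<rho> {- real m..real m} (\<lambda>x. 1 * x + of_int (d z))" by metis
  show ?thesis
  proof (rule that[OF R(1)])
    fix \<A> \<S> h
    assume A: "finite \<A>" "disjoint_ivls \<A>" "indep \<S>"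
      "\<And>\<sigma> u v. (\<sigma>,u,v) \<in> \<S> \<Longrightarrow> (u,v) \<in> \<A> \<and> matches \<rho> {u..v} \<sigma>"
      "\<And>h. h \<in> PLc (ivls \<A>) \<Longrightarrow> spread \<S> h \<in> Grho" "\<And>u v. (u,v) \<in> \<A> \<Longrightarrow> R \<le> v - u" "h \<in> PLc (ivls \<A>)"
    have b: "u \<le> y0 - \<delta> + of_int (d u)" "y0 + \<delta> + of_int (d u) \<le> v" if "(u,v) \<in> \<A>" for u v
      using d(1,2)[of u] A(6)[OF that] m MD(1) by linarith+
    \<comment> \<open>The recurrent block lies inside \<open>{u..v}\<close>, where
      \<open>\<sigma>\<close> matches labels; composing the two matchings gives an occurrence again,
      so \<open>disp\<close> applies across the whole family.\<close>
    have in_occs: "\<sigma> \<circ> (\<lambda>x. 1 * x + of_int (d u)) \<in> occs m" if "(\<sigma>,u,v) \<in> \<S>" for \<sigma> u v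
    proof -
      let ?t = "\<lambda>x. 1 * x + of_int (d u) :: real"
      have t: "isom ?t" by (rule isoI) auto
      have i: "isom \<sigma>" by (rule indep_iso[OF A(3) that])
      have "u \<le> of_int (d u) - real m" "of_int (d u) + real m \<le> v"
        using d(1,2)[of u] A(6)[of u v] A(4)[OF that] by linarith+
      then have "?t ` {- real m..real m} \<subseteq> {u..v}" by auto
      then have "matches \<rho> (?t ` {- real m..real m}) \<sigma>" using A(4)[OF that] matches_mono by blast
      then show ?thesis using matches_comp[OF t i d(3)] isom_comp(1)[OF i t] by (simp add: occs_def)
    qed
    show "conj_prod g 8 (spread \<S> h)"
    proof (rule conj_prod_local[OF A(1-3) _ A(5) g(1) _ _ A(7),
          where ?e1.0 = "\<lambda>u v. y0 - \<delta> + of_int (d u)" and ?e2.0 = "\<lambda>u v. y0 + \<delta> + of_int (d u)"])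
      show "(\<sigma>, u, v) \<in> \<S> \<Longrightarrow> (u, v) \<in> \<A>" for \<sigma> u v using A(4) by blast
      show "u \<le> y0 - \<delta> + of_int (d u) \<and> y0 - \<delta> + of_int (d u) < y0 + \<delta> + of_int (d u) \<and>
        y0 + \<delta> + of_int (d u) \<le> v" if "(u,v) \<in> \<A>" for u v using b[OF that] \<delta> by simp
      fix \<sigma> u v y \<tau> u' v' z
      assume s: "(\<sigma>,u,v) \<in> \<S>" "y0 - \<delta> + of_int (d u) < y" "y < y0 + \<delta> + of_int (d u)"
        "(\<tau>,u',v') \<in> \<S>" "y0 - \<delta> + of_int (d u') < z" "z < y0 + \<delta> + of_int (d u')"
      have "\<bar>(y - of_int (d u)) - y0\<bar> < \<delta>" "\<bar>(z - of_int (d u')) - y0\<bar> < \<delta>" using s by auto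
      from disp[OF in_occs[OF s(1)] in_occs[OF s(4)] this] show "g (\<sigma> y) \<noteq> \<tau> z" by simp
    qed
  qed
qed

text \<open>
  The marked points \<open>\<sigma> 0\<close> cut the line into intervals of boundedly many
  kinds, so an element of the group that is trivial near them is determined by its restrictions
  to finitely many intervals.
\<close>

lemma conj_prod_marked:
  assumes fam8: "\<And>\<A> \<S> h. finite \<A> \<Longrightarrow> disjoint_ivls \<A> \<Longrightarrow> indep \<S> \<Longrightarrow>
      (\<And>\<sigma> u v. (\<sigma>,u,v) \<in> \<S> \<Longrightarrow> (u,v) \<in> \<A> \<and> matches \<rho> {u..v} \<sigma>) \<Longrightarrow>
      (\<And>h. h \<in> PLc (ivls \<A>) \<Longrightarrow> spread \<S> h \<in> Grho) \<Longrightarrow>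
      (\<And>u v. (u,v) \<in> \<A> \<Longrightarrow> R \<le> v - u) \<Longrightarrow> h \<in> PLc (ivls \<A>) \<Longrightarrow> conj_prod g 8 (spread \<S> h)"
    and sparse: "\<And>\<sigma> \<tau>. \<sigma> \<in> occs m \<Longrightarrow> \<tau> \<in> occs m \<Longrightarrow> \<sigma> \<noteq> \<tau> \<Longrightarrow> R \<le> \<bar>\<sigma> 0 - \<tau> 0\<bar>"
    and f: "f \<in> Grho" and \<delta>: "\<delta> > 0" "\<And>\<sigma> x. \<sigma> \<in> occs m \<Longrightarrow> \<bar>x\<bar> < \<delta> \<Longrightarrow> f (\<sigma> x) = \<sigma> x"
  shows "conj_prod g 8 f"
proof -
  define P where "P = (\<lambda>\<sigma>. \<sigma> 0) ` occs m"
  have PZ: "p \<in> \<int>" if "p \<in> P" for p using that isom_Ints[of _ 0] by (auto simp: P_def occs_def)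
  obtain n :: nat where n: "m \<le> real n" using real_arch_simple by blast
  obtain R2 where R2: "R2 > 0" "\<And>z. \<exists>p\<in>P. z \<le> p \<and> p \<le> z + R2"
  proof -
    obtain R2 where r: "R2 > 0" "\<And>z. \<exists>d::int. z \<le> of_int d - real n \<and> of_int d + real n \<le> z + R2 \<and>
      matches \<rho> {- real n..real n} (\<lambda>x. 1 * x + of_int d)" using recurrence[of n] by blast
    have "\<exists>p\<in>P. z \<le> p \<and> p \<le> z + R2" for z
    proof -
      obtain d :: int where d: "z \<le> of_int d - real n" "of_int d + real n \<le> z + R2"
        "matches \<rho> {- real n..real n} (\<lambda>x. 1 * x + of_int d)" using r(2) by blast
      have "(\<lambda>x. 1 * x + of_int d) \<in> occs (real n)" using d(3) isoI[of 1 "of_int d"]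
        by (simp add: occs_def)
      then have "(\<lambda>x. 1 * x + of_int d) \<in> occs m" using occs_mono[OF n] by blast
      then have "1 * 0 + of_int d \<in> P" unfolding P_def by (rule rev_image_eqI) simp
      then show ?thesis using d(1,2) by (intro bexI[of _ "of_int d"]) auto
    qed
    then show ?thesis using that r(1) by blast
  qed
  obtain M D where MD: "0 \<le> M" "equivariant \<rho> M f" using Grho_equivariant[OF f] by blast
  \<comment> \<open>Three margins at once: \<open>m\<close> lets an isometry recognise marked
    points, \<open>M\<close> makes \<open>f\<close> commute with it, and 1/2 is the margin of
    \<open>spread_block\<close>.\<close>
  define a where "a = max (max m M) (1/2)"
  have a: "m \<le> a" "M \<le> a" "1/2 \<le> a" by (auto simp: a_def)
  define J where "J = {(p,q). p \<in> P \<and> q \<in> P \<and> p < q \<and> (\<forall>r\<in>P. \<not> (p < r \<and> r < q))}"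
  have JD: "p \<in> P" "q \<in> P" "p < q" "\<And>r. r \<in> P \<Longrightarrow> \<not> (p < r \<and> r < q)" if "(p,q) \<in> J" for p q
    using that by (auto simp: J_def)
  \<comment> \<open>Marked points are integers, and looking from \<open>p + 1\<close> on finds
    another one within \<open>R2\<close>; this bounds the gap.\<close>
  have J_gap: "q - p \<le> R2 + 1" if J: "(p,q) \<in> J" for p q
  proof -
    obtain r where r: "r \<in> P" "p + 1 \<le> r" "r \<le> p + 1 + R2" using R2(2) by blast
    then show ?thesis using JD(4)[OF J r(1)] by linarith
  qed
  have J_cover: "\<exists>p q. (p,q) \<in> J \<and> p < x \<and> x < q" if x: "x \<notin> P" for x
  proof -
    let ?A = "{p \<in> P. x - R2 \<le> p \<and> p \<le> x}" and ?C = "{p \<in> P. x \<le> p \<and> p \<le> x + R2}"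
    have fin: "finite ?A" "finite ?C"
      by (rule finite_subset[OF _ finite_int_segment[of "x - R2" x]], use PZ in blast)
        (rule finite_subset[OF _ finite_int_segment[of x "x + R2"]], use PZ in blast)
    obtain p1 p2 where "p1 \<in> ?A" "p2 \<in> ?C" using R2(2)[of "x - R2"] R2(2)[of x] by auto
    then have ne: "?A \<noteq> {}" "?C \<noteq> {}" by blast+
    have m: "Max ?A \<in> ?A" "Min ?C \<in> ?C" using Max_in[OF fin(1) ne(1)] Min_in[OF fin(2) ne(2)]
      by auto
    then have lt: "Max ?A < x" "x < Min ?C" using x by (auto simp: order_less_le)
    have "\<not> (Max ?A < r \<and> r < Min ?C)" if r: "r \<in> P" for r
    proof
      assume c: "Max ?A < r \<and> r < Min ?C"
      show False
      proof (cases "r \<le> x")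
        case True
        then have "r \<in> ?A" using r c m(1) by auto
        then show False using Max_ge[OF fin(1)] c by (meson not_le)
      next
        case False
        then have "r \<in> ?C" using r c m(2) by auto
        then show False using Min_le[OF fin(2)] c by (meson not_le)
      qed
    qed
    then have "(Max ?A, Min ?C) \<in> J" using m lt unfolding J_def by auto
    then show ?thesis using lt by blast
  qed
  have J_unique: "p = p' \<and> q = q'" if J: "(p,q) \<in> J" "(p',q') \<in> J" "p < x" "x < q" "p' < x" "x < q'"
    for p q p' q' x
  proof
    show "p = p'" using JD(4)[OF J(1) JD(1)[OF J(2)]] JD(4)[OF J(2) JD(1)[OF J(1)]] J by linarith
    show "q = q'" using JD(4)[OF J(1) JD(2)[OF J(2)]] JD(4)[OF J(2) JD(2)[OF J(1)]] J by linarith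
  qed
  \<comment> \<open>Gaps of the same kind: some isometry exchanges their ends suitably and matches
    the labels with margin \<open>a\<close>, possibly reversing them.\<close>
  define rel where "rel = (\<lambda>(p,q) (p',q'). \<exists>\<sigma>. isom \<sigma> \<and> matches \<rho> {p - a..q + a} \<sigma> \<and>
    (\<sigma> p = p' \<and> \<sigma> q = q' \<or> \<sigma> p = q' \<and> \<sigma> q = p'))"
  have rel_refl: "rel A A" for A
    by (cases A) (auto simp: rel_def matches_id intro!: exI[of _ id])
  have rel_sym: "rel A' A" if H: "A \<in> J" "A' \<in> J" "rel A A'" for A A'
  proof -
    obtain p q p' q' where A: "A = (p,q)" "A' = (p',q')" by (metis prod.exhaust)
    then have lt: "p < q" "p' < q'" using H JD(3) by auto
    obtain \<sigma>
      where s: "isom \<sigma>" "matches \<rho> {p - a..q + a} \<sigma>" "\<sigma> p = p' \<and> \<sigma> q = q' \<or> \<sigma> p = q' \<and> \<sigma> q = p'"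
      using H(3) unfolding A rel_def by auto
    have "matches \<rho> {p' - a..q' + a} (iv \<sigma>)"
      using matches_iv[OF s(1,2)] isom_ends_image[OF s(1) lt s(3)] by simp
    moreover have "iv \<sigma> p' = p \<and> iv \<sigma> q' = q \<or> iv \<sigma> p' = q \<and> iv \<sigma> q' = p"
      using s(3) isom_iv_f[OF s(1)] by metis
    ultimately show ?thesis unfolding A rel_def using isom_iv(1)[OF s(1)] by auto
  qed
  have rel_trans: "rel A A''" if H: "A \<in> J" "A' \<in> J" "rel A A'" "rel A' A''" for A A' A''
  proof -
    obtain p q p' q' p'' q'' where A: "A = (p,q)" "A' = (p',q')" "A'' = (p'',q'')"
      by (metis prod.exhaust)
    then have lt: "p < q" "p' < q'" using H JD(3) by auto
    obtain \<sigma>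
      where s: "isom \<sigma>" "matches \<rho> {p - a..q + a} \<sigma>" "\<sigma> p = p' \<and> \<sigma> q = q' \<or> \<sigma> p = q' \<and> \<sigma> q = p'"
      using H(3) unfolding A rel_def by auto
    obtain \<tau>
      where t: "isom \<tau>" "matches \<rho> {p' - a..q' + a} \<tau>"
        "\<tau> p' = p'' \<and> \<tau> q' = q'' \<or> \<tau> p' = q'' \<and> \<tau> q' = p''"
      using H(4) unfolding A rel_def by auto
    have "matches \<rho> {p - a..q + a} (\<tau> \<circ> \<sigma>)"
      by (rule matches_comp[OF s(1) t(1) s(2)]) (simp only: isom_ends_image[OF s(1) lt s(3)] t(2))
    moreover have "(\<tau> \<circ> \<sigma>) p = p'' \<and> (\<tau> \<circ> \<sigma>) q = q'' \<or> (\<tau> \<circ> \<sigma>) p = q'' \<and> (\<tau> \<circ> \<sigma>) q = p''"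
      using s(3) t(3) by auto
    ultimately show ?thesis unfolding A rel_def using isom_comp(1)[OF t(1) s(1)] by blast
  qed
  have P_image: "\<sigma> p \<in> P" if H: "p \<in> P" "isom \<sigma>" "matches \<rho> {p - m..p + m} \<sigma>" for \<sigma> p
  proof -
    obtain \<tau> where t: "\<tau> \<in> occs m" "p = \<tau> 0" using H(1) by (auto simp: P_def)
    then have i: "isom \<tau>" "matches \<rho> {- m..m} \<tau>" by (auto simp: occs_def)
    have "\<tau> x \<in> {p - m..p + m}" if "x \<in> {- m..m}" for x
      using isom_dist[OF i(1), of x 0] that t(2) by (auto simp: abs_le_iff abs_if split: if_splits)
    then have "matches \<rho> (\<tau> ` {- m..m}) \<sigma>" using H(3) by (auto elim!: matches_mono)
    then have "\<sigma> \<circ> \<tau> \<in> occs m" using matches_comp[OF i(1) H(2) i(2)] isom_comp(1)[OF H(2) i(1)]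
      by (simp add: occs_def)
    then show ?thesis unfolding P_def by (rule rev_image_eqI) (simp add: t(2))
  qed
  \<comment> \<open>Markedness is visible within \<open>m\<close>, so both ends stay marked. A new
    marked point strictly between their images would be pulled back to one between \<open>p\<close>
    and \<open>q\<close>.\<close>
  have J_image: "\<exists>p' q'. (p',q') \<in> J \<and> (\<sigma> p = p' \<and> \<sigma> q = q' \<or> \<sigma> p = q' \<and> \<sigma> q = p')"
    if J: "(p,q) \<in> J" and s: "isom \<sigma>" "matches \<rho> {p - a..q + a} \<sigma>" for p q \<sigma>
  proof -
    note pq = JD[OF J]
    let ?p = "min (\<sigma> p) (\<sigma> q)" and ?q = "max (\<sigma> p) (\<sigma> q)"
    have "{p - m..p + m} \<subseteq> {p - a..q + a}" "{q - m..q + m} \<subseteq> {p - a..q + a}" using pq(3) a(1)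
      by auto
    then have sP: "\<sigma> p \<in> P" "\<sigma> q \<in> P" using P_image pq(1,2) s matches_mono by blast+
    have ne: "\<sigma> p \<noteq> \<sigma> q" using isom_inj[OF s(1)] pq(3) by simp
    then have lt: "?p < ?q" by auto
    have ends: "\<sigma> p = ?p \<and> \<sigma> q = ?q \<or> \<sigma> p = ?q \<and> \<sigma> q = ?p" by auto
    note im = isom_ends_image[OF s(1) pq(3) lt ends, of a]
    note iff = isom_ends[OF s(1) pq(3) lt ends]
    have "\<not> (?p < r \<and> r < ?q)" if r: "r \<in> P" for r
    proof
      assume c: "?p < r \<and> r < ?q"
      have "matches \<rho> {?p - a..?q + a} (iv \<sigma>)" using matches_iv[OF s] im by simp
      moreover have "{r - m..r + m} \<subseteq> {?p - a..?q + a}" using c a(1) by auto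
      ultimately have "iv \<sigma> r \<in> P" using P_image[OF r isom_iv(1)[OF s(1)]] matches_mono by blast
      moreover have "iv \<sigma> r \<in> {p - 0..q + 0}" using iff[of "iv \<sigma> r" 0] c isom_f_iv[OF s(1), of r]
        by simp
      moreover have "iv \<sigma> r \<noteq> p" "iv \<sigma> r \<noteq> q" using c isom_f_iv[OF s(1), of r] by auto
      ultimately show False using pq(4)[of "iv \<sigma> r"] by auto
    qed
    then have "(?p,?q) \<in> J" using sP lt unfolding J_def by (auto simp: min_def max_def)
    then show ?thesis using ends by blast
  qed
  \<comment> \<open>One representative for each kind; every gap is an isometric copy of its
    representative.\<close>
  define c where "c = (\<lambda>A. SOME A'. A' \<in> J \<and> rel A A')"
  have cJ: "c A \<in> J \<and> rel A (c A)" if "A \<in> J" for A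
    unfolding c_def by (rule someI[of _ A]) (use that rel_refl in auto)
  have c_eq: "c A = c A'" if "A \<in> J" "A' \<in> J" "rel A A'" for A A'
  proof -
    have "(\<lambda>A''. A'' \<in> J \<and> rel A A'') = (\<lambda>A''. A'' \<in> J \<and> rel A' A'')"
      using rel_sym[OF that] rel_trans that by (intro ext) blast
    then show ?thesis by (simp add: c_def)
  qed
  define \<A> where "\<A> = c ` J"
  have AJ: "A \<in> J" "c A = A" if A: "A \<in> \<A>" for A
  proof -
    obtain A' where A': "A' \<in> J" "A = c A'" using A unfolding \<A>_def by blast
    then show "A \<in> J" "c A = A" using cJ[OF A'(1)] c_eq[OF A'(1), of A] by simp_all
  qed
  have finA: "finite \<A>"
  proof -
    \<comment> \<open>The kind of a gap is determined by its length and by the signs at positions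
      \<open>p + of_int j / 2\<close>. Positions within the margin satisfy
      \<open>\<bar>j\<bar> \<le> K\<close>, so only finitely many keys occur.\<close>
    define K where "K = \<lceil>2 * (R2 + 1 + a)\<rceil>"
    define key where "key = (\<lambda>(p,q). (q - p, {j \<in> {- K..K}. letter_sign \<rho> (p + of_int j / 2) = 1}))"
    have "key ` J \<subseteq> {x \<in> \<int>. 0 \<le> x \<and> x \<le> R2 + 1} \<times> Pow {- K..K}"
      using J_gap JD PZ by (fastforce simp: key_def intro: Ints_diff less_imp_le)
    then have fin: "finite (key ` J)"
      by (rule finite_subset) (intro finite_cartesian_product finite_int_segment; simp)
    have key: "c A = c A'" if A: "A \<in> J" "A' \<in> J" "key A = key A'" for A A'
    proof (rule c_eq[OF A(1,2)])
      obtain p q p' q' where pq: "A = (p,q)" "A' = (p',q')" by (metis prod.exhaust)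
      have k: "q - p = q' - p'"
        "\<And>j. j \<in> {- K..K} \<Longrightarrow> letter_sign \<rho> (p + of_int j / 2) = 1 \<longleftrightarrow> letter_sign \<rho> (p' + of_int j / 2) = 1"
        using A(3) unfolding pq key_def by (auto simp: set_eq_iff)
      have Z: "p \<in> \<int>" "p' \<in> \<int>" using A JD PZ unfolding pq by blast+
      let ?t = "\<lambda>x. 1 * x + (p' - p)"
      have "matches \<rho> {p - a..q + a} ?t"
        unfolding matches_def slope_affine
      proof
        fix x assume x: "x \<in> {p - a..q + a} \<inter> half_ints"
        have "2 * (x - p) = 2 * x - 2 * p" by simp
        also have "\<dots> \<in> \<int>" using x Ints_mult[OF Ints_numeral Z(1)]
          by (intro Ints_diff) (auto simp: half_ints_def)
        finally obtain j where j: "2 * (x - p) = of_int j" by (auto elim: Ints_cases)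
        have "q - p \<le> R2 + 1" using J_gap A(1) pq by blast
        then have "\<bar>of_int j\<bar> \<le> 2 * (R2 + 1 + a)" using x a(3) R2(1) unfolding j[symmetric] by auto
        then have "j \<in> {- K..K}" unfolding K_def atLeastAtMost_iff by linarith
        moreover have "x = p + of_int j / 2" "?t x = p' + of_int j / 2" using j by auto
        ultimately have "letter_sign \<rho> (?t x) = 1 \<longleftrightarrow> letter_sign \<rho> x = 1" using k(2) by metis
        then show "letter_sign \<rho> (?t x) = 1 * letter_sign \<rho> x"
          using letter_sign_cases[of \<rho> x] letter_sign_cases[of \<rho> "?t x"] by auto
      qed
      moreover have "isom ?t" using Z by (intro isoI) auto
      moreover have "?t p = p'" "?t q = q'" using k(1) by auto
      ultimately show "rel A A'" unfolding pq rel_def by blast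
    qed
    have "\<A> \<subseteq> (\<lambda>k. c (SOME A. A \<in> J \<and> key A = k)) ` (key ` J)"
    proof
      fix A' assume "A' \<in> \<A>"
      then obtain A where A: "A \<in> J" "A' = c A" by (auto simp: \<A>_def)
      let ?A = "SOME X. X \<in> J \<and> key X = key A"
      have "?A \<in> J \<and> key ?A = key A" by (rule someI[of _ A]) (use A in simp)
      then have "A' = c ?A" using key[of A ?A] A by simp
      then show "A' \<in> (\<lambda>k. c (SOME A. A \<in> J \<and> key A = k)) ` (key ` J)" using A(1) by blast
    qed
    then show ?thesis using fin by (meson finite_imageI finite_subset)
  qed
  have disA: "disjoint_ivls \<A>"
    unfolding disjoint_ivls_def
  proof (intro conjI allI impI)
    fix u v assume "(u,v) \<in> \<A>"
    then have J: "(u,v) \<in> J" using AJ by blast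
    show "u < v" using JD(3)[OF J] .
    have "u \<in> half_ints" "v \<in> half_ints" using PZ JD(1,2)[OF J] by auto
    then show "u \<in> dyadic" "v \<in> dyadic" using half_ints_dyadic by auto
  next
    fix u v u' v' x assume "(u,v) \<in> \<A>" "(u',v') \<in> \<A>" "u < x" "x < v" "u' < x" "x < v'"
    then show "u = u'" "v = v'" using J_unique[of u v u' v' x] AJ by blast+
  qed
  define \<S> where "\<S> = {(\<sigma>,p,q). (p,q) \<in> \<A> \<and> isom \<sigma> \<and> matches \<rho> {p - a..q + a} \<sigma>}"
  have SD: "(p,q) \<in> \<A>" "isom \<sigma>" "matches \<rho> {p - a..q + a} \<sigma>" if "(\<sigma>,p,q) \<in> \<S>" for \<sigma> p q
    using that by (auto simp: \<S>_def)
  have ind: "indep \<S>"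
    unfolding indep_def
  proof (intro conjI allI impI)
    show "\<forall>(\<sigma>,u,v)\<in>\<S>. isom \<sigma>" by (auto simp: \<S>_def)
    fix \<sigma> u v \<tau> u' v' x y
    assume s: "(\<sigma>,u,v) \<in> \<S>" "(\<tau>,u',v') \<in> \<S>" "u < x" "x < v" "u' < y" "y < v'" "\<sigma> x = \<tau> y"
    note s1 = SD[OF s(1)] and s2 = SD[OF s(2)]
    have J: "(u,v) \<in> J" "(u',v') \<in> J" using s1 s2 AJ by auto
    obtain p q where pq: "(p,q) \<in> J" "\<sigma> u = p \<and> \<sigma> v = q \<or> \<sigma> u = q \<and> \<sigma> v = p"
      using J_image[OF J(1) s1(2,3)] by blast
    obtain p' q' where pq': "(p',q') \<in> J" "\<tau> u' = p' \<and> \<tau> v' = q' \<or> \<tau> u' = q' \<and> \<tau> v' = p'"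
      using J_image[OF J(2) s2(2,3)] by blast
    have "\<sigma> x \<noteq> \<sigma> u" "\<sigma> x \<noteq> \<sigma> v" using isom_inj[OF s1(2)] s by auto
    then have x: "p < \<sigma> x" "\<sigma> x < q"
      using isom_ends[OF s1(2) JD(3)[OF J(1)] JD(3)[OF pq(1)] pq(2), of x 0] s pq(2) by auto
    have "\<tau> y \<noteq> \<tau> u'" "\<tau> y \<noteq> \<tau> v'" using isom_inj[OF s2(2)] s by auto
    then have y: "p' < \<tau> y" "\<tau> y < q'"
      using isom_ends[OF s2(2) JD(3)[OF J(2)] JD(3)[OF pq'(1)] pq'(2), of y 0] s pq'(2) by auto
    have eq: "p = p'" "q = q'" using J_unique[OF pq(1) pq'(1) x] y s(7) by auto
    have "rel (u,v) (p,q)" unfolding rel_def using s1 pq(2) by blast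
    moreover have "rel (u',v') (p,q)" unfolding rel_def using s2 pq'(2) eq by blast
    ultimately have "c (u,v) = c (u',v')" using c_eq J pq(1) by metis
    then have uv: "u = u'" "v = v'" using AJ(2) s1(1) s2(1) by auto
    show "u = u'" "v = v'" by fact+
    show "\<sigma> = \<tau>"
    proof (cases "\<sigma> u = \<tau> u")
      case True
      then have "\<sigma> v = \<tau> v" using pq(2) pq'(2) eq uv JD(3)[OF pq(1)] by auto
      then have "slope \<sigma> * (v - u) = slope \<tau> * (v - u)"
        unfolding isom_diff[OF s1(2), symmetric] isom_diff[OF s2(2), symmetric] using True by simp
      then have "slope \<sigma> = slope \<tau>" using JD(3)[OF J(1)] by simp
      then show ?thesis using isom_eqI[OF s1(2) s2(2) True] by blast
    next
      case False
      then have sw: "\<sigma> u = \<tau> v" "\<sigma> v = \<tau> u" using pq(2) pq'(2) eq uv by auto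
      then have "(slope \<sigma> + slope \<tau>) * (v - u) = 0"
        unfolding distrib_right isom_diff[OF s1(2), symmetric] isom_diff[OF s2(2), symmetric]
        by simp
      then have slope: "slope \<sigma> = - slope \<tau>" using JD(3)[OF J(1)] by simp
      \<comment> \<open>Ends exchanged: \<open>\<sigma>\<close> and \<open>\<tau>\<close> have
        opposite slopes and agree at the midpoint, which is a letter position because the ends are
        integers. Both match its letter, forcing opposite signs at one position.\<close>
      let ?t = "(u + v) / 2"
      have "u + v \<in> \<int>" using PZ JD(1,2)[OF J(1)] by simp
      then have "2 * ?t \<in> \<int>" by (metis field_sum_of_halves mult_2)
      then have h: "?t \<in> half_ints" by (simp add: half_ints_def)
      have "\<sigma> ?t - \<sigma> u = slope \<sigma> * (?t - u)" "\<tau> ?t - \<tau> v = slope \<tau> * (?t - v)"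
        using isom_diff[OF s1(2)] isom_diff[OF s2(2)] by blast+
      moreover have "slope \<sigma> * (?t - u) = slope \<tau> * (?t - v)" unfolding slope
        by (simp add: field_simps)
      ultimately have e: "\<sigma> ?t = \<tau> ?t" using sw by simp
      have "?t \<in> {u - a..v + a}" using JD(3)[OF J(1)] a(3) by auto
      then have "letter_sign \<rho> (\<sigma> ?t) = slope \<sigma> * letter_sign \<rho> ?t"
        "letter_sign \<rho> (\<tau> ?t) = slope \<tau> * letter_sign \<rho> ?t"
        using s1(3) s2(3) h uv unfolding matches_def by blast+
      then have "slope \<sigma> * letter_sign \<rho> ?t = slope \<tau> * letter_sign \<rho> ?t" using e by simp
      then show ?thesis using slope slope_cases[OF s2(2)] by auto
    qed
  qed
  have st: "h \<in> stabil \<S>" if "h \<in> PLc (ivls \<A>)" for h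
    by (rule stabil_PLc[OF that]) (use disjoint_ivls_endpoints[OF disA] SD(1) in blast)
  have LG: "spread \<S> h \<in> Grho" if h: "h \<in> PLc (ivls \<A>)" for h
  proof -
    have "h \<in> {h \<in> PLc (ivls \<A>). spread \<S> h \<in> Grho}"
    proof (rule PLc_ivls_induct[OF finA disA _ _ _ h])
      show "id \<in> {h \<in> PLc (ivls \<A>). spread \<S> h \<in> Grho}"
        using gpD(2)[OF perm_group_PLc] gpD(2)[OF perm_group_Grho] spread_id[OF ind] by simp
      show "k \<circ> l \<in> {h \<in> PLc (ivls \<A>). spread \<S> h \<in> Grho}"
        if "k \<in> {h \<in> PLc (ivls \<A>). spread \<S> h \<in> Grho}" "l \<in> {h \<in> PLc (ivls \<A>). spread \<S> h \<in> Grho}"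
          for k l
        using that gpD(3)[OF perm_group_PLc, of k _ l] gpD(3)[OF perm_group_Grho] spread_comp[OF ind st, of l k] by simp
      fix u v k assume uv: "(u,v) \<in> \<A>" and k: "k \<in> PLc {u<..<v}"
      let ?F = "copies (matches \<rho> {u - a..v + a}) u v"
      have sub: "?F \<subseteq> \<S>" using uv by (auto simp: copies_def \<S>_def)
      \<comment> \<open>A map supported in one representative acts only on copies of that
        representative, so the case of a single interval, \<open>spread_block\<close>,
        suffices.\<close>
      have "spread \<S> k = spread ?F k"
      proof (rule spread_eqI[OF ind sub spread_out])
        fix \<sigma> u' v' y assume y: "(\<sigma>,u',v') \<in> \<S>" "u' < y" "y < v'"
        have "(\<sigma>,u',v') \<in> ?F" if "u < y" "y < v"
        proof -
          have "u = u'" "v = v'" using disjoint_ivls_eq[OF disA uv SD(1)[OF y(1)] that y(2,3)]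
            by auto
          then show ?thesis using SD[OF y(1)] by (simp add: copies_iff)
        qed
        then have "(if (\<sigma>,u',v') \<in> ?F then k y else y) = k y" using PLc_fix[OF k, of y]
          by (cases "u < y \<and> y < v") auto
        then show "spread \<S> k (\<sigma> y) = \<sigma> (if (\<sigma>,u',v') \<in> ?F then k y else y)"
          using spread_in[OF ind y] by simp
      qed
      also have "\<dots> \<in> Grho"
        by (rule spread_block[OF indep_sub[OF ind sub] _ _ disD(1)[OF disA uv] k]) (use a(3) in auto)
      finally show "k \<in> {h \<in> PLc (ivls \<A>). spread \<S> h \<in> Grho}"
        using PLc_mono[OF k ivls_member[OF uv]] by simp
    qed
    then show ?thesis by simp
  qed
  have fP: "f x = x" if H: "p \<in> P" "\<bar>x - p\<bar> < \<delta>" for x p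
  proof -
    obtain \<sigma> where s: "\<sigma> \<in> occs m" "p = \<sigma> 0" using H(1) by (auto simp: P_def)
    then have i: "isom \<sigma>" by (simp add: occs_def)
    have "\<bar>iv \<sigma> x\<bar> < \<delta>" using isom_dist[OF i, of "iv \<sigma> x" 0] isom_f_iv[OF i] H(2) s(2) by simp
    then show ?thesis using \<delta>(2)[OF s(1), of "iv \<sigma> x"] isom_f_iv[OF i] by simp
  qed
  have fH: "f \<in> Homeo" using gpD(1)[OF perm_group_Grho f] .
  have cutB: "cut f u v \<in> PLc {u<..<v}" if uv: "(u,v) \<in> \<A>" for u v
  proof (rule cut_local_PLc[OF fH Grho_local(1)[OF f] disD[OF disA uv], where c = "u + \<delta>"
    and c' = "v - \<delta>"])
    have P: "u \<in> P" "v \<in> P" using AJ(1)[OF uv] JD by blast+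
    show "f u = u" "f v = v" using fP[OF P(1), of u] fP[OF P(2), of v] \<delta>(1) by auto
    show "u < u + \<delta>" "v - \<delta> < v" using \<delta>(1) by auto
    show "f x = x" if "u < x" "x < v" "x < u + \<delta> \<or> v - \<delta> < x" for x
      using fP[OF P(1), of x] fP[OF P(2), of x] that by auto
  qed
  \<comment> \<open>\<open>h\<close> consists of the restrictions of \<open>f\<close> to the
    representatives. Equivariance with margin \<open>M\<close> recovers \<open>f\<close> on every
    other gap.\<close>
  obtain h where h: "h \<in> PLc (ivls \<A>)" "\<And>u v x. (u,v) \<in> \<A> \<Longrightarrow> u < x \<Longrightarrow> x < v \<Longrightarrow> h x = cut f u v x"
    using PLc_glue[OF finA disA, of "cut f"] cutB by blast
  have "f = spread \<S> h"
  proof (rule spread_eqI[OF ind subset_refl])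
    fix x assume x: "x \<notin> region \<S>"
    have "x \<in> P"
    proof (rule ccontr)
      assume "x \<notin> P"
      then obtain p q where pq: "(p,q) \<in> J" "p < x" "x < q" using J_cover by blast
      obtain u v where uv: "c (p,q) = (u,v)" by (cases "c (p,q)")
      have J: "(u,v) \<in> J" "rel (u,v) (p,q)" using cJ[OF pq(1)] rel_sym[OF pq(1)] uv by auto
      obtain \<sigma>
        where s: "isom \<sigma>" "matches \<rho> {u - a..v + a} \<sigma>" "\<sigma> u = p \<and> \<sigma> v = q \<or> \<sigma> u = q \<and> \<sigma> v = p"
        using J(2) by (auto simp: rel_def)
      have "(u,v) \<in> \<A>" using uv pq(1) by (metis \<A>_def imageI)
      then have S: "(\<sigma>,u,v) \<in> \<S>" using s by (simp add: \<S>_def)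
      have fx: "\<sigma> (iv \<sigma> x) = x" by (rule isom_f_iv[OF s(1)])
      then have "iv \<sigma> x \<noteq> u" "iv \<sigma> x \<noteq> v" using s(3) pq(2,3) by auto
      moreover have "iv \<sigma> x \<in> {u - 0..v + 0}"
        using isom_ends[OF s(1) JD(3)[OF J(1)] JD(3)[OF pq(1)] s(3), of "iv \<sigma> x" 0] fx pq(2,3)
        by simp
      ultimately have "u < iv \<sigma> x" "iv \<sigma> x < v" by auto
      then show False using x S fx unfolding region_iff by metis
    qed
    then show "f x = x" using fP[of x x] \<delta>(1) by simp
  next
    fix \<sigma> u v y assume y: "(\<sigma>,u,v) \<in> \<S>" "u < y" "y < v"
    note s = SD[OF y(1)]
    have "{y - M..y + M} \<subseteq> {u - a..v + a}" using y a(2) by auto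
    then have "f (\<sigma> y) = \<sigma> (f y)" using MD(2) s(2,3) matches_mono unfolding equivariant_def by blast
    moreover have "h y = f y" using h(2)[OF s(1) y(2,3)] y(2,3) by (simp add: cut_def)
    ultimately show "f (\<sigma> y) = \<sigma> (if (\<sigma>,u,v) \<in> \<S> then h y else y)" using y(1) by simp
  qed
  moreover have "conj_prod g 8 (spread \<S> h)"
  proof (rule fam8[OF finA disA ind _ LG _ h(1)])
    show "(u,v) \<in> \<A> \<and> matches \<rho> {u..v} \<sigma>" if "(\<sigma>,u,v) \<in> \<S>" for \<sigma> u v
      using SD[OF that] matches_mono[of \<rho> "{u - a..v + a}" \<sigma> "{u..v}"] a(3) by auto
    show "R \<le> v - u" if uv: "(u,v) \<in> \<A>" for u v
    proof -
      note J = AJ(1)[OF uv]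
      obtain \<sigma> \<tau> where "\<sigma> \<in> occs m" "u = \<sigma> 0" "\<tau> \<in> occs m" "v = \<tau> 0" using JD(1,2)[OF J]
        by (auto simp: P_def)
      then show ?thesis using sparse[of \<tau> \<sigma>] JD(3)[OF J] by auto
    qed
  qed
  ultimately show ?thesis by simp
qed

text \<open>\<open>f\<close> need not fix marked points, so it does not split along them. A
  compactly supported map that agrees with \<open>f\<close> near 0 is therefore spread over all
  occurrences and divided out; what remains is trivial near every mark and falls under
  \<open>conj_prod_marked\<close>. Each of the two factors costs eight conjugates.\<close>

lemma conj_prod_all:
  assumes f: "f \<in> Grho" and g: "g \<in> Grho" "g \<noteq> id"
  shows "conj_prod g 16 f"
proof -
  obtain R where R: "R > 0" and fam8: "\<And>\<A> \<S> h. finite \<A> \<Longrightarrow> disjoint_ivls \<A> \<Longrightarrow> indep \<S> \<Longrightarrow>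
      (\<And>\<sigma> u v. (\<sigma>,u,v) \<in> \<S> \<Longrightarrow> (u,v) \<in> \<A> \<and> matches \<rho> {u..v} \<sigma>) \<Longrightarrow>
      (\<And>h. h \<in> PLc (ivls \<A>) \<Longrightarrow> spread \<S> h \<in> Grho) \<Longrightarrow>
      (\<And>u v. (u,v) \<in> \<A> \<Longrightarrow> R \<le> v - u) \<Longrightarrow> h \<in> PLc (ivls \<A>) \<Longrightarrow> conj_prod g 8 (spread \<S> h)"
    by (rule conj_prod_family[OF g]) blast
  obtain M where M: "0 \<le> M" "equivariant \<rho> M f" using Grho_equivariant[OF f] by blast
  obtain h where h: "h \<in> PLc UNIV" "\<forall>\<^sub>F y in nhds 0. h y = f y" using Grho_local(2)[OF f] by blast
  obtain \<delta>0 where \<delta>0: "\<delta>0 > 0" "\<And>y. \<bar>y\<bar> < \<delta>0 \<Longrightarrow> h y = f y"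
    using h(2) unfolding eventually_nhds_metric dist_real_def by auto
  obtain C where C: "compact C" "\<And>x. x \<notin> C \<Longrightarrow> h x = x" using h(1) by (auto simp: PLc_def)
  obtain b where b: "\<And>x. x \<in> C \<Longrightarrow> \<bar>x\<bar> \<le> b"
    using compact_imp_bounded[OF C(1)] unfolding bounded_iff real_norm_def by blast
  \<comment> \<open>\<open>b + 1\<close> puts the support of \<open>h\<close> inside
    \<open>{- ?L<..<?L}\<close>, \<open>R\<close> makes this interval long enough for
    \<open>fam8\<close>, and 1 makes it contain the neighbourhood of 0 used below.\<close>
  obtain n :: nat where n: "max (max (b + 1) R) 1 \<le> real n" using real_arch_simple by blast
  let ?L = "real n"
  have hB: "h \<in> PLc {- ?L<..<?L}"
  proof -
    have "C \<subseteq> {- ?L<..<?L}"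
    proof
      fix x assume "x \<in> C"
      then have "\<bar>x\<bar> < ?L" using b[of x] n by simp
      then show "x \<in> {- ?L<..<?L}" by (simp add: abs_less_iff)
    qed
    then show ?thesis using h(1) C by (auto simp: PLc_def)
  qed
  obtain m0 where m0: "\<And>\<sigma> \<tau>. \<sigma> \<in> occs m0 \<Longrightarrow> \<tau> \<in> occs m0 \<Longrightarrow> \<sigma> \<noteq> \<tau> \<Longrightarrow> 2 * ?L < \<bar>\<sigma> 0 - \<tau> 0\<bar>"
    using sparse[of "2 * ?L"] by blast
  \<comment> \<open>\<open>m0\<close> keeps marks more than \<open>2 * ?L\<close> apart, so that
    copies are disjoint; \<open>?L + 1/2\<close> is the margin of \<open>spread_block\<close>;
    \<open>M + 1\<close> covers the radius of \<open>f\<close> at points within 1 of 0.\<close>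
  define m where "m = max m0 (max (?L + 1/2) (M + 1))"
  have m: "m0 \<le> m" "?L + 1/2 \<le> m" "M + 1 \<le> m" by (auto simp: m_def)
  have slope: "2 * ?L < \<bar>\<sigma> 0 - \<tau> 0\<bar>" if "\<sigma> \<in> occs m" "\<tau> \<in> occs m" "\<sigma> \<noteq> \<tau>" for \<sigma> \<tau>
    using m0 that occs_mono[OF m(1)] by blast
  let ?S = "copies (matches \<rho> {- m..m}) (- ?L) ?L"
  have ind: "indep ?S"
    unfolding indep_def
  proof (intro conjI allI impI)
    show "\<forall>(\<sigma>,u,v)\<in>?S. isom \<sigma>" by (auto simp: copies_def)
    fix \<sigma> u v \<tau> u' v' x y
    assume s: "(\<sigma>,u,v) \<in> ?S" "(\<tau>,u',v') \<in> ?S" "u < x" "x < v" "u' < y" "y < v'" "\<sigma> x = \<tau> y"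
    then have i: "isom \<sigma>" "isom \<tau>" "\<sigma> \<in> occs m" "\<tau> \<in> occs m" "\<bar>x\<bar> < ?L" "\<bar>y\<bar> < ?L"
      by (auto simp: copies_iff occs_def abs_less_iff)
    have "\<bar>\<sigma> 0 - \<sigma> x\<bar> = \<bar>x\<bar>" "\<bar>\<tau> y - \<tau> 0\<bar> = \<bar>y\<bar>"
      using isom_dist[OF i(1), of 0 x] isom_dist[OF i(2), of y 0] by auto
    then have "\<bar>\<sigma> 0 - \<tau> 0\<bar> < 2 * ?L" using i(5,6) s(7) by linarith
    then show "\<sigma> = \<tau>" using slope[OF i(3,4)] by fastforce
    show "u = u'" "v = v'" using s by (auto simp: copies_iff)
  qed
  have L0: "- ?L < ?L" using n by simp
  have LG: "spread ?S k \<in> Grho" if "k \<in> PLc {- ?L<..<?L}" for k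
    by (rule spread_block[OF ind _ _ L0 that]) (use m in auto)
  have iv1: "ivls {(- ?L, ?L)} = {- ?L<..<?L}" by (auto simp: ivls_def)
  have "conj_prod g 8 (spread ?S h)"
  proof (rule fam8[of "{(- ?L, ?L)}"])
    show "disjoint_ivls {(- ?L, ?L)}"
      unfolding disjoint_ivls_def using L0 dyadic_of_int[of "int n"] by auto
    show "(u,v) \<in> {(- ?L, ?L)} \<and> matches \<rho> {u..v} \<sigma>" if "(\<sigma>,u,v) \<in> ?S" for \<sigma> u v
      using that m(2) matches_mono[of \<rho> "{- m..m}" \<sigma> "{- ?L..?L}"] by (auto simp: copies_iff)
    show "R \<le> v - u" if "(u,v) \<in> {(- ?L, ?L)}" for u v using that n by auto
  qed (use ind LG hB in \<open>simp_all only: iv1 finite.emptyI finite.insertI\<close>)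
  moreover
  let ?f = "iv (spread ?S h) \<circ> f"
  have l: "spread ?S h \<in> Grho" by (rule LG[OF hB])
  have lH: "spread ?S h \<in> Homeo" using gpD(1)[OF perm_group_Grho l] .
  have "conj_prod g 8 ?f"
  proof (rule conj_prod_marked[where R = R and m = m and \<delta> = "min \<delta>0 1"])
    show "?f \<in> Grho" using gpD(3)[OF perm_group_Grho gpD(4)[OF perm_group_Grho l] f] .
    show "0 < min \<delta>0 1" using \<delta>0 by simp
    show "R \<le> \<bar>\<sigma> 0 - \<tau> 0\<bar>" if "\<sigma> \<in> occs m" "\<tau> \<in> occs m" "\<sigma> \<noteq> \<tau>" for \<sigma> \<tau>
      using slope[OF that] n by linarith
    fix \<sigma> x assume s: "\<sigma> \<in> occs m" and x: "\<bar>x\<bar> < min \<delta>0 1"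
    have i: "isom \<sigma>" "matches \<rho> {- m..m} \<sigma>" using s by (auto simp: occs_def)
    have "{x - M..x + M} \<subseteq> {- m..m}" using x m(3) by auto
    then have "f (\<sigma> x) = \<sigma> (f x)" using M(2) i matches_mono unfolding equivariant_def by blast
    also have "f x = h x" using \<delta>0(2) x by simp
    also have "\<sigma> (h x) = spread ?S h (\<sigma> x)"
    proof (rule spread_in[OF ind, symmetric])
      show "(\<sigma>, - ?L, ?L) \<in> ?S" using i by (simp add: copies_iff)
      show "- ?L < x" "x < ?L" using x n by linarith+
    qed
    finally show "?f (\<sigma> x) = \<sigma> x" using lH by simp
  qed (rule fam8)
  ultimately have "conj_prod g (8 + 8) (spread ?S h \<circ> ?f)" by (intro conj_prod_comp)
  moreover have "spread ?S h \<circ> ?f = f" using lH by (auto simp: fun_eq_iff f_iv)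
  ultimately show ?thesis by simp
qed

end

section \<open>Translation to the group structure of \<open>G_rho\<close>\<close>

lemma inv_subgroup:
  assumes "subgroup H (homeo_plus UNIV)" "f \<in> H"
  shows "inv\<^bsub>(homeo_plus UNIV)\<lparr>carrier := H\<rparr>\<^esub> f = iv f"
proof -
  have "f \<in> Homeo" using assms subgroup.subset Homeo_carrier by blast
  then show ?thesis
    using group.m_inv_consistent[OF group_homeo_plus assms] homeo_inv by simp
qed

theorem theorem1p5:
  fixes c0 \<nu>2 \<nu>3 :: "real \<Rightarrow> real" and \<rho> :: "real \<Rightarrow> letter"
  assumes c0_F: "c0 \<in> thompson_F"
    and c0_supp: "supp c0 = {0<..<1/4}"
    and c0_up: "\<forall>x\<in>{0<..<1/4}. c0 x > x"
    and c0_double: "\<forall>t\<in>{0<..<1/16}. c0 t = 2 * t"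
    and nu2: "\<nu>2 \<in> carrier (homeo_plus {0..1})" "supp \<nu>2 \<subseteq> {1/16<..<15/16}"
    and nu3: "\<nu>3 \<in> carrier (homeo_plus {0..1})" "supp \<nu>3 \<subseteq> {1/16<..<15/16}"
    and nu_gen: "generate (homeo_plus {0..1}) {\<nu>2, \<nu>3} = F_on (1/16) (15/16)"
    and lab: "labelling \<rho>"
    and qp: "quasi_periodic \<rho>"
  shows "uniformly_simple (G_rho \<rho> {nu1 c0, \<nu>2, \<nu>3})"
proof -
  interpret labelled_gens c0 \<nu>2 \<nu>3 \<rho>
    by unfold_locales (fact assms)+
  let ?G = "G_rho \<rho> {nu1 c0, \<nu>2, \<nu>3}"
  have G: "?G = (homeo_plus UNIV)\<lparr>carrier := Grho\<rparr>" by (simp add: G_rho_def Grho_def)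
  have sub: "subgroup Grho (homeo_plus UNIV)"
    unfolding Grho_def
    by (rule group.generate_is_subgroup[OF group_homeo_plus]) (simp only: Homeo_carrier generators_Homeo)
  have car: "carrier ?G = Grho" and mult: "x \<otimes>\<^bsub>?G\<^esub> y = y \<circ> x" and one: "\<one>\<^bsub>?G\<^esub> = id" for x y
    unfolding G by (simp_all add: homeo_plus_def fcomp_comp)
  have inv: "inv\<^bsub>?G\<^esub> x = iv x" if "x \<in> Grho" for x
    unfolding G by (rule inv_subgroup[OF sub that])
  \<comment> \<open>Maps act on the right, so \<open>\<otimes>\<close> is composition in the
    opposite order and \<open>s \<circ> e \<circ> iv s\<close> is the conjugate of \<open>e\<close>
    by \<open>s\<close> in the sense of \<open>conj_class\<close>.\<close>
  have conj: "s \<circ> e \<circ> iv s \<in> conj_class ?G e" if "s \<in> Grho" for s e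
  proof -
    have "s \<circ> e \<circ> iv s = inv\<^bsub>?G\<^esub> s \<otimes>\<^bsub>?G\<^esub> e \<otimes>\<^bsub>?G\<^esub> s"
      unfolding inv[OF that] mult by (simp only: comp_assoc)
    then show ?thesis unfolding conj_class_def car using that by blast
  qed
  have list: "\<exists>gs. length gs = n \<and> set gs \<subseteq> conj_class ?G g \<union> conj_class ?G (inv\<^bsub>?G\<^esub> g) \<and>
      f = foldr (\<otimes>\<^bsub>?G\<^esub>) gs \<one>\<^bsub>?G\<^esub>" if "conj_prod g n f" "g \<in> Grho" for g n f
    using that(1)
  proof (induction rule: conj_prod.induct)
    case conj_prod_id
    then show ?case by (simp add: one)
  next
    case (conj_prod_step s e n f)
    then obtain gs where gs: "length gs = n" "set gs \<subseteq> conj_class ?G g \<union> conj_class ?G (inv\<^bsub>?G\<^esub> g)"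
      "f = foldr (\<otimes>\<^bsub>?G\<^esub>) gs \<one>\<^bsub>?G\<^esub>" by blast
    let ?x = "s \<circ> e \<circ> iv s"
    have "?x \<in> conj_class ?G g \<union> conj_class ?G (inv\<^bsub>?G\<^esub> g)"
      using conj[OF conj_prod_step(1), of e] conj_prod_step(2) inv[OF that(2)] by auto
    then have "set (?x # gs) \<subseteq> conj_class ?G g \<union> conj_class ?G (inv\<^bsub>?G\<^esub> g)" using gs(2) by simp
    \<comment> \<open>The factor composed on the right is applied first, so it becomes the head of
      the list.\<close>
    moreover have "f \<circ> ?x = foldr (\<otimes>\<^bsub>?G\<^esub>) (?x # gs) \<one>\<^bsub>?G\<^esub>" using gs(3) by (simp add: mult)
    ultimately show ?case using gs(1) by (intro exI[of _ "?x # gs"]) simp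
  qed
  have "group ?G" unfolding G by (rule group.subgroup_imp_group[OF group_homeo_plus sub])
  moreover have "\<exists>gs. length gs \<le> 16 \<and> set gs \<subseteq> conj_class ?G g \<union> conj_class ?G (inv\<^bsub>?G\<^esub> g) \<and>
      f = foldr (\<otimes>\<^bsub>?G\<^esub>) gs \<one>\<^bsub>?G\<^esub>"
    if "f \<in> Grho - {id}" "g \<in> Grho - {id}" for f g
  proof -
    have "f \<in> Grho" "g \<in> Grho" "g \<noteq> id" using that by auto
    from list[OF conj_prod_all[OF this] this(2)] show ?thesis by (metis order_refl)
  qed
  ultimately have "N_uniformly_simple 16 ?G"
    unfolding N_uniformly_simple_def car one by blast
  then show ?thesis unfolding uniformly_simple_def by blast
qed

end
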